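(* Let $\mathcal{G}$ be a nonlocal game and $K>0$. There exist constants $C>0$, $\epsilon_0>0$ depending only on $\mathcal G$ and $K$ such that for every $0\le\epsilon\le\epsilon_0$ and every $d\ge1$: \begin{enumerate} \item If $\mathcal G$ is a synchronous game and $\phi$ is an $\epsilon$-representation of $\mathcal A(\mathcal G)$ on $\mathbb C^d$ with respect to $\|\cdot\|_f$ with $\|\phi(p^i_a)\|_{op}\le K$ for all $(i,a)$, then there is a synchronous strategy for $\mathcal G$ using the maximally entangled state on $\mathbb C^d\otimes\mathbb C^d$, with Bob's projections $Q^i_a$ satisfying $\|Q^i_a-\phi(p^i_a)\|_f\le C\epsilon$ for all $(i,a)$, whose winning probability is at least $1-C\epsilon^2$. \item If $\mathcal G$ is a BCS game and $\phi$ is an $\epsilon$-representation of $\mathcal B(\mathcal G)$ on $\mathbb C^d$ with respect to $\|\cdot\|_f$ with $\|\phi(x_j)\|_{op}\le K$ for all $j$, then there is a quantum strategy for $\mathcal G$ using the maximally entangled state on $\mathbb C^d\otimes\mathbb C^d$, with Bob's observables $X_j$ satisfying $\|X_j-\phi(x_j)\|_f\le C\epsilon$ for all $j$, whose winning probability is at least $1-C\epsilon^2$. \item If $\mathcal G$ is an XOR game whose marginal row biases are all non-zero, and $\phi$ is an $\epsilon$-representation of $\mathcal C(\mathcal G)$ on $\mathbb C^d$ with respect to $\|\cdot\|_f$ with $\|\phi(s_j)\|_{op}\le K$ for all $j$, then there is a quantum strategy for $\mathcal G$ using the maximally entangled state on $\mathbb C^d\otimes\mathbb C^d$, with Bob's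 observables $X_j$ satisfying $\|X_j-\phi(s_j)\|_f\le C\epsilon$ for all $j$, whose bias is at least $\beta^*(\mathcal G)-C\epsilon$. \end{enumerate}
   Context: Norms: for an operator $A$ on a finite-dimensional Hilbert space of dimension $d$, $\|A\|_{op}$ is the operator norm, $\|A\|_F=\mathrm{tr}(A^*A)^{1/2}$ the Frobenius norm and $\|A\|_f=\|A\|_F/\sqrt d$ the little Frobenius norm. Finitely presented algebras: $\mathbb{C}^*\langle S:R\rangle$ is the quotient of the free unital complex $*$-algebra $\mathbb{C}^*\langle S\rangle$ on a finite set $S$ by the two-sided $*$-ideal generated by a finite set $R$; a relation written $a=b$ stands for $a-b\in R$. Given a (semi)norm $\|\cdot\|$ on operators on $H$, an $\epsilon$-representation is a unital $*$-homomorphism $\phi:\mathbb{C}^*\langle S\rangle\to\mathcal L(H)$ (determined by the $\phi(s)$, $s\in S$) with $\|\phi(r)\|\le\epsilon$ for all $r\in R$. Nonlocal games and strategies: a game $\mathcal{G}=(\eta,I,J,A,B,V)$ has finite input sets $I,J$, output sets $A,B$, a probability distribution $\eta$ on $I\times J$ and a predicate $V:A\times B\times I\times J\to\{0,1\}$. A quantum strategy consists of a finite-dimensional Hilbert space $H$, projection-valued measures $\{E^i_a\}_{a}$ for Alice and $\{F^j_b\}_b$ for Bob on $H$, and a unit vector $|\psi\rangle\in H\otimes H$; its winning probability is $\sum_{i,j}\eta(i,j)\sum_{a,b}V(a,b|i,j)\langle\psi|E^i_a\otimes F^j_b|\psi\rangle$. The maximally entangled state on $\mathbb C^d\otimes\mathbb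 C^d$ is $d^{-1/2}\sum_t|t\rangle\otimes|t\rangle$ for an orthonormal basis $\{|t\rangle\}$; $\overline X$ denotes entrywise complex conjugation in this basis. Synchronous games: $I=J$, $A=B$, $V(a,b|i,i)=0$ whenever $a\ne b$, $\eta(i,j)>0$ for all $i,j$. A synchronous strategy is one with $E^i_a=\overline{F^i_a}$. The synchronous algebra $\mathcal A(\mathcal G)$ has generators $p^i_a$ and relations $(p^i_a)^2=p^i_a=(p^i_a)^*$, $\sum_{a}p^i_a=1$ for each $i$, and $p^i_ap^j_b=0$ whenever $V(a,b|i,j)=0$. BCS games: variables $x_1,\dots,x_n$, constraints $C_1,\dots,C_m$ with scopes $K_i$, each encoded by the unique real multilinear polynomial $f_i=\sum_{\alpha\subseteq K_i}\hat f^{(i)}_\alpha x^\alpha$ (products in increasing order of index) equal to $-1$ exactly on satisfying assignments in $\{\pm1\}^{K_i}$ and $1$ otherwise. Alice gets $i$, answers a satisfying assignment of $K_i$; Bob gets $j$, answers a value in $\{\pm1\}$; inputs are drawn from $\eta$; they win iff $x_j\notin K_i$ or their values for $x_j$ agree. A quantum strategy consists of, for each $i$, pairwise commuting self-adjoint unitaries $Y_{ij}$ ($x_j\in K_i$) with $f_i(Y_{ij}:x_j\in K_i)=-\mathbb 1$, Bob's self-adjoint unitaries $X_j$, and a state $|\psi\rangle$; winning probability $\sum_{i,j}\eta(i,j)p_{ij}$ with $p_{ij}=1$ if $x_j\notin K_i$ and $p_{ij}=\frac12(1+\langle\psi|Y_{ij}\otimes X_j|\psi\rangle)$ otherwise.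 The BCS algebra $\mathcal B(\mathcal G)$ has generators $x_1,\dots,x_n$ and relations $x_j^*=x_j$, $x_j^2=1$, $f_i(K_i)=-1$, and $x_jx_{j'}=x_{j'}x_j$ whenever $x_j,x_{j'}\in K_i$ for some $i$. XOR games: an $m\times n$ $(0,1)$-matrix $(t_{ij})$ and distribution $\pi$; cost matrix $g_{ij}=(-1)^{t_{ij}}\pi(i,j)$. A strategy consists of self-adjoint unitaries $Y_1,\dots,Y_m$ (Alice), $X_1,\dots,X_n$ (Bob) and a state $|\psi\rangle$; bias $\beta=\sum_{i,j}g_{ij}\langle\psi|Y_i\otimes X_j|\psi\rangle$, optimal bias $\beta^*(\mathcal G)$ is the supremum. The marginal row biases are the real constants $c_i$ such that every optimal strategy satisfies $\sum_j g_{ij}(\mathbb 1\otimes X_j)|\psi\rangle=c_i(Y_i\otimes\mathbb 1)|\psi\rangle$ and $c_i=\sum_jg_{ij}\langle\psi|Y_i\otimes X_j|\psi\rangle$; thus $\sum_ic_i=\beta^*$. The solution algebra $\mathcal C(\mathcal G)$ has generators $s_1,\dots,s_n$ and relations $s_j=s_j^*$, $s_j^2=1$, $(\sum_jg_{ij}s_j)^2=c_i^2$ for all $i$. *)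

theory Defs
  imports "Jordan_Normal_Form.Matrix" "HOL-Library.Multiset"
begin

definition cadj :: "complex mat \<Rightarrow> complex mat" where
  "cadj A = mat (dim_col A) (dim_row A) (\<lambda>(i,j). cnj (A $$ (j,i)))"

definition cconj :: "complex mat \<Rightarrow> complex mat" where
  "cconj A = map_mat cnj A"

definition mtrace :: "complex mat \<Rightarrow> complex" where
  "mtrace A = (\<Sum>i<dim_row A. A $$ (i,i))"

definition frob_norm :: "complex mat \<Rightarrow> real" where
  "frob_norm A = sqrt (Re (mtrace (cadj A * A)))"

definition lfrob :: "complex mat \<Rightarrow> real" where
  "lfrob A = frob_norm A / sqrt (real (dim_row A))"

definition vnorm :: "complex vec \<Rightarrow> real" where
  "vnorm v = sqrt (\<Sum>i<dim_vec v. (cmod (v $ i))\<^sup>2)"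

definition op_norm :: "complex mat \<Rightarrow> real" where
  "op_norm A = Sup {vnorm (A *\<^sub>v v) | v. v \<in> carrier_vec (dim_col A) \<and> vnorm v = 1}"

text \<open>Kronecker product; basis vector |s> \<otimes> |t> of C^d \<otimes> C^d has index s*d+t\<close>
definition kron :: "complex mat \<Rightarrow> complex mat \<Rightarrow> complex mat" where
  "kron A B = mat (dim_row A * dim_row B) (dim_col A * dim_col B)
     (\<lambda>(i,j). A $$ (i div dim_row B, j div dim_col B) * B $$ (i mod dim_row B, j mod dim_col B))"

definition max_ent :: "nat \<Rightarrow> complex vec" where
  "max_ent d = vec (d*d) (\<lambda>k. if k div d = k mod d then complex_of_real (1 / sqrt (real d)) else 0)"

definition expect :: "complex vec \<Rightarrow> complex mat \<Rightarrow> complex" where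
  "expect psi M = (\<Sum>k<dim_vec psi. cnj (psi $ k) * (M *\<^sub>v psi) $ k)"

definition is_proj :: "nat \<Rightarrow> complex mat \<Rightarrow> bool" where
  "is_proj d P \<longleftrightarrow> P \<in> carrier_mat d d \<and> P * P = P \<and> cadj P = P"

definition is_obs :: "nat \<Rightarrow> complex mat \<Rightarrow> bool" where
  "is_obs d X \<longleftrightarrow> X \<in> carrier_mat d d \<and> cadj X = X \<and> X * X = 1\<^sub>m d"

datatype 'g spoly = Gen 'g | Cst complex | Add "'g spoly" "'g spoly"
  | Mul "'g spoly" "'g spoly" | Star "'g spoly"

primrec seval :: "nat \<Rightarrow> ('g \<Rightarrow> complex mat) \<Rightarrow> 'g spoly \<Rightarrow> complex mat" where
  "seval d \<phi> (Gen s) = \<phi> s"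
| "seval d \<phi> (Cst c) = c \<cdot>\<^sub>m 1\<^sub>m d"
| "seval d \<phi> (Add p q) = seval d \<phi> p + seval d \<phi> q"
| "seval d \<phi> (Mul p q) = seval d \<phi> p * seval d \<phi> q"
| "seval d \<phi> (Star p) = cadj (seval d \<phi> p)"

definition Sub :: "'g spoly \<Rightarrow> 'g spoly \<Rightarrow> 'g spoly" where
  "Sub p q = Add p (Mul (Cst (-1)) q)"

text \<open>finite sum of terms (evaluation is independent of the chosen enumeration)\<close>
definition ssum :: "('b \<Rightarrow> 'g spoly) \<Rightarrow> 'b set \<Rightarrow> 'g spoly" where
  "ssum f A = foldr (\<lambda>x acc. Add (f x) acc) (SOME xs. distinct xs \<and> set xs = A) (Cst 0)"

definition smono :: "'g::linorder set \<Rightarrow> 'g spoly" where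
  "smono \<alpha> = foldr (\<lambda>j acc. Mul (Gen j) acc) (sorted_list_of_set \<alpha>) (Cst 1)"

definition eps_rep :: "(complex mat \<Rightarrow> real) \<Rightarrow> nat \<Rightarrow> 'g spoly set \<Rightarrow> real \<Rightarrow> ('g \<Rightarrow> complex mat) \<Rightarrow> bool" where
  "eps_rep nrm d R \<epsilon> \<phi> \<longleftrightarrow> (\<forall>s. \<phi> s \<in> carrier_mat d d) \<and> (\<forall>r\<in>R. nrm (seval d \<phi> r) \<le> \<epsilon>)"

definition prob_dist :: "('x \<Rightarrow> 'y \<Rightarrow> real) \<Rightarrow> bool" where
  "prob_dist \<eta> \<longleftrightarrow> (\<forall>i j. \<eta> i j \<ge> 0) \<and> (\<Sum>i\<in>UNIV. \<Sum>j\<in>UNIV. \<eta> i j) = 1"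

definition sync_game :: "('i::finite \<Rightarrow> 'i \<Rightarrow> real) \<Rightarrow> ('a::finite \<Rightarrow> 'a \<Rightarrow> 'i \<Rightarrow> 'i \<Rightarrow> bool) \<Rightarrow> bool" where
  "sync_game \<eta> V \<longleftrightarrow> prob_dist \<eta> \<and> (\<forall>i j. \<eta> i j > 0) \<and> (\<forall>a b i. a \<noteq> b \<longrightarrow> \<not> V a b i i)"

definition sync_rels :: "('a::finite \<Rightarrow> 'a \<Rightarrow> 'i::finite \<Rightarrow> 'i \<Rightarrow> bool) \<Rightarrow> ('i \<times> 'a) spoly set" where
  "sync_rels V =
     {Sub (Mul (Gen (i,a)) (Gen (i,a))) (Gen (i,a)) | i a. True}
   \<union> {Sub (Gen (i,a)) (Star (Gen (i,a))) | i a. True}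
   \<union> {Sub (ssum (\<lambda>a. Gen (i,a)) UNIV) (Cst 1) | i. True}
   \<union> {Mul (Gen (i,a)) (Gen (j,b)) | i a j b. \<not> V a b i j}"

text \<open>Bob's PVMs Q on C^d (Alice uses the entrywise conjugates)\<close>
definition sync_strategy :: "nat \<Rightarrow> ('i::finite \<times> 'a::finite \<Rightarrow> complex mat) \<Rightarrow> bool" where
  "sync_strategy d Q \<longleftrightarrow> (\<forall>ia. is_proj d (Q ia)) \<and>
     (\<forall>i. foldr (+) (map (\<lambda>a. Q (i,a)) (SOME xs. distinct xs \<and> set xs = UNIV)) (0\<^sub>m d d) = 1\<^sub>m d)"

definition sync_winprob :: "('i::finite \<Rightarrow> 'i \<Rightarrow> real) \<Rightarrow> ('a::finite \<Rightarrow> 'a \<Rightarrow> 'i \<Rightarrow> 'i \<Rightarrow> bool)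
    \<Rightarrow> ('i \<times> 'a \<Rightarrow> complex mat) \<Rightarrow> complex vec \<Rightarrow> real" where
  "sync_winprob \<eta> V Q \<psi> = (\<Sum>i\<in>UNIV. \<Sum>j\<in>UNIV. \<eta> i j * (\<Sum>a\<in>UNIV. \<Sum>b\<in>UNIV.
      of_bool (V a b i j) * Re (expect \<psi> (kron (cconj (Q (i,a))) (Q (j,b))))))"

text \<open>{+-1}-valued assignments to the variables in the scope K (extended by 1 outside K)\<close>
definition cube :: "'v set \<Rightarrow> ('v \<Rightarrow> real) set" where
  "cube K = {x. (\<forall>j\<in>K. x j = 1 \<or> x j = -1) \<and> (\<forall>j. j \<notin> K \<longrightarrow> x j = 1)}"

definition bcs_game :: "('c::finite \<Rightarrow> 'v::{finite,linorder} \<Rightarrow> real) \<Rightarrow> ('c \<Rightarrow> 'v set)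
    \<Rightarrow> ('c \<Rightarrow> ('v \<Rightarrow> real) set) \<Rightarrow> bool" where
  "bcs_game \<eta> K Sat \<longleftrightarrow> prob_dist \<eta> \<and> (\<forall>i. Sat i \<subseteq> cube (K i))"

text \<open>coefficients of the unique multilinear polynomial f_i (equal to -1 on satisfying
  assignments and 1 otherwise)\<close>
definition bcs_coef :: "('c \<Rightarrow> 'v set) \<Rightarrow> ('c \<Rightarrow> ('v \<Rightarrow> real) set) \<Rightarrow> 'c \<Rightarrow> 'v set \<Rightarrow> real" where
  "bcs_coef K Sat i = (THE f. (\<forall>\<alpha>. \<not> \<alpha> \<subseteq> K i \<longrightarrow> f \<alpha> = 0) \<and>
      (\<forall>x\<in>cube (K i). (\<Sum>\<alpha>\<in>Pow (K i). f \<alpha> * (\<Prod>j\<in>\<alpha>. x j)) = (if x \<in> Sat i then -1 else 1)))"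

definition bcs_poly :: "('c \<Rightarrow> 'v::linorder set) \<Rightarrow> ('c \<Rightarrow> ('v \<Rightarrow> real) set) \<Rightarrow> 'c \<Rightarrow> 'v spoly" where
  "bcs_poly K Sat i = ssum (\<lambda>\<alpha>. Mul (Cst (complex_of_real (bcs_coef K Sat i \<alpha>))) (smono \<alpha>)) (Pow (K i))"

definition bcs_rels :: "('c \<Rightarrow> 'v::linorder set) \<Rightarrow> ('c \<Rightarrow> ('v \<Rightarrow> real) set) \<Rightarrow> 'v spoly set" where
  "bcs_rels K Sat =
     {Sub (Star (Gen j)) (Gen j) | j. True}
   \<union> {Sub (Mul (Gen j) (Gen j)) (Cst 1) | j. True}
   \<union> {Sub (bcs_poly K Sat i) (Cst (-1)) | i. True}
   \<union> {Sub (Mul (Gen j) (Gen j')) (Mul (Gen j') (Gen j)) | j j' i. j \<in> K i \<and> j' \<in> K i}"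

definition bcs_strategy :: "nat \<Rightarrow> ('c \<Rightarrow> 'v::linorder set) \<Rightarrow> ('c \<Rightarrow> ('v \<Rightarrow> real) set)
    \<Rightarrow> ('c \<Rightarrow> 'v \<Rightarrow> complex mat) \<Rightarrow> ('v \<Rightarrow> complex mat) \<Rightarrow> bool" where
  "bcs_strategy d K Sat Y X \<longleftrightarrow>
     (\<forall>i. \<forall>j\<in>K i. is_obs d (Y i j)) \<and>
     (\<forall>i. \<forall>j\<in>K i. \<forall>j'\<in>K i. Y i j * Y i j' = Y i j' * Y i j) \<and>
     (\<forall>i. seval d (Y i) (bcs_poly K Sat i) = - 1\<^sub>m d) \<and>
     (\<forall>j. is_obs d (X j))"

definition bcs_winprob :: "('c::finite \<Rightarrow> 'v::finite \<Rightarrow> real) \<Rightarrow> ('c \<Rightarrow> 'v set)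
    \<Rightarrow> ('c \<Rightarrow> 'v \<Rightarrow> complex mat) \<Rightarrow> ('v \<Rightarrow> complex mat) \<Rightarrow> complex vec \<Rightarrow> real" where
  "bcs_winprob \<eta> K Y X \<psi> = (\<Sum>i\<in>UNIV. \<Sum>j\<in>UNIV. \<eta> i j *
      (if j \<notin> K i then 1 else (1 + Re (expect \<psi> (kron (Y i j) (X j)))) / 2))"

text \<open>rows 'r (Alice's inputs), columns 'c (Bob's inputs); t i j = True means t_ij = 1\<close>
definition xor_cost :: "('r \<Rightarrow> 'c \<Rightarrow> bool) \<Rightarrow> ('r \<Rightarrow> 'c \<Rightarrow> real) \<Rightarrow> 'r \<Rightarrow> 'c \<Rightarrow> real" where
  "xor_cost t \<pi> i j = (if t i j then -1 else 1) * \<pi> i j"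

definition xor_strategy :: "nat \<Rightarrow> ('r \<Rightarrow> complex mat) \<Rightarrow> ('c \<Rightarrow> complex mat) \<Rightarrow> complex vec \<Rightarrow> bool" where
  "xor_strategy d Y X \<psi> \<longleftrightarrow> (\<forall>i. is_obs d (Y i)) \<and> (\<forall>j. is_obs d (X j)) \<and>
     \<psi> \<in> carrier_vec (d*d) \<and> vnorm \<psi> = 1"

definition xor_bias :: "('r::finite \<Rightarrow> 'c::finite \<Rightarrow> real) \<Rightarrow> ('r \<Rightarrow> complex mat) \<Rightarrow> ('c \<Rightarrow> complex mat) \<Rightarrow> complex vec \<Rightarrow> real" where
  "xor_bias g Y X \<psi> = (\<Sum>i\<in>UNIV. \<Sum>j\<in>UNIV. g i j * Re (expect \<psi> (kron (Y i) (X j))))"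

definition xor_opt_bias :: "('r::finite \<Rightarrow> 'c::finite \<Rightarrow> real) \<Rightarrow> real" where
  "xor_opt_bias g = Sup {xor_bias g Y X \<psi> | d Y X \<psi>. xor_strategy d Y X \<psi>}"

definition xor_optimal :: "('r::finite \<Rightarrow> 'c::finite \<Rightarrow> real) \<Rightarrow> nat \<Rightarrow> ('r \<Rightarrow> complex mat) \<Rightarrow> ('c \<Rightarrow> complex mat) \<Rightarrow> complex vec \<Rightarrow> bool" where
  "xor_optimal g d Y X \<psi> \<longleftrightarrow> xor_strategy d Y X \<psi> \<and> xor_bias g Y X \<psi> = xor_opt_bias g"

definition xor_row_bias :: "('r::finite \<Rightarrow> 'c::finite \<Rightarrow> real) \<Rightarrow> 'r \<Rightarrow> real" where
  "xor_row_bias g i = (THE c. \<forall>d Y X \<psi>. xor_optimal g d Y X \<psi> \<longrightarrow>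
      (\<forall>k<d*d. (\<Sum>j\<in>UNIV. complex_of_real (g i j) * (kron (1\<^sub>m d) (X j) *\<^sub>v \<psi>) $ k)
               = complex_of_real c * (kron (Y i) (1\<^sub>m d) *\<^sub>v \<psi>) $ k) \<and>
      complex_of_real c = (\<Sum>j\<in>UNIV. complex_of_real (g i j) * expect \<psi> (kron (Y i) (X j))))"

definition xor_rels :: "('r::finite \<Rightarrow> 'c::finite \<Rightarrow> real) \<Rightarrow> 'c spoly set" where
  "xor_rels g =
     {Sub (Gen j) (Star (Gen j)) | j. True}
   \<union> {Sub (Mul (Gen j) (Gen j)) (Cst 1) | j. True}
   \<union> {Sub (Mul (ssum (\<lambda>j. Mul (Cst (complex_of_real (g i j))) (Gen j)) UNIV)
               (ssum (\<lambda>j. Mul (Cst (complex_of_real (g i j))) (Gen j)) UNIV))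
          (Cst (complex_of_real ((xor_row_bias g i)\<^sup>2))) | i. True}"

end

theory Submission
  imports Defs "HOL-Analysis.Analysis" "HOL-Computational_Algebra.Fundamental_Theorem_Algebra"
begin

text \<open>The key tool is rounding in normalised Frobenius norm with dimension-free linear loss. If \<open>H\<close> is
  self-adjoint then \<open>S = sgn H\<close> satisfies \<open>\<parallel>S - H\<parallel> \<le> \<parallel>H\<^sup>2 - 1\<parallel>\<close> and commutes with everything that
  commutes with \<open>H\<close>. Averaging an observable over the group generated by commuting observables that
  almost commute with it, and then taking the sign, gives exactly commuting observables nearby.
  For a synchronous game the resulting commuting projections are almost orthogonal and are made
  orthogonal one after the other. For a BCS game the joint spectral projections of unsatisfying
  assignments are small, so their mass can be moved to a satisfying one.
  With the maximally entangled state the losing probabilities are squares of Frobenius distances,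
  hence quadratic in \<open>\<epsilon>\<close>.

  For an XOR game the row biases are computed from the vectors of Alice and Bob: by Tsirelson's theorem the
  optimal bias is the maximum over Gram matrices \<open>W\<close> of the concave function \<open>\<Sum>\<^sub>i sqrt (q\<^sub>i W)\<close>. Strict
  concavity of the square root makes every \<open>q\<^sub>i\<close> constant on the maximisers, so \<open>c\<^sub>i = sqrt (q\<^sub>i W)\<close> and
  the \<open>c\<^sub>i\<close> sum to the optimal bias. Alice then answers with the (conjugated) signs of \<open>\<Sum>\<^sub>j g\<^sub>i\<^sub>j X\<^sub>j\<close>.\<close>

text \<open>The normalised Frobenius norm is submultiplicative only up to a factor sqrt d, so a
  product of two errors has no useful bound. Each product is therefore estimated with one factor in
  operator norm, through \<open>mult_bound\<close>, and one in Frobenius norm. This is where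
  \<open>K\<close> enters, and it keeps every loss linear. Estimates are made in the unnormalised
  norm, with error \<open>\<delta> = \<epsilon> * sqrt (real d)\<close>. Relations become exact by
  successive roundings, and each rounding must preserve what the previous ones achieved. Hence
  spectral projections, signs and orthogonalised projections all carry a bicommutant property.
  \<open>xor_row_bias\<close> is a definite description over all optimal strategies: it denotes the
  intended number only if some optimal strategy exists and all of them agree. Attainment therefore
  has to be proved, by compactness of the set of correlation matrices and a realisation of each of
  its points by anticommuting matrices. The bound \<open>\<epsilon> \<le> 1\<close> rules out BCS
  games with an unsatisfiable constraint, whose relation reads 1 = -1 and is violated by 2.\<close>

unbundle no vec_syntax

section \<open>Finitely supported matrices\<close>

text \<open>Matrices of all sizes live in one type, which is a ring (without unit) and a real inner product
  space for the Frobenius inner product; \<open>d \<times> d\<close> matrices form the corner with unit \<open>eye d\<close> below.\<close>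

typedef finmat = "{A :: nat \<Rightarrow> nat \<Rightarrow> complex. \<exists>n. \<forall>i j. A i j \<noteq> 0 \<longrightarrow> i < n \<and> j < n}"
  morphisms entry Abs_finmat
  by (rule exI[of _ "\<lambda>i j. 0"]) auto

setup_lifting type_definition_finmat

lemma finmat_eqI: "(\<And>i j. entry A i j = entry B i j) \<Longrightarrow> A = B"
  by (metis entry_inject ext)

definition bounded_by :: "finmat \<Rightarrow> nat \<Rightarrow> bool" where
  "bounded_by A n \<longleftrightarrow> (\<forall>i j. entry A i j \<noteq> 0 \<longrightarrow> i < n \<and> j < n)"

lemma bounded_by_mono: "bounded_by A n \<Longrightarrow> n \<le> m \<Longrightarrow> bounded_by A m"
  unfolding bounded_by_def by (meson less_le_trans)

lemma ex_bounded_by: "\<exists>n. bounded_by A n"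
  using entry[of A] unfolding bounded_by_def by auto

lemma entry_eq_0: "bounded_by A n \<Longrightarrow> i \<ge> n \<or> j \<ge> n \<Longrightarrow> entry A i j = 0"
  unfolding bounded_by_def by (meson leD)

lemma common_bound2: obtains n where "bounded_by A n" "bounded_by B n"
  by (metis ex_bounded_by bounded_by_mono max.cobounded1 max.cobounded2)

lemma common_bound3: obtains n where "bounded_by A n" "bounded_by B n" "bounded_by C n"
  by (metis common_bound2 ex_bounded_by bounded_by_mono max.cobounded1 max.cobounded2)

instantiation finmat :: ab_group_add
begin

lift_definition zero_finmat :: finmat is "\<lambda>i j. 0" by auto
lift_definition plus_finmat :: "finmat \<Rightarrow> finmat \<Rightarrow> finmat" is "\<lambda>A B i j. A i j + B i j"
proof -
  fix A B :: "nat \<Rightarrow> nat \<Rightarrow> complex"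
  assume "\<exists>n. \<forall>i j. A i j \<noteq> 0 \<longrightarrow> i < n \<and> j < n" "\<exists>n. \<forall>i j. B i j \<noteq> 0 \<longrightarrow> i < n \<and> j < n"
  then obtain n m where "\<forall>i j. A i j \<noteq> 0 \<longrightarrow> i < n \<and> j < n" "\<forall>i j. B i j \<noteq> 0 \<longrightarrow> i < m \<and> j < m"
    by blast
  then show "\<exists>n. \<forall>i j. A i j + B i j \<noteq> 0 \<longrightarrow> i < n \<and> j < n"
    by (intro exI[of _ "max n m"]) (metis add.right_neutral less_max_iff_disj)
qed
lift_definition uminus_finmat :: "finmat \<Rightarrow> finmat" is "\<lambda>A i j. - A i j" by auto
definition minus_finmat :: "finmat \<Rightarrow> finmat \<Rightarrow> finmat" where "minus_finmat A B = A + - B"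

instance
proof
  fix A B C :: finmat
  show "A + B + C = A + (B + C)" "A + B = B + A" "0 + A = A" "- A + A = 0"
    by (auto intro!: finmat_eqI simp: plus_finmat.rep_eq zero_finmat.rep_eq uminus_finmat.rep_eq)
qed (simp add: minus_finmat_def)

end

lemma entry_zero [simp]: "entry 0 i j = 0" by transfer simp
lemma entry_add [simp]: "entry (A + B) i j = entry A i j + entry B i j" by transfer simp
lemma entry_uminus [simp]: "entry (- A) i j = - entry A i j" by transfer simp
lemma entry_diff [simp]: "entry (A - B) i j = entry A i j - entry B i j"
  by (simp only: minus_finmat_def entry_add entry_uminus) simp
lemma entry_sum [simp]: "entry (\<Sum>x\<in>S. f x) i j = (\<Sum>x\<in>S. entry (f x) i j)"
  by (induction S rule: infinite_finite_induct) auto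

lift_definition trunc_mat :: "nat \<Rightarrow> (nat \<Rightarrow> nat \<Rightarrow> complex) \<Rightarrow> finmat" is
  "\<lambda>n A i j. if i < n \<and> j < n then A i j else 0"
  by (metis)

lemma entry_trunc [simp]: "entry (trunc_mat n A) i j = (if i < n \<and> j < n then A i j else 0)"
  by transfer simp

lemma bounded_by_trunc [simp]: "bounded_by (trunc_mat n A) n"
  by (simp add: bounded_by_def)

instantiation finmat :: ring
begin

definition times_finmat :: "finmat \<Rightarrow> finmat \<Rightarrow> finmat" where
  "times_finmat A B = (let n = (SOME n. bounded_by A n \<and> bounded_by B n) in
     trunc_mat n (\<lambda>i j. \<Sum>k<n. entry A i k * entry B k j))"

text \<open>Terms beyond the smaller of two common bounds vanish, so the bound picked by
  \<open>SOME\<close> in the product does not matter.\<close>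

lemma entry_times_some:
  assumes "bounded_by A n" "bounded_by B n"
  shows "entry (A * B) i j = (\<Sum>k<n. entry A i k * entry B k j)"
proof -
  define m where "m = (SOME n. bounded_by A n \<and> bounded_by B n)"
  have m: "bounded_by A m" "bounded_by B m"
    using someI[of "\<lambda>n. bounded_by A n \<and> bounded_by B n" n] assms by (auto simp: m_def)
  have "entry (A * B) i j = (if i < m \<and> j < m then \<Sum>k<m. entry A i k * entry B k j else 0)"
    by (simp add: times_finmat_def Let_def m_def[symmetric])
  also have "\<dots> = (\<Sum>k<m. entry A i k * entry B k j)"
    using m by (auto simp: entry_eq_0 intro!: sum.neutral[symmetric])
  also have "\<dots> = (\<Sum>k<min m n. entry A i k * entry B k j)"
    using assms by (intro sum.mono_neutral_right) (auto simp: entry_eq_0 min_def split: if_splits)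
  also have "\<dots> = (\<Sum>k<n. entry A i k * entry B k j)"
    using m by (intro sum.mono_neutral_left) (auto simp: entry_eq_0 min_def split: if_splits)
  finally show ?thesis .
qed

text \<open>A bound on the left factor is enough, since the entry of \<open>A\<close> already kills
  all terms with k at least n. This is the form in which products are unfolded.\<close>

lemma entry_times:
  assumes "bounded_by A n"
  shows "entry (A * B) i j = (\<Sum>k<n. entry A i k * entry B k j)"
proof -
  obtain m where m: "bounded_by A m" "bounded_by B m" by (rule common_bound2)
  have "entry (A * B) i j = (\<Sum>k<m. entry A i k * entry B k j)"
    by (rule entry_times_some[OF m])
  also have "\<dots> = (\<Sum>k<min m n. entry A i k * entry B k j)"
    using assms by (intro sum.mono_neutral_right) (auto simp: entry_eq_0 min_def split: if_splits)
  also have "\<dots> = (\<Sum>k<n. entry A i k * entry B k j)"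
    using m by (intro sum.mono_neutral_left) (auto simp: entry_eq_0 min_def split: if_splits)
  finally show ?thesis .
qed

lemma bounded_by_times:
  assumes "bounded_by A n" "bounded_by B n"
  shows "bounded_by (A * B) n"
  unfolding bounded_by_def using assms
  by (auto simp: entry_times_some[OF assms] entry_eq_0 not_le[symmetric])

instance
proof
  fix A B C :: finmat
  obtain n where n: "bounded_by A n" "bounded_by B n" "bounded_by C n" by (rule common_bound3)
  show "A * B * C = A * (B * C)"
  proof (rule finmat_eqI)
    fix i j
    have "entry (A * B * C) i j = (\<Sum>k<n. (\<Sum>l<n. entry A i l * entry B l k) * entry C k j)"
      using n bounded_by_times by (simp add: entry_times_some[where n = n])
    also have "\<dots> = (\<Sum>l<n. entry A i l * (\<Sum>k<n. entry B l k * entry C k j))"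
      unfolding sum_distrib_left sum_distrib_right
      by (subst sum.swap) (simp add: mult.assoc)
    also have "\<dots> = entry (A * (B * C)) i j"
      using n bounded_by_times by (simp add: entry_times_some[where n = n])
    finally show "entry (A * B * C) i j = entry (A * (B * C)) i j" .
  qed
  obtain m where m: "bounded_by (A + B) m" by (metis ex_bounded_by)
  define N where "N = max n m"
  have N: "bounded_by A N" "bounded_by B N" "bounded_by (A + B) N"
    using n m bounded_by_mono by (auto simp: N_def)
  show "(A + B) * C = A * C + B * C"
    by (rule finmat_eqI) (simp add: entry_times[where n = N] N distrib_right sum.distrib)
  show "A * (B + C) = A * B + A * C"
    by (rule finmat_eqI) (simp add: entry_times[where n = N] N distrib_left sum.distrib)
qed

end

lift_definition star :: "finmat \<Rightarrow> finmat" is "\<lambda>A i j. cnj (A j i)"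
  by (metis complex_cnj_zero)

lift_definition fconj :: "finmat \<Rightarrow> finmat" is "\<lambda>A i j. cnj (A i j)"
  by (metis complex_cnj_zero)

lemma entry_star [simp]: "entry (star A) i j = cnj (entry A j i)" by transfer simp
lemma entry_fconj [simp]: "entry (fconj A) i j = cnj (entry A i j)" by transfer simp

lemma bounded_by_star [simp]: "bounded_by (star A) n \<longleftrightarrow> bounded_by A n"
  by (auto simp: bounded_by_def)
lemma bounded_by_fconj [simp]: "bounded_by (fconj A) n \<longleftrightarrow> bounded_by A n"
  by (auto simp: bounded_by_def)

text \<open>The trace form tr(A* B), conjugate-linear in the first argument; a support bound for
  \<open>A\<close> alone makes the sum complete.\<close>

definition cinner :: "finmat \<Rightarrow> finmat \<Rightarrow> complex" where
  "cinner A B = (let n = (SOME n. bounded_by A n) in \<Sum>i<n. \<Sum>j<n. cnj (entry A i j) * entry B i j)"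

lemma square_sum_mono_neutral:
  fixes f :: "nat \<Rightarrow> nat \<Rightarrow> complex"
  assumes "\<And>i j. f i j \<noteq> 0 \<Longrightarrow> i < n \<and> j < n" "\<And>i j. f i j \<noteq> 0 \<Longrightarrow> i < m \<and> j < m"
  shows "(\<Sum>i<n. \<Sum>j<n. f i j) = (\<Sum>i<m. \<Sum>j<m. f i j)"
proof -
  have "(\<Sum>i<n. \<Sum>j<n. f i j) = (\<Sum>p\<in>{..<n}\<times>{..<n}. f (fst p) (snd p))"
    by (simp add: sum.cartesian_product case_prod_beta)
  also have "\<dots> = (\<Sum>p\<in>{..<min n m}\<times>{..<min n m}. f (fst p) (snd p))"
    by (intro sum.mono_neutral_right) (auto dest: assms)
  also have "\<dots> = (\<Sum>p\<in>{..<m}\<times>{..<m}. f (fst p) (snd p))"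
    by (intro sum.mono_neutral_left) (auto dest: assms)
  also have "\<dots> = (\<Sum>i<m. \<Sum>j<m. f i j)"
    by (simp add: sum.cartesian_product case_prod_beta)
  finally show ?thesis .
qed

lemma cinner_eq:
  assumes "bounded_by A n"
  shows "cinner A B = (\<Sum>i<n. \<Sum>j<n. cnj (entry A i j) * entry B i j)"
proof -
  define m where "m = (SOME n. bounded_by A n)"
  have m: "bounded_by A m" using someI[of "bounded_by A" n] assms by (auto simp: m_def)
  show ?thesis
    unfolding cinner_def Let_def m_def[symmetric]
    by (rule square_sum_mono_neutral) (use m assms in \<open>auto simp: bounded_by_def\<close>)
qed

lemma cinner_commute: "cinner A B = cnj (cinner B A)"
proof -
  obtain n where "bounded_by A n" "bounded_by B n" by (rule common_bound2)
  then show ?thesis by (simp add: cinner_eq[where n = n] mult.commute)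
qed

lemma cinner_add_left: "cinner (A + B) C = cinner A C + cinner B C"
proof -
  obtain n where "bounded_by A n" "bounded_by B n" "bounded_by (A + B) n" by (rule common_bound3)
  then show ?thesis by (simp add: cinner_eq[where n = n] distrib_right sum.distrib)
qed

lemma cinner_add_right: "cinner C (A + B) = cinner C A + cinner C B"
  by (metis cinner_add_left cinner_commute complex_cnj_add)

instantiation finmat :: real_inner
begin

lift_definition scaleR_finmat :: "real \<Rightarrow> finmat \<Rightarrow> finmat" is "\<lambda>r A i j. r *\<^sub>R A i j"
  by (metis scaleR_zero_right)

definition inner_finmat :: "finmat \<Rightarrow> finmat \<Rightarrow> real" where "inner_finmat A B = Re (cinner A B)"
definition norm_finmat :: "finmat \<Rightarrow> real" where "norm_finmat A = sqrt (inner A A)"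
definition sgn_finmat :: "finmat \<Rightarrow> finmat" where "sgn_finmat A = scaleR (inverse (norm A)) A"
definition dist_finmat :: "finmat \<Rightarrow> finmat \<Rightarrow> real" where "dist_finmat A B = norm (A - B)"
definition uniformity_finmat :: "(finmat \<times> finmat) filter" where
  "uniformity_finmat = (INF e\<in>{0<..}. principal {(x, y). dist x y < e})"
definition open_finmat :: "finmat set \<Rightarrow> bool" where
  "open_finmat U \<longleftrightarrow> (\<forall>x\<in>U. \<forall>\<^sub>F (x', y) in uniformity. x' = x \<longrightarrow> y \<in> U)"

lemma entry_scaleR [simp]: "entry (r *\<^sub>R A) i j = of_real r * entry A i j"
  by transfer (simp add: scaleR_conv_of_real)

lemma inner_self: assumes "bounded_by A n"
  shows "inner A A = (\<Sum>i<n. \<Sum>j<n. (cmod (entry A i j))\<^sup>2)"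
  by (simp add: inner_finmat_def cinner_eq[OF assms] cmod_power2) (simp add: power2_eq_square)

instance
proof
  fix A B C :: finmat and r s :: real
  show "r *\<^sub>R (A + B) = r *\<^sub>R A + r *\<^sub>R B" "(r + s) *\<^sub>R A = r *\<^sub>R A + s *\<^sub>R A"
    "r *\<^sub>R s *\<^sub>R A = (r * s) *\<^sub>R A" "1 *\<^sub>R A = A"
    by (rule finmat_eqI; simp add: algebra_simps)+
  show "inner A B = inner B A"
    unfolding inner_finmat_def by (subst cinner_commute) simp
  show "inner (A + B) C = inner A C + inner B C"
    by (simp add: inner_finmat_def cinner_add_left)
  obtain n where n: "bounded_by A n" "bounded_by (r *\<^sub>R A) n" by (rule common_bound2)
  show "inner (r *\<^sub>R A) B = r * inner A B"
    unfolding inner_finmat_def cinner_eq[OF n(1)] cinner_eq[OF n(2)]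
    by (simp add: sum_distrib_left algebra_simps)
  show nonneg: "0 \<le> inner A A"
    by (simp add: inner_self[OF n(1)] sum_nonneg)
  show "inner A A = 0 \<longleftrightarrow> A = 0"
  proof
    assume "inner A A = 0"
    then have "\<forall>i<n. \<forall>j<n. entry A i j = 0"
      by (auto simp: inner_self[OF n(1)] sum_nonneg_eq_0_iff sum_nonneg)
    then show "A = 0"
      using entry_eq_0[OF n(1)] by (intro finmat_eqI) (metis entry_zero not_le)
  qed (simp add: inner_finmat_def cinner_def)
qed (simp_all add: norm_finmat_def sgn_finmat_def dist_finmat_def uniformity_finmat_def open_finmat_def)

end

instance finmat :: real_algebra
proof
  fix A B :: finmat and r :: real
  obtain n where n: "bounded_by A n" "bounded_by (r *\<^sub>R A) n" by (rule common_bound2)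
  show "r *\<^sub>R A * B = r *\<^sub>R (A * B)" "A * r *\<^sub>R B = r *\<^sub>R (A * B)"
    by (rule finmat_eqI; simp add: entry_times[OF n(1)] entry_times[OF n(2)] sum_distrib_left algebra_simps)+
qed

section \<open>Adjoint, entrywise conjugation and the trace form\<close>

lemma star_star [simp]: "star (star A) = A" by (rule finmat_eqI) simp
lemma star_zero [simp]: "star 0 = 0" by (rule finmat_eqI) simp
lemma star_add [simp]: "star (A + B) = star A + star B" by (rule finmat_eqI) simp
lemma star_diff [simp]: "star (A - B) = star A - star B" by (rule finmat_eqI) simp
lemma star_uminus [simp]: "star (- A) = - star A" by (rule finmat_eqI) simp
lemma star_scaleR [simp]: "star (r *\<^sub>R A) = r *\<^sub>R star A" by (rule finmat_eqI) simp
lemma star_sum [simp]: "star (\<Sum>x\<in>S. f x) = (\<Sum>x\<in>S. star (f x))" by (rule finmat_eqI) simp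
lemma star_mult [simp]: "star (A * B) = star B * star A"
proof -
  obtain n where n: "bounded_by A n" "bounded_by B n" by (rule common_bound2)
  show ?thesis
    using n by (intro finmat_eqI) (simp add: entry_times[where n = n] mult.commute)
qed

lemma fconj_add [simp]: "fconj (A + B) = fconj A + fconj B" by (rule finmat_eqI) simp
lemma fconj_uminus [simp]: "fconj (- A) = - fconj A" by (rule finmat_eqI) simp
lemma fconj_scaleR [simp]: "fconj (r *\<^sub>R A) = r *\<^sub>R fconj A" by (rule finmat_eqI) simp
lemma fconj_sum [simp]: "fconj (\<Sum>x\<in>S. f x) = (\<Sum>x\<in>S. fconj (f x))" by (rule finmat_eqI) simp
lemma fconj_star: "fconj (star A) = star (fconj A)" by (rule finmat_eqI) simp
lemma fconj_mult [simp]: "fconj (A * B) = fconj A * fconj B"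
proof -
  obtain n where n: "bounded_by A n" "bounded_by B n" by (rule common_bound2)
  show ?thesis
    using n by (intro finmat_eqI) (simp add: entry_times[where n = n])
qed

text \<open>Since tr((AB)* C) = tr(B* (A* C)), the adjoint of left multiplication by
  \<open>A\<close> is left multiplication by \<open>star A\<close>. This replaces trace computations
  throughout.\<close>

lemma cinner_mult_left: "cinner (A * B) C = cinner B (star A * C)"
proof -
  obtain n where n: "bounded_by A n" "bounded_by B n" "bounded_by C n" by (rule common_bound3)
  have "cinner (A * B) C = (\<Sum>i<n. \<Sum>j<n. \<Sum>k<n. cnj (entry A i k) * cnj (entry B k j) * entry C i j)"
    using n by (simp add: cinner_eq[where n = n] bounded_by_times entry_times[where n = n] sum_distrib_right)
  also have "\<dots> = (\<Sum>i<n. \<Sum>k<n. \<Sum>j<n. cnj (entry A i k) * cnj (entry B k j) * entry C i j)"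
    by (intro sum.cong refl sum.swap)
  also have "\<dots> = (\<Sum>k<n. \<Sum>i<n. \<Sum>j<n. cnj (entry A i k) * cnj (entry B k j) * entry C i j)"
    by (rule sum.swap)
  also have "\<dots> = (\<Sum>k<n. \<Sum>j<n. \<Sum>i<n. cnj (entry A i k) * cnj (entry B k j) * entry C i j)"
    by (intro sum.cong refl sum.swap)
  also have "\<dots> = cinner B (star A * C)"
    using n by (simp add: cinner_eq[where n = n] entry_times[where n = n] sum_distrib_left mult_ac)
  finally show ?thesis .
qed

lemma cinner_star: "cinner (star A) (star B) = cinner B A"
proof -
  obtain n where "bounded_by A n" "bounded_by B n" by (rule common_bound2)
  then show ?thesis by (simp add: cinner_eq[where n = n] mult.commute) (rule sum.swap)
qed

lemma cinner_mult_right: "cinner (B * A) C = cinner B (C * star A)"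
  by (metis cinner_mult_left cinner_star star_mult star_star)

lemma cinner_scaleR_right: "cinner A (r *\<^sub>R B) = of_real r * cinner A B"
proof -
  obtain n where "bounded_by A n" by (metis ex_bounded_by)
  then show ?thesis by (simp add: cinner_eq[where n = n] sum_distrib_left mult_ac)
qed

lemma cinner_zero_right [simp]: "cinner A 0 = 0"
  by (simp add: cinner_def)

lemma cinner_sum_right: "cinner A (\<Sum>x\<in>S. f x) = (\<Sum>x\<in>S. cinner A (f x))"
  by (induction S rule: infinite_finite_induct) (auto simp: cinner_add_right)

lemma cinner_self: "cinner A A = of_real ((norm A)\<^sup>2)"
proof -
  have "cnj (cinner A A) = cinner A A" by (metis cinner_commute)
  then have "Im (cinner A A) = 0" by (simp add: complex_eq_iff)
  moreover have "Re (cinner A A) = (norm A)\<^sup>2"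
    by (simp add: power2_norm_eq_inner inner_finmat_def)
  ultimately show ?thesis by (simp add: complex_eq_iff)
qed

lemma inner_mult_left: "inner (A * B) C = inner B (star A * (C::finmat))"
  by (simp add: inner_finmat_def cinner_mult_left)

lemma inner_mult_right: "inner (B * A) C = inner B (C * star (A::finmat))"
  by (simp add: inner_finmat_def cinner_mult_right)

lemma inner_star: "inner (star A) (star B) = inner A (B::finmat)"
  by (metis cinner_star inner_commute inner_finmat_def)

lemma norm_star [simp]: "norm (star A) = norm A"
  by (simp add: norm_eq_sqrt_inner inner_star)

section \<open>The corner of d x d matrices\<close>

definition eye :: "nat \<Rightarrow> finmat" where
  "eye d = trunc_mat d (\<lambda>i j. of_bool (i = j))"

text \<open>The support condition \<open>bounded_by A d\<close> in algebraic form, so that closure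
  under ring operations and cancellation of the unit are rewriting steps.\<close>

definition in_corner :: "nat \<Rightarrow> finmat \<Rightarrow> bool" where
  "in_corner d A \<longleftrightarrow> eye d * A = A \<and> A * eye d = A"

lemma entry_eye: "entry (eye d) i j = (if i < d \<and> i = j then 1 else 0)"
  by (simp add: eye_def)

lemma bounded_by_eye [simp]: "bounded_by (eye d) d"
  by (simp add: eye_def)

lemma star_eye [simp]: "star (eye d) = eye d"
  by (rule finmat_eqI) (auto simp: entry_eye)

lemma fconj_eye [simp]: "fconj (eye d) = eye d"
  by (rule finmat_eqI) (auto simp: entry_eye)

lemma entry_eye_mult: "entry (eye d * A) i j = (if i < d then entry A i j else 0)"
proof -
  have "entry (eye d * A) i j = (\<Sum>k<d. if k = i then entry A i j else 0)"
    by (simp add: entry_times[where n = d] entry_eye if_distrib if_distribR cong: if_cong)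
  then show ?thesis by simp
qed

lemma entry_mult_eye: "entry (A * eye d) i j = (if j < d then entry A i j else 0)"
proof -
  have "entry (A * eye d) i j = cnj (entry (eye d * star A) j i)"
    by (metis entry_star star_mult star_eye star_star)
  then show ?thesis by (simp add: entry_eye_mult)
qed

lemma in_corner_iff: "in_corner d A \<longleftrightarrow> bounded_by A d"
proof
  assume "in_corner d A"
  then have *: "entry A i j = (if i < d then entry A i j else 0)"
    "entry A i j = (if j < d then entry A i j else 0)" for i j
    by (metis in_corner_def entry_eye_mult entry_mult_eye)+
  show "bounded_by A d"
    unfolding bounded_by_def using * by metis
next
  assume "bounded_by A d"
  then show "in_corner d A"
    unfolding in_corner_def by (auto intro!: finmat_eqI simp: entry_eye_mult entry_mult_eye entry_eq_0)
qed

lemma corner_eye [simp]: "in_corner d (eye d)" by (simp add: in_corner_iff)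
lemma eye_mult_eye [simp]: "eye d * eye d = eye d"
  using corner_eye by (simp only: in_corner_def)
lemma corner_zero [simp]: "in_corner d 0" by (simp add: in_corner_def)
lemma corner_add [simp]: "in_corner d A \<Longrightarrow> in_corner d B \<Longrightarrow> in_corner d (A + B)"
  by (simp add: in_corner_def algebra_simps)
lemma corner_diff [simp]: "in_corner d A \<Longrightarrow> in_corner d B \<Longrightarrow> in_corner d (A - B)"
  by (simp add: in_corner_def algebra_simps)
lemma corner_scaleR [simp]: "in_corner d A \<Longrightarrow> in_corner d (r *\<^sub>R A)"
  by (simp add: in_corner_def)
lemma corner_mult [simp]: "in_corner d A \<Longrightarrow> in_corner d B \<Longrightarrow> in_corner d (A * B)"
  by (metis in_corner_def mult.assoc)
lemma corner_star [simp]: "in_corner d A \<Longrightarrow> in_corner d (star A)"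
  by (simp add: in_corner_iff)
lemma corner_fconj [simp]: "in_corner d A \<Longrightarrow> in_corner d (fconj A)"
  by (simp add: in_corner_iff)
lemma corner_sum [simp]: "(\<And>x. x \<in> S \<Longrightarrow> in_corner d (f x)) \<Longrightarrow> in_corner d (\<Sum>x\<in>S. f x)"
  by (induction S rule: infinite_finite_induct) auto

lemma eye_mult_corner [simp]: "in_corner d A \<Longrightarrow> eye d * A = A"
  and mult_eye_corner [simp]: "in_corner d A \<Longrightarrow> A * eye d = A"
  by (simp_all add: in_corner_def)

lemma eye_mult_corner_assoc [simp]: "in_corner d A \<Longrightarrow> eye d * (A * B) = A * B"
  by (metis in_corner_def mult.assoc)

lemma norm_eye: "norm (eye d) = sqrt (real d)"
proof -
  have "inner (eye d) (eye d) = (\<Sum>i<d. \<Sum>j<d. if j = i then 1 else 0)"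
    unfolding inner_self[OF bounded_by_eye] by (intro sum.cong refl) (auto simp: entry_eye)
  also have "\<dots> = real d" by simp
  finally show ?thesis by (simp add: norm_eq_sqrt_inner)
qed

section \<open>Matrices of fixed size as finitely supported matrices\<close>

lemma sum_nat_block: "(\<Sum>k<a * d. f k) = (\<Sum>s<a. \<Sum>t<d. f (s * d + t))" for f :: "nat \<Rightarrow> 'a::comm_monoid_add"
proof (induction a)
  case (Suc a)
  have "(\<Sum>k<Suc a * d. f k) = (\<Sum>k\<in>{..<a*d} \<union> {a*d..<a*d+d}. f k)"
    by (rule sum.cong) auto
  also have "\<dots> = (\<Sum>k<a*d. f k) + (\<Sum>k\<in>{a*d..<a*d+d}. f k)"
    by (rule sum.union_disjoint) auto
  also have "(\<Sum>k\<in>{a*d..<a*d+d}. f k) = (\<Sum>t<d. f (a * d + t))"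
    by (rule sum.reindex_bij_witness[of _ "\<lambda>t. a*d+t" "\<lambda>k. k - a*d"]) auto
  finally show ?case using Suc by simp
qed simp

text \<open>On \<open>carrier_mat d d\<close> this is a *-isomorphism onto the corner, with inverse
  \<open>of_fin d\<close>; the proofs work with its image and translate back at the end.\<close>

definition fin :: "complex mat \<Rightarrow> finmat" where
  "fin A = trunc_mat (max (dim_row A) (dim_col A))
     (\<lambda>i j. if i < dim_row A \<and> j < dim_col A then A $$ (i, j) else 0)"

definition of_fin :: "nat \<Rightarrow> finmat \<Rightarrow> complex mat" where
  "of_fin d F = Matrix.mat d d (\<lambda>(i, j). entry F i j)"

lemma entry_fin: "A \<in> carrier_mat d d \<Longrightarrow> entry (fin A) i j = (if i < d \<and> j < d then A $$ (i, j) else 0)"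
  by (auto simp: fin_def)

lemma bounded_by_fin: "A \<in> carrier_mat d d \<Longrightarrow> bounded_by (fin A) d"
  by (auto simp: bounded_by_def entry_fin split: if_splits)

lemma corner_fin [simp]: "A \<in> carrier_mat d d \<Longrightarrow> in_corner d (fin A)"
  by (simp add: in_corner_iff bounded_by_fin)

lemma of_fin_carrier [simp]: "of_fin d F \<in> carrier_mat d d"
  by (simp add: of_fin_def)

lemma fin_of_fin [simp]: "in_corner d F \<Longrightarrow> fin (of_fin d F) = F"
  by (rule finmat_eqI)
    (auto simp: entry_fin[OF of_fin_carrier] in_corner_iff entry_eq_0, auto simp: of_fin_def)

lemma of_fin_fin: "A \<in> carrier_mat d d \<Longrightarrow> of_fin d (fin A) = A"
  by (intro eq_matI) (auto simp: of_fin_def entry_fin)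

lemma fin_inject: "A \<in> carrier_mat d d \<Longrightarrow> B \<in> carrier_mat d d \<Longrightarrow> fin A = fin B \<longleftrightarrow> A = B"
  by (metis of_fin_fin)

lemma cadj_carrier [simp]: "A \<in> carrier_mat m n \<Longrightarrow> cadj A \<in> carrier_mat n m"
  by (auto simp: cadj_def)

lemma cconj_carrier [simp]: "A \<in> carrier_mat m n \<Longrightarrow> cconj A \<in> carrier_mat m n"
  by (auto simp: cconj_def)

context
  fixes d :: nat and A B :: "complex mat"
  assumes A: "A \<in> carrier_mat d d" and B: "B \<in> carrier_mat d d"
begin


lemma fin_add: "fin (A + B) = fin A + fin B"
proof -
  have "A + B \<in> carrier_mat d d" using A B by simp
  then show ?thesis using A B by (intro finmat_eqI) (auto simp: entry_fin[where d = d])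
qed

lemma fin_diff: "fin (A - B) = fin A - fin B"
proof -
  have "A - B \<in> carrier_mat d d" using B by (rule minus_carrier_mat)
  then show ?thesis using A B by (intro finmat_eqI) (auto simp: entry_fin[where d = d])
qed

lemma fin_mult: "fin (A * B) = fin A * fin B"
proof -
  have "A * B \<in> carrier_mat d d" using A B by simp
  then show ?thesis
    using A B
    by (intro finmat_eqI)
      (auto simp: entry_fin[where d = d] entry_times[OF bounded_by_fin[OF A]] scalar_prod_def
        lessThan_atLeast0 intro!: sum.cong)
qed

end

context
  fixes d :: nat and A :: "complex mat"
  assumes A: "A \<in> carrier_mat d d"
begin

lemma fin_uminus: "fin (- A) = - fin A"
proof -
  have "- A \<in> carrier_mat d d" using A by simp
  then show ?thesis using A by (intro finmat_eqI) (auto simp: entry_fin[where d = d])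
qed

lemma fin_smult: "fin (complex_of_real r \<cdot>\<^sub>m A) = r *\<^sub>R fin A"
proof -
  have "complex_of_real r \<cdot>\<^sub>m A \<in> carrier_mat d d" using A by simp
  then show ?thesis using A by (intro finmat_eqI) (auto simp: entry_fin[where d = d])
qed

lemma fin_cadj: "fin (cadj A) = star (fin A)"
  using A cadj_carrier[OF A]
  by (intro finmat_eqI) (auto simp: entry_fin[where d = d], auto simp: cadj_def)

lemma fin_cconj: "fin (cconj A) = fconj (fin A)"
  using A cconj_carrier[OF A]
  by (intro finmat_eqI) (auto simp: entry_fin[where d = d], auto simp: cconj_def)

lemma lfrob_eq: "lfrob A = norm (fin A) / sqrt (real d)"
proof -
  have "mtrace (cadj A * A) = (\<Sum>i<d. \<Sum>j<d. cnj (A $$ (j, i)) * A $$ (j, i))"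
    using A by (auto simp: mtrace_def cadj_def scalar_prod_def lessThan_atLeast0 intro!: sum.cong)
  also have "\<dots> = (\<Sum>j<d. \<Sum>i<d. cnj (A $$ (j, i)) * A $$ (j, i))"
    by (rule sum.swap)
  also have "\<dots> = cinner (fin A) (fin A)"
    using A by (auto simp: cinner_eq[OF bounded_by_fin[OF A]] entry_fin intro!: sum.cong)
  finally have "Re (mtrace (cadj A * A)) = (norm (fin A))\<^sup>2"
    by (simp add: cinner_self)
  then show ?thesis
    using A by (simp add: lfrob_def frob_norm_def)
qed

end

lemma fin_one [simp]: "fin (1\<^sub>m d) = eye d"
  by (rule finmat_eqI) (auto simp: entry_fin[where d = d] entry_eye)

lemma fin_zero [simp]: "fin (0\<^sub>m d d) = 0"
  by (rule finmat_eqI) (auto simp: entry_fin[where d = d])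

definition obs :: "nat \<Rightarrow> finmat \<Rightarrow> bool" where
  "obs d X \<longleftrightarrow> in_corner d X \<and> star X = X \<and> X * X = eye d"

definition proj :: "nat \<Rightarrow> finmat \<Rightarrow> bool" where
  "proj d P \<longleftrightarrow> in_corner d P \<and> star P = P \<and> P * P = P"

lemma is_obs_of_fin: assumes "obs d F" shows "is_obs d (of_fin d F)"
proof -
  have "cadj (of_fin d F) = of_fin d F"
    using assms by (subst fin_inject[symmetric, where d = d]) (auto simp: fin_cadj[of _ d] obs_def)
  moreover have "of_fin d F * of_fin d F = 1\<^sub>m d"
    using assms by (subst fin_inject[symmetric, where d = d]) (auto simp: fin_mult[of _ d] obs_def intro!: mult_carrier_mat[of _ d d])
  ultimately show ?thesis by (simp add: is_obs_def)
qed

lemma obs_fin: assumes "is_obs d X" shows "obs d (fin X)"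
  using assms unfolding is_obs_def obs_def
  by (metis corner_fin fin_cadj fin_mult fin_one)

lemma is_proj_of_fin: assumes "proj d F" shows "is_proj d (of_fin d F)"
proof -
  have "cadj (of_fin d F) = of_fin d F"
    using assms by (subst fin_inject[symmetric, where d = d]) (auto simp: fin_cadj[of _ d] proj_def)
  moreover have "of_fin d F * of_fin d F = of_fin d F"
    using assms by (subst fin_inject[symmetric, where d = d]) (auto simp: fin_mult[of _ d] proj_def intro!: mult_carrier_mat[of _ d d])
  ultimately show ?thesis by (simp add: is_proj_def)
qed

lemma seval_carrier:
  "(\<And>s. \<phi> s \<in> carrier_mat d d) \<Longrightarrow> seval d \<phi> p \<in> carrier_mat d d"
  by (induction p) auto

section \<open>Bipartite vectors read as matrices\<close>

definition fvec :: "nat \<Rightarrow> complex Matrix.vec \<Rightarrow> finmat" where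
  "fvec d \<psi> = trunc_mat d (\<lambda>s t. \<psi> $ (s * d + t))"

text \<open>The transpose, as the adjoint of the entrywise conjugate.\<close>

definition ftr :: "finmat \<Rightarrow> finmat" where
  "ftr X = star (fconj X)"

lemma entry_ftr [simp]: "entry (ftr X) i j = entry X j i"
  by (simp add: ftr_def)

lemma corner_ftr [simp]: "in_corner d X \<Longrightarrow> in_corner d (ftr X)"
  by (simp add: ftr_def)

lemma corner_fvec [simp]: "in_corner d (fvec d \<psi>)"
  by (simp add: fvec_def in_corner_iff)

lemma entry_fvec: "entry (fvec d \<psi>) s t = (if s < d \<and> t < d then \<psi> $ (s * d + t) else 0)"
  by (simp add: fvec_def)

lemma block_index_less: "s < (d::nat) \<Longrightarrow> t < d \<Longrightarrow> s * d + t < d * d"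
proof -
  assume "s < d" "t < d"
  then have "s * d + t < Suc s * d" by simp
  also have "\<dots> \<le> d * d" using \<open>s < d\<close> by (intro mult_le_mono1) simp
  finally show "s * d + t < d * d" .
qed

text \<open>With a bipartite vector reshaped to a matrix M, the operator \<open>kron Y X\<close>
  acts as M |-> Y M X^T. All tensor products are eliminated through this rule.\<close>

lemma kron_mult_vec_index:
  assumes Y: "Y \<in> carrier_mat d d" and X: "X \<in> carrier_mat d d" and \<psi>: "\<psi> \<in> carrier_vec (d * d)"
    and s: "s < d" and t: "t < d"
  shows "(kron Y X *\<^sub>v \<psi>) $ (s * d + t) = entry (fin Y * fvec d \<psi> * ftr (fin X)) s t"
proof -
  have "(kron Y X *\<^sub>v \<psi>) $ (s * d + t) = (\<Sum>k<d * d. kron Y X $$ (s * d + t, k) * \<psi> $ k)"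
    using assms block_index_less[OF s t] by (simp add: kron_def scalar_prod_def lessThan_atLeast0)
  also have "\<dots> = (\<Sum>a<d. \<Sum>b<d. kron Y X $$ (s * d + t, a * d + b) * \<psi> $ (a * d + b))"
    by (rule sum_nat_block)
  also have "\<dots> = (\<Sum>a<d. \<Sum>b<d. Y $$ (s, a) * X $$ (t, b) * \<psi> $ (a * d + b))"
    using assms block_index_less by (intro sum.cong refl) (simp add: kron_def)
  also have "\<dots> = entry (fin Y * fvec d \<psi> * ftr (fin X)) s t"
    using assms
    by (simp add: entry_times[where n = d] bounded_by_times bounded_by_fin in_corner_iff[symmetric]
        entry_fin entry_fvec sum_distrib_left mult_ac)
  finally show ?thesis .
qed

lemma expect_kron:
  assumes Y: "Y \<in> carrier_mat d d" and X: "X \<in> carrier_mat d d" and \<psi>: "\<psi> \<in> carrier_vec (d * d)"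
  shows "expect \<psi> (kron Y X) = cinner (fvec d \<psi>) (fin Y * fvec d \<psi> * ftr (fin X))"
proof -
  have "expect \<psi> (kron Y X) = (\<Sum>s<d. \<Sum>t<d. cnj (\<psi> $ (s*d+t)) * (kron Y X *\<^sub>v \<psi>) $ (s*d+t))"
    using \<psi> by (simp add: expect_def sum_nat_block)
  also have "\<dots> = cinner (fvec d \<psi>) (fin Y * fvec d \<psi> * ftr (fin X))"
    using kron_mult_vec_index[OF assms]
    by (simp add: cinner_eq[where n = d] fvec_def)
  finally show ?thesis .
qed

lemma vnorm_fvec:
  assumes \<psi>: "\<psi> \<in> carrier_vec (d * d)"
  shows "vnorm \<psi> = norm (fvec d \<psi>)"
proof -
  have "bounded_by (fvec d \<psi>) d" by (simp add: fvec_def)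
  then show ?thesis
    using \<psi> by (simp add: vnorm_def norm_eq_sqrt_inner inner_self sum_nat_block entry_fvec)
qed

lemma max_ent_carrier [simp]: "max_ent d \<in> carrier_vec (d * d)"
  by (simp add: max_ent_def)

lemma fvec_max_ent: "fvec d (max_ent d) = (1 / sqrt (real d)) *\<^sub>R eye d"
  by (rule finmat_eqI) (auto simp: entry_fvec max_ent_def block_index_less entry_eye)

lemma vnorm_max_ent: "d \<ge> 1 \<Longrightarrow> vnorm (max_ent d) = 1"
  by (subst vnorm_fvec[of _ d]) (simp_all add: fvec_max_ent norm_eye)

lemma cinner_fconj: "cinner (fconj A) (fconj B) = cinner B A"
proof -
  obtain n where "bounded_by A n" "bounded_by B n" by (rule common_bound2)
  then show ?thesis by (simp add: cinner_eq[where n = n] mult.commute)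
qed

lemma cinner_scaleR_left: "cinner (r *\<^sub>R A) B = of_real r * cinner A B"
  by (metis cinner_commute cinner_scaleR_right complex_cnj_complex_of_real complex_cnj_mult)

text \<open>The maximally entangled state reshapes to d^(-1/2) times the unit, so the expectation is
  tr(conj(A) B^T)/d = tr(A* B)/d. Conjugating Alice's operators is what turns correlations into
  Frobenius inner products.\<close>

lemma expect_max_ent:
  assumes A: "A \<in> carrier_mat d d" and B: "B \<in> carrier_mat d d"
  shows "expect (max_ent d) (kron (cconj A) B) = cinner (fin A) (fin B) / of_nat d"
proof -
  have "cinner (eye d) (fconj (fin A) * ftr (fin B)) = cinner (ftr (fin A)) (ftr (fin B))"
    using cinner_mult_left[of "fconj (fin A)" "ftr (fin A)" "ftr (fin B)"]
    using A B cinner_mult_left[of "ftr (fin A)" "eye d" "ftr (fin B)"] by (simp add: ftr_def fconj_star)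
  also have "\<dots> = cinner (fin A) (fin B)"
    by (simp add: ftr_def cinner_star cinner_fconj)
  finally have *: "cinner (eye d) (fconj (fin A) * ftr (fin B)) = cinner (fin A) (fin B)" .
  have "of_real (1 / sqrt (real d)) * of_real (1 / sqrt (real d)) = (1 / of_nat d :: complex)"
    unfolding of_real_mult[symmetric] by simp
  then show ?thesis
    using A B
    by (simp add: expect_kron[of _ d] fvec_max_ent fin_cconj[where d = d] cinner_scaleR_left
        cinner_scaleR_right * mult.assoc[symmetric])
qed

lemma Re_expect_max_ent:
  assumes A: "A \<in> carrier_mat d d" and B: "B \<in> carrier_mat d d"
  shows "Re (expect (max_ent d) (kron (cconj A) B)) = inner (fin A) (fin B) / real d"
  by (simp add: expect_max_ent[OF assms] inner_finmat_def Re_divide_of_nat)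

section \<open>Multiplicative bounds and the spectral theorem\<close>

text \<open>Operator norm at most \<open>K\<close>, expressed by the effect on Frobenius norms. Both
  sides are included because error factors occur on the left and on the right.\<close>

definition mult_bound :: "real \<Rightarrow> finmat \<Rightarrow> bool" where
  "mult_bound K A \<longleftrightarrow> 0 \<le> K \<and> (\<forall>X. norm (A * X) \<le> K * norm X \<and> norm (X * A) \<le> K * norm X)"

lemma mult_boundD: "mult_bound K A \<Longrightarrow> norm (A * X) \<le> K * norm X"
  "mult_bound K A \<Longrightarrow> norm (X * A) \<le> K * norm X" "mult_bound K A \<Longrightarrow> 0 \<le> K"
  by (auto simp: mult_bound_def)

text \<open>Left multiplication by \<open>star A\<close> is the adjoint of left multiplication by
  \<open>A\<close> and so has the same bound, by Cauchy-Schwarz; taking adjoints then gives right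
  multiplication by \<open>A\<close>.\<close>

lemma mult_boundI:
  assumes K: "0 \<le> K" and left: "\<And>X. norm (A * X) \<le> K * norm X"
  shows "mult_bound K A"
proof -
  have star: "norm (star A * X) \<le> K * norm X" for X
  proof -
    have "(norm (star A * X))\<^sup>2 = inner X (A * (star A * X))"
      by (simp add: power2_norm_eq_inner inner_mult_left)
    also have "\<dots> \<le> norm X * norm (A * (star A * X))"
      by (rule norm_cauchy_schwarz)
    also have "\<dots> \<le> norm X * (K * norm (star A * X))"
      by (intro mult_left_mono left) simp
    finally have "norm (star A * X) * norm (star A * X) \<le> (K * norm X) * norm (star A * X)"
      by (simp add: power2_eq_square mult_ac)
    then show ?thesis
      using K by (cases "norm (star A * X) = 0") (auto simp: mult_le_cancel_right)
  qed
  have "norm (X * A) \<le> K * norm X" for X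
    using star[of "star X"] by (metis norm_star star_mult)
  then show ?thesis using K left by (simp add: mult_bound_def)
qed

lemma mult_bound_star: assumes "mult_bound K A" shows "mult_bound K (star A)"
  unfolding mult_bound_def
proof (intro conjI allI)
  show "0 \<le> K" using assms by (rule mult_boundD)
  fix X
  show "norm (star A * X) \<le> K * norm X" "norm (X * star A) \<le> K * norm X"
    using mult_boundD(1,2)[OF assms, of "star X"] by (metis norm_star star_mult star_star)+
qed

lemma mult_bound_add: "mult_bound K A \<Longrightarrow> mult_bound L B \<Longrightarrow> mult_bound (K + L) (A + B)"
  unfolding mult_bound_def distrib_left distrib_right
  by (auto intro: norm_triangle_mono)

lemma mult_bound_scaleR: "mult_bound K A \<Longrightarrow> mult_bound (\<bar>r\<bar> * K) (r *\<^sub>R A)"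
  unfolding mult_bound_def by (auto simp: mult.assoc intro: mult_left_mono)

lemma mult_bound_diff:
  assumes "mult_bound K A" "mult_bound L B" shows "mult_bound (K + L) (A - B)"
proof -
  have "mult_bound L (- B)" using mult_bound_scaleR[OF assms(2), of "-1"] by simp
  then show ?thesis using mult_bound_add[OF assms(1), of L "- B"] by simp
qed

lemma mult_bound_mult: assumes "mult_bound K A" "mult_bound L B" shows "mult_bound (K * L) (A * B)"
proof (rule mult_boundI)
  show K: "0 \<le> K * L" using assms by (simp add: mult_bound_def)
  fix X
  have "norm (A * B * X) \<le> K * norm (B * X)"
    using mult_boundD(1)[OF assms(1), of "B * X"] by (simp add: mult.assoc)
  also have "\<dots> \<le> K * (L * norm X)"
    by (intro mult_left_mono mult_boundD(1)[OF assms(2)] mult_boundD(3)[OF assms(1)])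
  finally show "norm (A * B * X) \<le> K * L * norm X" by (simp add: mult.assoc)
qed

lemma norm_proj_mult_le:
  assumes "star P = P" "P * P = P" shows "norm (P * X) \<le> norm X"
proof -
  have "(norm (P * X))\<^sup>2 = inner X (P * X)"
    using assms by (simp add: power2_norm_eq_inner inner_mult_left mult.assoc[symmetric])
  also have "\<dots> \<le> norm X * norm (P * X)" by (rule norm_cauchy_schwarz)
  finally have "norm (P * X) * norm (P * X) \<le> norm X * norm (P * X)"
    by (simp add: power2_eq_square)
  then show ?thesis by (cases "norm (P * X) = 0") auto
qed

lemma mult_bound_proj: "star P = P \<Longrightarrow> P * P = P \<Longrightarrow> mult_bound 1 P"
  by (rule mult_boundI) (simp_all add: norm_proj_mult_le)

lemma mult_bound_eye: "mult_bound 1 (eye d)"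
  by (rule mult_bound_proj) simp_all

lemma mult_bound_obs: assumes "obs d X" shows "mult_bound 1 X"
proof (rule mult_boundI)
  fix A
  have "(norm (X * A))\<^sup>2 = inner A (eye d * A)"
    using assms by (simp add: obs_def power2_norm_eq_inner inner_mult_left mult.assoc[symmetric])
  also have "\<dots> = (norm (eye d * A))\<^sup>2"
    by (simp add: power2_norm_eq_inner inner_mult_left mult.assoc[symmetric])
  finally show "norm (X * A) \<le> 1 * norm A"
    using norm_proj_mult_le[of "eye d" A] by simp
qed simp

text \<open>\<open>op_norm\<close> is a real supremum, so it yields upper bounds only once its set
  is known to be bounded. The crude entrywise bound \<open>B\<close> provides this, and scaling to a
  unit vector does the rest.\<close>

lemma vnorm_mult_vec_le:
  assumes A: "A \<in> carrier_mat d d" and op: "op_norm A \<le> K" and v: "v \<in> carrier_vec d"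
  shows "vnorm (A *\<^sub>v v) \<le> K * vnorm v"
proof (cases "vnorm v = 0")
  case True
  then have "(\<Sum>i<d. (cmod (v $ i))\<^sup>2) = 0" using v by (auto simp: vnorm_def sum_nonneg)
  then have "\<And>i. i < d \<Longrightarrow> v $ i = 0" by (simp add: sum_nonneg_eq_0_iff)
  then have "\<And>i. i < d \<Longrightarrow> (A *\<^sub>v v) $ i = 0" using A v by (auto simp: scalar_prod_def)
  then show ?thesis using A True by (simp add: vnorm_def)
next
  case False
  have vn: "vnorm (complex_of_real r \<cdot>\<^sub>v u) = \<bar>r\<bar> * vnorm u" for r u
    by (simp add: vnorm_def norm_mult power_mult_distrib sum_distrib_left[symmetric] real_sqrt_mult)
  define B where "B = sqrt (\<Sum>i<d. (\<Sum>j<d. cmod (A $$ (i, j)))\<^sup>2)"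
  have B: "vnorm (A *\<^sub>v u) \<le> B" if u: "u \<in> carrier_vec d" "vnorm u = 1" for u
  proof -
    have "cmod (u $ j) \<le> 1" if "j < d" for j
    proof -
      have "(cmod (u $ j))\<^sup>2 \<le> (\<Sum>i<d. (cmod (u $ i))\<^sup>2)"
        using that by (intro member_le_sum) auto
      also have "\<dots> = 1" using u by (simp add: vnorm_def)
      finally show ?thesis by (simp add: power_le_one_iff abs_square_le_1)
    qed
    then have "cmod ((A *\<^sub>v u) $ i) \<le> (\<Sum>j<d. cmod (A $$ (i, j)))" if "i < d" for i
      using A u that
      by (auto simp: scalar_prod_def lessThan_atLeast0 norm_mult intro!: sum_norm_le mult_left_le)
    then show ?thesis
      using A by (auto simp: vnorm_def B_def intro!: sum_mono power_mono)
  qed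
  define u where "u = complex_of_real (1 / vnorm v) \<cdot>\<^sub>v v"
  have pos: "vnorm v > 0" using False by (simp add: vnorm_def sum_nonneg less_le)
  have u: "u \<in> carrier_vec d" "vnorm u = 1" using v pos vn[of "1 / vnorm v" v] by (auto simp: u_def)
  have "A *\<^sub>v v = complex_of_real (vnorm v) \<cdot>\<^sub>v (A *\<^sub>v u)"
    using A v pos unfolding u_def by (simp add: mult_mat_vec smult_smult_assoc)
  then have "vnorm (A *\<^sub>v v) = vnorm v * vnorm (A *\<^sub>v u)" using vn pos by simp
  moreover have "vnorm (A *\<^sub>v u) \<le> op_norm A"
    unfolding op_norm_def using A u B by (intro cSup_upper bdd_aboveI[of _ B]) auto
  ultimately show ?thesis using pos op by (simp add: mult.commute)
qed

text \<open>The squared Frobenius norm is the sum of the squared norms of the columns, and left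
  multiplication acts on each column separately.\<close>

lemma mult_bound_op_norm:
  assumes A: "A \<in> carrier_mat d d" and op: "op_norm A \<le> K" and K: "0 \<le> K"
  shows "mult_bound K (fin A)"
proof (rule mult_boundI[OF K])
  fix X
  obtain m where m: "bounded_by X m" by (metis ex_bounded_by)
  define n where "n = max m d"
  have n: "bounded_by X n" "bounded_by (fin A) n" "d \<le> n"
    using m bounded_by_fin[OF A] by (auto simp: n_def intro: bounded_by_mono)
  have AX: "bounded_by (fin A * X) n" using n by (intro bounded_by_times)
  define c where "c = (\<lambda>j. Matrix.vec d (\<lambda>i. entry X i j))"
  have col: "entry (fin A * X) i j = (if i < d then (A *\<^sub>v c j) $ i else 0)" for i j
    using A by (auto simp: entry_times[OF bounded_by_fin[OF A]] entry_fin c_def scalar_prod_def lessThan_atLeast0)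
  have "(norm (fin A * X))\<^sup>2 = (\<Sum>j<n. \<Sum>i<n. (cmod (entry (fin A * X) i j))\<^sup>2)"
    unfolding power2_norm_eq_inner inner_self[OF AX] by (rule sum.swap)
  also have "\<dots> = (\<Sum>j<n. \<Sum>i<d. (cmod ((A *\<^sub>v c j) $ i))\<^sup>2)"
    using n by (intro sum.cong refl sum.mono_neutral_cong_right) (auto simp: col)
  also have "\<dots> = (\<Sum>j<n. (vnorm (A *\<^sub>v c j))\<^sup>2)"
    using A by (intro sum.cong refl) (auto simp: vnorm_def sum_nonneg)
  also have "\<dots> \<le> (\<Sum>j<n. (K * vnorm (c j))\<^sup>2)"
    by (intro sum_mono power_mono vnorm_mult_vec_le[OF A op]) (auto simp: c_def vnorm_def sum_nonneg)
  also have "\<dots> = K\<^sup>2 * (\<Sum>j<n. \<Sum>i<d. (cmod (entry X i j))\<^sup>2)"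
    unfolding sum_distrib_left by (intro sum.cong refl) (auto simp: vnorm_def c_def sum_nonneg power_mult_distrib sum_distrib_left)
  also have "\<dots> \<le> K\<^sup>2 * (\<Sum>j<n. \<Sum>i<n. (cmod (entry X i j))\<^sup>2)"
    using n by (intro mult_left_mono sum_mono sum_mono2) auto
  also have "\<dots> = (K * norm X)\<^sup>2"
    unfolding power_mult_distrib power2_norm_eq_inner inner_self[OF n(1)]
    by (subst sum.swap) simp
  finally show "norm (fin A * X) \<le> K * norm X"
    using K by (simp add: power2_le_iff_abs_le)
qed

section \<open>Polynomial functional calculus and the spectral theorem\<close>

text \<open>The unit is the projection \<open>e\<close>, so that \<open>H\<close> can be split off to the range of a smaller projection.\<close>

definition poly_at :: "finmat \<Rightarrow> finmat \<Rightarrow> real poly \<Rightarrow> finmat" where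
  "poly_at e H p = fold_coeffs (\<lambda>a B. a *\<^sub>R e + H * B) p 0"

lemma poly_at_0 [simp]: "poly_at e H 0 = 0"
  by (simp add: poly_at_def)

lemma poly_at_pCons [simp]: "poly_at e H (pCons a p) = a *\<^sub>R e + H * poly_at e H p"
  by (cases "p = 0 \<and> a = 0") (auto simp: poly_at_def)

lemma poly_at_add: "poly_at e H (p + q) = poly_at e H p + poly_at e H q"
  by (induction p q rule: poly_induct2) (simp_all add: algebra_simps)

lemma poly_at_smult: "poly_at e H (smult c p) = c *\<^sub>R poly_at e H p"
  by (induction p) (simp_all add: algebra_simps)

lemma poly_at_diff: "poly_at e H (p - q) = poly_at e H p - poly_at e H q"
  using poly_at_add[of e H p "- q"] poly_at_smult[of e H "-1" q] by simp

lemma poly_at_sum: "poly_at e H (\<Sum>x\<in>S. f x) = (\<Sum>x\<in>S. poly_at e H (f x))"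
  by (induction S rule: infinite_finite_induct) (simp_all add: poly_at_add)

lemma poly_at_commute: "e * B = B * e \<Longrightarrow> H * B = B * H \<Longrightarrow> poly_at e H p * B = B * poly_at e H p"
proof (induction p)
  case (pCons a p)
  then have "H * poly_at e H p * B = H * (B * poly_at e H p)" by (simp add: mult.assoc)
  also have "\<dots> = B * (H * poly_at e H p)" using pCons by (simp add: mult.assoc[symmetric])
  finally show ?case using pCons by (simp add: distrib_left distrib_right)
qed simp

lemma poly_at_eigen:
  assumes "e * A = A" "H * A = l *\<^sub>R A"
  shows "poly_at e H p * A = poly p l *\<^sub>R A"
  by (induction p) (simp_all add: assms distrib_right mult.assoc algebra_simps)

locale self_adjoint_in =
  fixes e H :: finmat
  assumes e: "star e = e" "e * e = e" and H: "star H = H" "e * H = H" "H * e = H"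
begin

lemma poly_at_corner: "e * poly_at e H p = poly_at e H p" "poly_at e H p * e = poly_at e H p"
proof -
  show *: "e * poly_at e H p = poly_at e H p"
    by (induction p) (simp_all add: e H distrib_left mult.assoc[symmetric])
  show "poly_at e H p * e = poly_at e H p"
    using poly_at_commute[of e e H p] * H by simp
qed

lemma poly_at_mult: "poly_at e H (p * q) = poly_at e H p * poly_at e H q"
  by (induction p)
    (simp_all add: poly_at_add poly_at_smult distrib_right mult.assoc poly_at_corner)

lemma star_poly_at: "star (poly_at e H p) = poly_at e H p"
proof (induction p)
  case (pCons a p)
  then show ?case using poly_at_commute[of e H H p] by (simp add: e H)
qed simp

text \<open>The polynomial has a complex root. If it is real, dividing by the linear factor leaves a
  q of smaller degree, so q(H) is nonzero by minimality and its range consists of eigenvectors. A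
  non-real root is impossible because \<open>H\<close> is self-adjoint.\<close>

lemma annihilator_root:
  assumes "e \<noteq> 0" "p \<noteq> 0" "poly_at e H p = 0"
    and minimal: "\<And>q. q \<noteq> 0 \<Longrightarrow> poly_at e H q = 0 \<Longrightarrow> degree p \<le> degree q"
  obtains l q where "p = [:-l, 1:] * q" "q \<noteq> 0" "degree q < degree p"
    "poly_at e H q \<noteq> 0" "H * poly_at e H q = l *\<^sub>R poly_at e H q"
proof -
  note result = that
  define pc where "pc = map_poly complex_of_real p"
  have "degree p \<noteq> 0"
  proof
    assume "degree p = 0"
    then obtain c where "p = [:c:]" by (meson degree_eq_zeroE)
    then show False using assms by simp
  qed
  then have "\<not> constant (poly pc)"
    by (simp add: pc_def constant_degree degree_map_poly)
  then obtain z where z: "poly pc z = 0"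
    using fundamental_theorem_of_algebra by blast
  have factor: thesis if "Im z = 0"
  proof -
    define l where "l = Re z"
    have "z = of_real l" using that by (simp add: l_def complex_eq_iff)
    moreover have "poly (map_poly complex_of_real r) (of_real l) = of_real (poly r l)" for r
      by (induction r) (simp_all add: map_poly_pCons)
    ultimately have "poly p l = 0" using z by (simp add: pc_def)
    then obtain q where q: "p = [:-l, 1:] * q" by (meson dvdE poly_eq_0_iff_dvd)
    then have q0: "q \<noteq> 0" using \<open>p \<noteq> 0\<close> by auto
    then have deg: "degree q < degree p" unfolding q by (subst degree_mult_eq) auto
    have "(H - l *\<^sub>R e) * poly_at e H q = 0"
      using assms(3) unfolding q poly_at_mult by (simp add: algebra_simps poly_at_corner H)
    then have "H * poly_at e H q = l *\<^sub>R poly_at e H q"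
      by (simp only: left_diff_distrib mult_scaleR_left poly_at_corner right_minus_eq)
    then show ?thesis using result[OF q q0 deg] minimal[OF q0] deg by fastforce
  qed
  moreover have False if im: "Im z \<noteq> 0"
  proof -
    define a b where "a = Re z" and "b = Im z"
    \<comment> \<open>The real quadratic with roots z and its conjugate. The remainder of p modulo
      \<open>Q\<close> has degree at most 1 and vanishes at the non-real z, hence is zero.\<close>
    define Q where "Q = [:a\<^sup>2 + b\<^sup>2, -2 * a, 1:]"
    have Qz: "poly (map_poly complex_of_real Q) z = 0"
      by (simp add: Q_def map_poly_pCons complex_eq_iff a_def b_def power2_eq_square algebra_simps)
    define r where "r = p mod Q"
    have "Q \<noteq> 0" "degree Q = 2" by (simp_all add: Q_def)
    have add: "poly (map_poly complex_of_real (f + g)) z =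
        poly (map_poly complex_of_real f) z + poly (map_poly complex_of_real g) z" for f g
      by (induction f g rule: poly_induct2) (simp_all add: map_poly_pCons algebra_simps)
    have smult: "poly (map_poly complex_of_real (smult c f)) z =
        of_real c * poly (map_poly complex_of_real f) z" for c f
      by (induction f) (simp_all add: map_poly_pCons algebra_simps)
    have mult: "poly (map_poly complex_of_real (f * g)) z =
        poly (map_poly complex_of_real f) z * poly (map_poly complex_of_real g) z" for f g
      by (induction f) (simp_all add: map_poly_pCons add smult algebra_simps)
    have "poly (map_poly complex_of_real (Q * (p div Q) + r)) z = 0"
      using z by (simp add: pc_def r_def)
    then have rz: "poly (map_poly complex_of_real r) z = 0"
      using Qz by (simp add: add mult)
    have "degree r < 2 \<or> r = 0" using degree_mod_less[of Q p] \<open>Q \<noteq> 0\<close> \<open>degree Q = 2\<close> by (auto simp: r_def)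
    then have "degree r \<le> 1" by auto
    obtain s r' where r': "r = pCons s r'" by (cases r)
    then have "degree r' = 0" using \<open>degree r \<le> 1\<close> by (cases "r' = 0") auto
    then obtain t where "r' = [:t:]" by (meson degree_eq_zeroE)
    then have r: "r = [:s, t:]" using r' by simp
    have "r = 0" using rz im by (auto simp: r map_poly_pCons complex_eq_iff)
    then obtain q where q: "p = Q * q" by (metis dvdE mod_eq_0_iff_dvd r_def)
    then have q0: "q \<noteq> 0" using \<open>p \<noteq> 0\<close> by auto
    then have deg: "degree q < degree p"
      unfolding q using \<open>degree Q = 2\<close> \<open>Q \<noteq> 0\<close> by (subst degree_mult_eq) auto
    define A where "A = poly_at e H q"
    have A0: "A \<noteq> 0" using minimal[OF q0] deg by (fastforce simp: A_def)
    have eA: "e * A = A" by (simp add: A_def poly_at_corner)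
    \<comment> \<open>Q(H) is the sum of squares (H - a)^2 + b^2. Pairing with \<open>A\<close>
      gives |(H - a)A|^2 + b^2 |A|^2 = 0, which contradicts b and \<open>A\<close> being
      nonzero.\<close>
    have "(H - a *\<^sub>R e) * ((H - a *\<^sub>R e) * A) + b\<^sup>2 *\<^sub>R A = poly_at e H Q * A"
      by (simp add: Q_def algebra_simps eA H e power2_eq_square mult.assoc)
        (simp add: mult.assoc[symmetric] H flip: scaleR_add_left)
    also have "\<dots> = 0" using assms(3) by (simp add: q poly_at_mult A_def)
    finally have "inner A ((H - a *\<^sub>R e) * ((H - a *\<^sub>R e) * A)) + b\<^sup>2 * inner A A = 0"
      by (metis inner_add_right inner_scaleR_right inner_zero_right)
    moreover have "inner A ((H - a *\<^sub>R e) * ((H - a *\<^sub>R e) * A)) = inner ((H - a *\<^sub>R e) * A) ((H - a *\<^sub>R e) * A)"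
      by (simp add: inner_mult_left e H)
    ultimately have "b\<^sup>2 * inner A A = 0"
      by (smt (verit) inner_ge_zero mult_nonneg_nonneg zero_le_power2)
    then show False using A0 im by (simp add: b_def)
  qed
  ultimately show ?thesis by blast
qed

end

text \<open>The last conjunct places each \<open>E i\<close> in the bicommutant of \<open>e\<close>
  and \<open>H\<close>; functions of \<open>H\<close> inherit commutation relations through
  it.\<close>

definition spectral_decomp :: "finmat \<Rightarrow> finmat \<Rightarrow> nat \<Rightarrow> (nat \<Rightarrow> real) \<Rightarrow> (nat \<Rightarrow> finmat) \<Rightarrow> bool" where
  "spectral_decomp e H m l E \<longleftrightarrow>
     (\<forall>i<m. star (E i) = E i \<and> E i \<noteq> 0) \<and>
     (\<forall>i<m. \<forall>j<m. E i * E j = (if i = j then E i else 0)) \<and>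
     e = (\<Sum>i<m. E i) \<and> H = (\<Sum>i<m. l i *\<^sub>R E i) \<and>
     (\<forall>B. e * B = B * e \<longrightarrow> H * B = B * H \<longrightarrow> (\<forall>i<m. E i * B = B * E i))"

lemma spectral_decompD:
  assumes "spectral_decomp e H m l E"
  shows "i < m \<Longrightarrow> star (E i) = E i" "i < m \<Longrightarrow> E i \<noteq> 0"
    "i < m \<Longrightarrow> j < m \<Longrightarrow> E i * E j = (if i = j then E i else 0)"
    "e = (\<Sum>i<m. E i)" "H = (\<Sum>i<m. l i *\<^sub>R E i)"
    "e * B = B * e \<Longrightarrow> H * B = B * H \<Longrightarrow> i < m \<Longrightarrow> E i * B = B * E i"
  using assms unfolding spectral_decomp_def by blast+

text \<open>Induction on the degree. For a minimal annihilator (X - l) q, a multiple of q(H) is an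
  eigenprojection \<open>E\<close>. On the complement \<open>e - E\<close> the polynomial q
  annihilates the rest of \<open>H\<close>, and its degree is smaller.\<close>

lemma spectral_decomp_if_annihilated:
  assumes "self_adjoint_in e H" "p \<noteq> 0" "poly_at e H p = 0"
  shows "\<exists>m l E. spectral_decomp e H m l E"
  using assms
proof (induction "degree p" arbitrary: e H p rule: less_induct)
  case less
  then interpret self_adjoint_in e H by simp
  show ?case
  proof (cases "e = 0")
    case True
    then have "spectral_decomp e H 0 (\<lambda>_. 0) (\<lambda>_. 0)" using H by (simp add: spectral_decomp_def)
    then show ?thesis by blast
  next
    case False
    define P where "P = (\<lambda>q. q \<noteq> 0 \<and> poly_at e H q = 0)"
    obtain p' where p': "P p'" "\<And>q. P q \<Longrightarrow> degree p' \<le> degree q"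
      using ex_has_least_nat[of P p degree] less.prems by (auto simp: P_def)
    then have deg': "degree p' \<le> degree p" using less.prems by (simp add: P_def)
    have pr: "p' \<noteq> 0" "poly_at e H p' = 0"
      "\<And>q. q \<noteq> 0 \<Longrightarrow> poly_at e H q = 0 \<Longrightarrow> degree p' \<le> degree q"
      using p' by (simp_all add: P_def)
    obtain l q where q: "q \<noteq> 0" "degree q < degree p'" "poly_at e H q \<noteq> 0"
      "H * poly_at e H q = l *\<^sub>R poly_at e H q"
      by (rule annihilator_root[OF False pr(1,2)], rule pr(3), assumption, assumption,
        rule that, assumption+)
    define A where "A = poly_at e H q"
    have A: "e * A = A" "A * e = A" "star A = A" "A \<noteq> 0" "H * A = l *\<^sub>R A"
      using q(3,4) unfolding A_def by (simp_all only: poly_at_corner star_poly_at not_False_eq_True)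
    have AH: "A * H = l *\<^sub>R A"
      using A(5) poly_at_commute[of e H H q] by (simp add: A_def H)
    have AA: "A * A = poly q l *\<^sub>R A"
      using poly_at_eigen[OF A(1,5), of q] by (simp add: A_def)
    \<comment> \<open>Self-adjointness gives |A|^2 = q(l) times the inner product of
      \<open>e\<close> and \<open>A\<close>, so q(l) = 0 would force A = 0. Dividing by q(l) makes
      \<open>A\<close> idempotent.\<close>
    have "inner A A = inner e (A * A)"
      using inner_mult_left[of A e A] A by simp
    then have mu: "poly q l \<noteq> 0" using A(4) AA by auto
    define E where "E = (1 / poly q l) *\<^sub>R A"
    have A_eq: "A = poly q l *\<^sub>R E" using mu by (simp add: E_def)
    have E: "e * E = E" "E * e = E" "star E = E" "E \<noteq> 0" "H * E = l *\<^sub>R E" "E * H = l *\<^sub>R E" "E * E = E"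
      using A AA AH mu by (simp_all add: E_def)
    define e' H' where "e' = e - E" and "H' = H - l *\<^sub>R E"
    have saj: "self_adjoint_in e' H'"
      by unfold_locales (simp_all add: e'_def H'_def E e H algebra_simps)
    have H'_eq: "H' = H * e'" "e' * H = H * e'" "e * e' = e'" "e' * e = e'"
      by (simp_all add: e'_def H'_def E e H algebra_simps)
    \<comment> \<open>Polynomials in the restricted operator, with unit \<open>e'\<close>, are
      restrictions of polynomials in \<open>H\<close>. So q evaluates on the complement to q(H) e' =
      q(l) E (e - E) = 0.\<close>
    have restrict: "poly_at e' H' r = poly_at e H r * e'" for r
    proof (induction r)
      case (pCons a r)
      have "H' * (poly_at e H r * e') = H * (e' * poly_at e H r) * e'"
        by (simp add: H'_eq mult.assoc)
      also have "e' * poly_at e H r = poly_at e H r * e'"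
        using poly_at_commute[of e e' H r] H'_eq by simp
      also have "H * (poly_at e H r * e') * e' = H * poly_at e H r * e'"
        using saj by (simp add: mult.assoc self_adjoint_in_def)
      finally show ?case using pCons by (simp add: distrib_right H'_eq mult.assoc)
    qed simp
    have "poly_at e' H' q = 0"
      using restrict[of q] by (simp add: A_def[symmetric] A_eq e'_def algebra_simps E)
    then obtain m l' F where F: "spectral_decomp e' H' m l' F"
      using less.hyps[of q e' H'] saj q deg' by fastforce
    define G where "G = case_nat E F"
    define l'' where "l'' = case_nat l l'"
    have Fe: "F i * e' = F i" "e' * F i = F i" if "i < m" for i
    proof -
      have "F i * e' = (\<Sum>j<m. F i * F j)" "e' * F i = (\<Sum>j<m. F j * F i)"
        by (simp_all add: spectral_decompD(4)[OF F] sum_distrib_left sum_distrib_right)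
      moreover have "(\<Sum>j<m. F i * F j) = (\<Sum>j<m. if j = i then F i else 0)"
        "(\<Sum>j<m. F j * F i) = (\<Sum>j<m. if j = i then F i else 0)"
        using that by (auto intro!: sum.cong simp: spectral_decompD(3)[OF F])
      ultimately show "F i * e' = F i" "e' * F i = F i" using that by simp_all
    qed
    have EF: "E * F i = 0" "F i * E = 0" if "i < m" for i
    proof -
      have "E * e' = 0" "e' * E = 0" by (simp_all add: e'_def E algebra_simps)
      then show "E * F i = 0" "F i * E = 0"
        using Fe[OF that] by (metis mult.assoc mult_zero_left mult_zero_right)+
    qed
    have comm: "G i * B = B * G i" if "e * B = B * e" "H * B = B * H" "i < Suc m" for B i
    proof -
      have "A * B = B * A" unfolding A_def by (rule poly_at_commute) (use that in auto)
      then have EB: "E * B = B * E" by (simp add: E_def)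
      then have "e' * B = B * e'" "H' * B = B * H'"
        using that(1,2) unfolding e'_def H'_def left_diff_distrib right_diff_distrib by simp_all
      then have "F i * B = B * F i" if "i < m" for i
        using spectral_decompD(6)[OF F] that by blast
      then show ?thesis using EB that(3) by (cases i) (simp_all only: G_def nat.case Suc_less_eq)
    qed
    have sum_split: "(\<Sum>i<Suc m. f i) = f 0 + (\<Sum>i<m. f (Suc i))" for f :: "nat \<Rightarrow> finmat"
      by (rule sum.lessThan_Suc_shift)
    have "e = E + e'" "H = l *\<^sub>R E + H'" by (simp_all add: e'_def H'_def)
    then have sums: "e = (\<Sum>i<Suc m. G i)" "H = (\<Sum>i<Suc m. l'' i *\<^sub>R G i)"
      unfolding sum_split using spectral_decompD(4,5)[OF F] by (simp_all add: G_def l''_def)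
    have "spectral_decomp e H (Suc m) l'' G"
      unfolding spectral_decomp_def
    proof (intro conjI allI impI sums)
      fix i assume i: "i < Suc m"
      show "star (G i) = G i" "G i \<noteq> 0"
        using i E spectral_decompD(1,2)[OF F] by (auto simp: G_def split: nat.split)
      fix j assume j: "j < Suc m"
      show "G i * G j = (if i = j then G i else 0)"
        using i j E EF spectral_decompD(3)[OF F] by (auto simp: G_def split: nat.split)
    next
      fix B i assume "e * B = B * e" "H * B = B * H" "i < Suc m"
      then show "G i * B = B * G i" by (rule comm)
    qed
    then show ?thesis by blast
  qed
qed

text \<open>Over the reals the corner is spanned by the finite set \<open>U\<close> of matrix units
  and their multiples by the imaginary unit, so \<open>card U + 1\<close> powers of \<open>H\<close>
  are linearly dependent.\<close>

lemma corner_annihilated: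
  assumes H: "in_corner d H"
  shows "\<exists>p. p \<noteq> 0 \<and> poly_at (eye d) H p = 0"
proof -
  define U where "U = (\<lambda>(i, j, c). trunc_mat d (\<lambda>a b. if a = i \<and> b = j then c else 0)) `
    ({..<d} \<times> {..<d} \<times> {1, \<i>})"
  have fin_U: "finite U" by (simp add: U_def)
  have in_span: "X \<in> span U" if X: "in_corner d X" for X
  proof -
    define u where "u = (\<lambda>i j c. trunc_mat d (\<lambda>a b. if a = i \<and> b = j then c else 0))"
    have u: "u i j c \<in> U" if "i < d" "j < d" "c = 1 \<or> c = \<i>" for i j c
      using that by (auto simp: U_def u_def image_iff)
    have "X = (\<Sum>i<d. \<Sum>j<d. Re (entry X i j) *\<^sub>R u i j 1 + Im (entry X i j) *\<^sub>R u i j \<i>)" (is "X = ?Y")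
    proof (rule finmat_eqI)
      fix a b
      have "entry ?Y a b = (\<Sum>i<d. \<Sum>j<d. if b = j then if a = i then entry X a b else 0 else 0)"
        unfolding entry_sum by (intro sum.cong refl) (auto simp: u_def complex_eq_iff)
      also have "\<dots> = entry X a b" using X by (cases "b < d") (simp_all add: in_corner_iff entry_eq_0)
      finally show "entry X a b = entry ?Y a b" ..
    qed
    also have "\<dots> \<in> span U"
      by (intro span_sum span_add span_scale span_base u) auto
    finally show ?thesis .
  qed
  define h where "h = (\<lambda>k. poly_at (eye d) H (monom 1 k))"
  have poly_corner: "in_corner d (poly_at (eye d) H p)" for p
    using H by (induction p) simp_all
  show ?thesis
  \<comment> \<open>Linear dependence is a property of sets, not of families, so coinciding powers
    are treated separately: their difference is the annihilator.\<close>
  proof (cases "inj_on h {..card U}")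
    case False
    then obtain i j where ij: "h i = h j" "i \<noteq> j" by (auto simp: inj_on_def)
    have "coeff (monom 1 i - monom (1::real) j) i = 1" using ij by simp
    then have "monom 1 i - monom (1::real) j \<noteq> 0" by (metis coeff_0 zero_neq_one)
    then show ?thesis using ij by (intro exI[of _ "monom 1 i - monom 1 j"]) (simp add: h_def poly_at_diff)
  next
    case True
    have "card (h ` {..card U}) = Suc (card U)" using True by (simp add: card_image)
    moreover have "h ` {..card U} \<subseteq> span U" using in_span poly_corner by (auto simp: h_def)
    ultimately have "dependent (h ` {..card U})"
      using independent_span_bound[OF fin_U] by fastforce
    then obtain u where u: "\<exists>v\<in>h ` {..card U}. u v \<noteq> 0" "(\<Sum>v\<in>h ` {..card U}. u v *\<^sub>R v) = 0"
      by (subst (asm) dependent_finite) auto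
    define p where "p = (\<Sum>k\<le>card U. monom (u (h k)) k)"
    have coeff: "coeff p k = u (h k)" if "k \<le> card U" for k
      using that by (simp add: p_def coeff_sum)
    have "p \<noteq> 0" using u(1) coeff by (metis atMost_iff coeff_0 imageE)
    moreover have "poly_at (eye d) H p = (\<Sum>k\<le>card U. u (h k) *\<^sub>R h k)"
      unfolding p_def poly_at_sum h_def by (intro sum.cong refl) (simp flip: poly_at_smult add: smult_monom)
    moreover have "\<dots> = 0" using u(2) sum.reindex[OF True, of "\<lambda>v. u v *\<^sub>R v"] by simp
    ultimately show ?thesis by auto
  qed
qed

theorem spectral_theorem:
  assumes "in_corner d H" "star H = H"
  obtains m l E where "spectral_decomp (eye d) H m l E"
proof -
  have "self_adjoint_in (eye d) H" using assms by unfold_locales simp_all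
  then show ?thesis using corner_annihilated[OF assms(1)] spectral_decomp_if_annihilated that by blast
qed

lemma spectral_calculus:
  assumes "spectral_decomp e H m l E"
  shows "(\<Sum>i<m. a i *\<^sub>R E i) * (\<Sum>i<m. b i *\<^sub>R E i) = (\<Sum>i<m. (a i * b i) *\<^sub>R E i)"
    and "(norm (\<Sum>i<m. a i *\<^sub>R E i))\<^sup>2 = (\<Sum>i<m. (a i)\<^sup>2 * (norm (E i))\<^sup>2)"
    and "star (\<Sum>i<m. a i *\<^sub>R E i) = (\<Sum>i<m. a i *\<^sub>R E i)"
proof -
  have E: "E i * E j = (if i = j then E i else 0)" "star (E i) = E i" if "i < m" "j < m" for i j
    using that spectral_decompD(1,3)[OF assms] by auto
  have "(\<Sum>i<m. a i *\<^sub>R E i) * (\<Sum>j<m. b j *\<^sub>R E j) = (\<Sum>i<m. \<Sum>j<m. if j = i then (a i * b i) *\<^sub>R E i else 0)"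
    unfolding sum_product using E by (intro sum.cong refl) auto
  then show "(\<Sum>i<m. a i *\<^sub>R E i) * (\<Sum>j<m. b j *\<^sub>R E j) = (\<Sum>i<m. (a i * b i) *\<^sub>R E i)"
    by simp
  have ip: "inner (E i) (E j) = (if i = j then (norm (E i))\<^sup>2 else 0)" if "i < m" "j < m" for i j
  proof -
    have "inner (E i) (E j) = inner (E i * E i) (E j)" using E that by simp
    also have "\<dots> = inner (E i) (E i * E j)" by (simp only: inner_mult_left E(2)[OF that])
    finally show ?thesis using E that by (auto simp: power2_norm_eq_inner)
  qed
  have "inner (\<Sum>i<m. a i *\<^sub>R E i) (\<Sum>i<m. a i *\<^sub>R E i) = (\<Sum>i<m. \<Sum>j<m. a i * (a j * inner (E i) (E j)))"
    by (simp add: inner_sum_left inner_sum_right sum_distrib_left inner_commute mult.left_commute)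
  also have "\<dots> = (\<Sum>i<m. \<Sum>j<m. if j = i then (a i)\<^sup>2 * (norm (E i))\<^sup>2 else 0)"
    using ip by (intro sum.cong refl) (auto simp: power2_eq_square mult.assoc)
  finally show "(norm (\<Sum>i<m. a i *\<^sub>R E i))\<^sup>2 = (\<Sum>i<m. (a i)\<^sup>2 * (norm (E i))\<^sup>2)"
    by (simp add: power2_norm_eq_inner)
  show "star (\<Sum>i<m. a i *\<^sub>R E i) = (\<Sum>i<m. a i *\<^sub>R E i)"
    using E by simp
qed

text \<open>For a real number t one has |sgn t - t| \<le> |t^2 - 1|, because |sgn t + t| \<ge> 1.
  Summing over the spectrum with weights |E i|^2 gives the Frobenius bound without any dependence on
  \<open>d\<close>.\<close>

lemma sign_round:
  assumes H: "in_corner d H" "star H = H"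
  obtains S where "obs d S" "norm (S - H) \<le> norm (H * H - eye d)"
    "\<And>B. in_corner d B \<Longrightarrow> H * B = B * H \<Longrightarrow> S * B = B * S"
proof -
  obtain m l E where sp: "spectral_decomp (eye d) H m l E"
    using spectral_theorem[OF H] .
  \<comment> \<open>The sign of 0 is taken to be 1, so that S * S is exactly the unit even on the
    kernel of \<open>H\<close>.\<close>
  define s where "s = (\<lambda>i. if l i \<ge> 0 then 1 else (-1::real))"
  define S where "S = (\<Sum>i<m. s i *\<^sub>R E i)"
  have eye: "eye d = (\<Sum>i<m. 1 *\<^sub>R E i)" and H_eq: "H = (\<Sum>i<m. l i *\<^sub>R E i)"
    using spectral_decompD(4,5)[OF sp] by simp_all
  have comm: "S * B = B * S" if "in_corner d B" "H * B = B * H" for B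
  proof -
    have "\<forall>i<m. E i * B = B * E i"
      using spectral_decompD(6)[OF sp _ that(2)] that(1) by simp
    then show ?thesis by (simp add: S_def sum_distrib_left sum_distrib_right)
  qed
  have "S * S = eye d"
    using spectral_calculus(1)[OF sp, of s s] eye by (simp add: S_def s_def if_distrib cong: if_cong)
  moreover have "S * eye d = S" "eye d * S = S"
    using spectral_calculus(1)[OF sp, of s "\<lambda>_. 1"] spectral_calculus(1)[OF sp, of "\<lambda>_. 1" s]
    unfolding eye[symmetric] S_def by simp_all
  moreover have "star S = S" unfolding S_def by (rule spectral_calculus(3)[OF sp])
  ultimately have "obs d S" unfolding obs_def in_corner_def by blast
  moreover have "norm (S - H) \<le> norm (H * H - eye d)"
  proof (rule power2_le_imp_le)
    have "S - H = (\<Sum>i<m. (s i - l i) *\<^sub>R E i)"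
      by (simp add: S_def H_eq scaleR_diff_left sum_subtractf)
    then have "(norm (S - H))\<^sup>2 = (\<Sum>i<m. (s i - l i)\<^sup>2 * (norm (E i))\<^sup>2)"
      by (simp add: spectral_calculus(2)[OF sp])
    also have "\<dots> \<le> (\<Sum>i<m. (l i * l i - 1)\<^sup>2 * (norm (E i))\<^sup>2)"
    proof (intro sum_mono mult_right_mono)
      fix i
      have "\<bar>s i - l i\<bar> * 1 \<le> \<bar>s i - l i\<bar> * \<bar>s i + l i\<bar>"
        by (rule mult_left_mono) (auto simp: s_def)
      also have "\<dots> = \<bar>l i * l i - 1\<bar>" by (auto simp: s_def abs_mult[symmetric] algebra_simps)
      finally show "(s i - l i)\<^sup>2 \<le> (l i * l i - 1)\<^sup>2" by (simp add: abs_le_square_iff)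
    qed simp
    also have "\<dots> = (norm (\<Sum>i<m. (l i * l i - 1) *\<^sub>R E i))\<^sup>2"
      by (simp add: spectral_calculus(2)[OF sp])
    also have "(\<Sum>i<m. (l i * l i - 1) *\<^sub>R E i) = H * H - eye d"
      unfolding H_eq spectral_calculus(1)[OF sp] scaleR_diff_left sum_subtractf eye[symmetric] ..
    finally show "(norm (S - H))\<^sup>2 \<le> (norm (H * H - eye d))\<^sup>2" .
  qed simp
  ultimately show ?thesis using that comm by blast
qed

section \<open>Rounding to observables and projective measurements\<close>

lemma obsD: "obs d X \<Longrightarrow> in_corner d X" "obs d X \<Longrightarrow> star X = X" "obs d X \<Longrightarrow> X * X = eye d"
  by (simp_all add: obs_def)

lemma projD: "proj d X \<Longrightarrow> in_corner d X" "proj d X \<Longrightarrow> star X = X" "proj d X \<Longrightarrow> X * X = X"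
  by (simp_all add: proj_def)

lemma mult_bound_projD: "proj d P \<Longrightarrow> mult_bound 1 P"
  by (simp add: mult_bound_proj projD)

lemma obs_mult_mult: "obs d X \<Longrightarrow> in_corner d B \<Longrightarrow> X * (X * B) = B"
  by (simp add: obsD mult.assoc[symmetric])

lemma proj_mult_mult: "proj d X \<Longrightarrow> X * (X * B) = X * B"
  by (simp add: projD mult.assoc[symmetric])

lemma obs_of_proj: "proj d P \<Longrightarrow> obs d (2 *\<^sub>R P - eye d)"
  by (auto simp: obs_def projD algebra_simps)
    (simp flip: scaleR_add_left)

lemma proj_of_obs: "obs d X \<Longrightarrow> proj d ((1/2) *\<^sub>R (X + eye d))"
  by (auto simp: proj_def obsD algebra_simps) (simp flip: scaleR_add_left add: add.assoc[symmetric])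

text \<open>Pass to the self-adjoint part \<open>H\<close>, at distance \<delta>/2, and take its
  sign. H^2 - 1 differs from A^2 - 1 by terms containing \<open>D\<close>, each of order K
  \<delta>.\<close>

lemma round_obs:
  assumes A: "in_corner d A" "mult_bound K A"
    and \<delta>: "norm (A - star A) \<le> \<delta>" "norm (A * A - eye d) \<le> \<delta>"
  shows "\<exists>X. obs d X \<and> norm (X - A) \<le> (2 + 2 * K) * \<delta>"
proof -
  define D where "D = A - star A"
  define H where "H = A - (1/2) *\<^sub>R D"
  have K: "0 \<le> K" using A(2) by (rule mult_boundD)
  have nD: "norm D \<le> \<delta>" using \<delta> by (simp add: D_def)
  have \<delta>0: "0 \<le> \<delta>" using \<delta>(1) norm_ge_zero order_trans by blast
  have H_eq: "H = (1/2) *\<^sub>R (A + star A)"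
    by (simp add: H_def D_def algebra_simps) (simp flip: scaleR_add_left)
  have H: "in_corner d H" "star H = H" using A by (simp_all add: H_eq add.commute)
  obtain S where S: "obs d S" "norm (S - H) \<le> norm (H * H - eye d)"
    using sign_round[OF H] by metis
  have 1: "norm (A * D) \<le> K * \<delta>" "norm (D * A) \<le> K * \<delta>"
    using mult_boundD[OF A(2)] nD K by (meson mult_left_mono order_trans)+
  have "norm (D * star A) \<le> K * \<delta>"
    using mult_boundD[OF mult_bound_star[OF A(2)]] nD K by (meson mult_left_mono order_trans)
  \<comment> \<open>Expanding one factor as A - star A, both bounded in operator norm, keeps the
    estimate linear in \<delta> and free of \<open>d\<close>.\<close>
  then have 2: "norm (D * D) \<le> 2 * (K * \<delta>)"
    using 1(2) norm_triangle_ineq4[of "D * A" "D * star A"]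
    by (simp add: D_def[symmetric] flip: right_diff_distrib)
  have "H * H - eye d = (A * A - eye d) - (1/2) *\<^sub>R (A * D + D * A) + (1/4) *\<^sub>R (D * D)"
    by (simp add: H_def algebra_simps)
  also have "norm \<dots> \<le> \<delta> + (1/2) * (K * \<delta> + K * \<delta>) + (1/4) * (2 * (K * \<delta>))"
    by (intro norm_triangle_le add_mono order_trans[OF norm_triangle_ineq4] \<delta>)
      (use 1 2 norm_triangle_ineq[of "A * D" "D * A"] in auto)
  finally have "norm (S - H) \<le> \<delta> + (1/2) * (K * \<delta> + K * \<delta>) + (1/4) * (2 * (K * \<delta>))"
    using S(2) by linarith
  moreover have "norm (H - A) \<le> (1/2) * \<delta>" using nD by (simp add: H_def)
  moreover have "norm (S - A) \<le> norm (S - H) + norm (H - A)"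
    using norm_triangle_ineq[of "S - H" "H - A"] by simp
  moreover have "0 \<le> K * \<delta>" using K \<delta>0 by simp
  ultimately have "norm (S - A) \<le> (2 + 2 * K) * \<delta>"
    using \<delta>0 by (simp add: algebra_simps)
  then show ?thesis using S(1) by blast
qed

text \<open>Round the reflection B = 2A - 1, for which B^2 - 1 = 4(A^2 - A). The constant is (1/2) *
  4 times that of \<open>round_obs\<close> for the bound 2K + 1.\<close>

lemma round_proj:
  assumes A: "in_corner d A" "mult_bound K A"
    and \<delta>: "norm (A - star A) \<le> \<delta>" "norm (A * A - A) \<le> \<delta>"
  shows "\<exists>P. proj d P \<and> norm (P - A) \<le> (8 + 8 * K) * \<delta>"
proof -
  define B where "B = 2 *\<^sub>R A - eye d"
  have B: "in_corner d B" using A by (simp add: B_def)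
  have mb: "mult_bound (2 * K + 1) B"
    using mult_bound_diff[OF mult_bound_scaleR[OF A(2), of 2] mult_bound_eye] by (simp add: B_def)
  have "B - star B = 2 *\<^sub>R (A - star A)" by (simp add: B_def algebra_simps)
  then have "norm (B - star B) = 2 * norm (A - star A)" by simp
  then have 1: "norm (B - star B) \<le> 4 * \<delta>" using \<delta> norm_ge_zero[of "A - star A"] by linarith
  have "B * B - eye d = 4 *\<^sub>R (A * A - A)"
    using A by (simp add: B_def algebra_simps) (simp flip: scaleR_add_left)
  then have 2: "norm (B * B - eye d) \<le> 4 * \<delta>" using \<delta> by simp
  obtain X where X: "obs d X" "norm (X - B) \<le> (2 + 2 * (2 * K + 1)) * (4 * \<delta>)"
    using round_obs[OF B mb 1 2] by blast
  define P where "P = (1/2) *\<^sub>R (X + eye d)"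
  have "P - A = (1/2) *\<^sub>R (X - B)" by (simp add: P_def B_def algebra_simps)
  then have "norm (P - A) = (1/2) * norm (X - B)" by simp
  also have "\<dots> \<le> (8 + 8 * K) * \<delta>" using X(2) by (simp add: algebra_simps)
  finally show ?thesis using proj_of_obs[OF X(1)] by (auto simp: P_def)
qed

section \<open>Almost commuting families of observables\<close>

lemma norm_mult_le1: "mult_bound 1 A \<Longrightarrow> norm (A * X) \<le> norm X" "mult_bound 1 A \<Longrightarrow> norm (X * A) \<le> norm X"
  by (simp_all add: mult_bound_def)

lemma norm_mult_diff_le:
  assumes "mult_bound 1 A'" "mult_bound 1 B"
  shows "norm (A * B - A' * B') \<le> norm (A - A') + norm (B - B')"
proof -
  have "A * B - A' * B' = (A - A') * B + A' * (B - B')" by (simp add: algebra_simps)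
  also have "norm \<dots> \<le> norm ((A - A') * B) + norm (A' * (B - B'))" by (rule norm_triangle_ineq)
  also have "\<dots> \<le> norm (A - A') + norm (B - B')"
    using assms by (intro add_mono norm_mult_le1)
  finally show ?thesis .
qed

text \<open>The group average is built one generator at a time, by H |-> (H + Z H Z)/2. The change
  is half the commutator of Z and H, which is at most \<eta> plus twice the error e so far. So e
  becomes at most 2e + \<eta>, whence the factor 2^n - 1.\<close>

lemma commuting_average:
  assumes "finite J" "\<And>j. j \<in> J \<Longrightarrow> obs d (Z j)" "\<And>i j. i \<in> J \<Longrightarrow> j \<in> J \<Longrightarrow> Z i * Z j = Z j * Z i"
    and X: "in_corner d X" "star X = X" "mult_bound 1 X"
    and "\<And>j. j \<in> J \<Longrightarrow> norm (Z j * X - X * Z j) \<le> \<eta>"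
  shows "\<exists>H. in_corner d H \<and> star H = H \<and> mult_bound 1 H \<and> (\<forall>j\<in>J. Z j * H = H * Z j) \<and>
    norm (H - X) \<le> (2 ^ card J - 1) * \<eta>"
  using assms(1-3,7)
proof (induction J)
  case empty
  then show ?case using X by (intro exI[of _ X]) simp
next
  case (insert j J)
  then obtain H where H: "in_corner d H" "star H = H" "mult_bound 1 H" "\<And>i. i \<in> J \<Longrightarrow> Z i * H = H * Z i"
    "norm (H - X) \<le> (2 ^ card J - 1) * \<eta>"
    by (metis insertCI)
  have Zj: "in_corner d (Z j)" "star (Z j) = Z j" "Z j * Z j = eye d" "mult_bound 1 (Z j)"
    using insert.prems(1)[of j] by (auto dest: obsD mult_bound_obs)
  define H' where "H' = (1/2) *\<^sub>R (H + Z j * (H * Z j))"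
  have corner: "in_corner d H'" using H Zj by (simp add: H'_def)
  have star: "star H' = H'" using H Zj by (simp add: H'_def mult.assoc)
  have "mult_bound (1 * (1 * 1)) (Z j * (H * Z j))" by (intro mult_bound_mult Zj H)
  from mult_bound_scaleR[OF mult_bound_add[OF H(3) this], of "1/2"]
  have mb: "mult_bound 1 H'" by (simp add: H'_def)
  have c1: "Z j * H' = H' * Z j"
    using H Zj obs_mult_mult[OF insert.prems(1), of j "H * Z j"]
    by (simp add: H'_def distrib_left distrib_right mult.assoc)
  \<comment> \<open>Averaging over a further \<open>Z j\<close> keeps the earlier commutation
    relations because \<open>Z i\<close> and \<open>Z j\<close> commute.\<close>
  have c2: "Z i * H' = H' * Z i" if i: "i \<in> J" for i
  proof -
    have "Z i * (Z j * (H * Z j)) = Z j * (Z i * H) * Z j"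
      using insert.prems(2)[of i j] i by (simp add: mult.assoc[symmetric])
    also have "\<dots> = Z j * H * (Z i * Z j)" using H(4)[OF i] by (simp add: mult.assoc)
    also have "\<dots> = Z j * (H * Z j) * Z i" using insert.prems(2)[of i j] i by (simp add: mult.assoc)
    finally show ?thesis using H(4)[OF i] by (simp add: H'_def distrib_left distrib_right)
  qed
  have "H' - H = (1/2) *\<^sub>R ((Z j * H - H * Z j) * Z j)"
    using H Zj by (simp add: H'_def algebra_simps) (simp flip: scaleR_add_left)
  then have "norm (H' - H) \<le> (1/2) * norm (Z j * H - H * Z j)"
    using norm_mult_le1(2)[OF Zj(4)] by simp
  moreover have "Z j * H - H * Z j = (Z j * X - X * Z j) + (Z j * (H - X) - (H - X) * Z j)"
    by (simp add: algebra_simps)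
  then have "norm (Z j * H - H * Z j) \<le> norm (Z j * X - X * Z j) + norm (Z j * (H - X) - (H - X) * Z j)"
    by (metis norm_triangle_ineq)
  moreover have "norm (Z j * (H - X) - (H - X) * Z j) \<le> norm (H - X) + norm (H - X)"
    by (intro order_trans[OF norm_triangle_ineq4] add_mono norm_mult_le1 Zj)
  moreover have "norm (Z j * X - X * Z j) \<le> \<eta>" by (rule insert.prems) simp
  moreover have "0 \<le> \<eta>" using calculation(4) norm_ge_zero order_trans by blast
  moreover have "norm (H' - X) \<le> norm (H' - H) + norm (H - X)"
    using norm_triangle_ineq[of "H' - H" "H - X"] by simp
  ultimately have "norm (H' - X) \<le> 2 * norm (H - X) + \<eta>" by linarith
  also have "\<dots> \<le> 2 * ((2 ^ card J - 1) * \<eta>) + \<eta>" using H(5) by simp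
  also have "\<dots> = (2 ^ card (insert j J) - 1) * \<eta>" using insert.hyps by (simp add: algebra_simps)
  finally show ?case using corner star mb c1 c2 by blast
qed

definition commuting_on :: "'i set \<Rightarrow> ('i \<Rightarrow> finmat) \<Rightarrow> bool" where
  "commuting_on J Z \<longleftrightarrow> (\<forall>i\<in>J. \<forall>j\<in>J. Z i * Z j = Z j * Z i)"

lemma commuting_onI: "(\<And>i j. i \<in> J \<Longrightarrow> j \<in> J \<Longrightarrow> Z i * Z j = Z j * Z i) \<Longrightarrow> commuting_on J Z"
  unfolding commuting_on_def by (intro ballI)

lemma commuting_onD: assumes "commuting_on J Z" shows "i \<in> J \<Longrightarrow> j \<in> J \<Longrightarrow> Z i * Z j = Z j * Z i"
  by (rule bspec[OF bspec[OF assms[unfolded commuting_on_def]]])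

text \<open>Cost of adding one observable to n rounded ones: 1 + 2C bounds its commutators with
  them, 2^n - 1 comes from averaging, and 3 from taking the sign (2) on top of the average itself
  (1). The summand C makes the constant cover the old members too.\<close>

fun commuting_const :: "nat \<Rightarrow> real" where
  "commuting_const 0 = 0"
| "commuting_const (Suc n) = commuting_const n + 3 * ((2 ^ n - 1) * (1 + 2 * commuting_const n))"

lemma commuting_const_nonneg: "0 \<le> commuting_const n"
  by (induction n) simp_all

text \<open>The observables are treated one after another: average the next one over those already
  commuting, then take the sign. The sign commutes with every \<open>Z j\<close> because the average
  does.\<close>

lemma commuting_round:
  assumes "finite J" "\<And>j. j \<in> J \<Longrightarrow> obs d (X j)"
    "\<And>i j. i \<in> J \<Longrightarrow> j \<in> J \<Longrightarrow> norm (X i * X j - X j * X i) \<le> \<delta>"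
  shows "\<exists>Z. (\<forall>j\<in>J. obs d (Z j) \<and> norm (Z j - X j) \<le> commuting_const (card J) * \<delta>) \<and> commuting_on J Z"
  using assms
proof (induction J)
  case empty
  show ?case by (simp add: commuting_on_def)
next
  case (insert k J)
  define C where "C = commuting_const (card J)"
  have C: "0 \<le> C" by (simp add: C_def commuting_const_nonneg)
  define C' where "C' = commuting_const (card (insert k J))"
  have C'_eq: "C' = C + 3 * ((2 ^ card J - 1) * (1 + 2 * C))"
    using insert.hyps by (simp add: C'_def C_def)
  have \<delta>: "0 \<le> \<delta>" using insert.prems(2)[of k k] by simp
  obtain Z where Z0: "\<forall>j\<in>J. obs d (Z j) \<and> norm (Z j - X j) \<le> C * \<delta>" and ZZ: "commuting_on J Z"
    using insert.IH insert.prems unfolding C_def by blast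
  then have Z: "obs d (Z j)" "norm (Z j - X j) \<le> C * \<delta>" if "j \<in> J" for j using that by auto
  have Xk: "in_corner d (X k)" "star (X k) = X k" "mult_bound 1 (X k)" "X k * X k = eye d"
    using insert.prems(1)[of k] by (auto dest: obsD mult_bound_obs)
  have comm: "norm (Z j * X k - X k * Z j) \<le> (1 + 2 * C) * \<delta>" if j: "j \<in> J" for j
  proof -
    have "Z j * X k - X k * Z j = (X j * X k - X k * X j) + ((Z j - X j) * X k - X k * (Z j - X j))"
      by (simp add: algebra_simps)
    also have "norm \<dots> \<le> \<delta> + (C * \<delta> + C * \<delta>)"
      using j insert.prems(2)[of j k] order_trans[OF norm_mult_le1(1)[OF Xk(3)] Z(2)[OF j]]
        order_trans[OF norm_mult_le1(2)[OF Xk(3)] Z(2)[OF j]]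
      by (intro norm_triangle_mono order_trans[OF norm_triangle_ineq4 add_mono]) auto
    finally show ?thesis by (simp add: algebra_simps)
  qed
  have "\<exists>H. in_corner d H \<and> star H = H \<and> mult_bound 1 H \<and> (\<forall>j\<in>J. Z j * H = H * Z j) \<and>
    norm (H - X k) \<le> (2 ^ card J - 1) * ((1 + 2 * C) * \<delta>)"
    by (rule commuting_average[OF insert.hyps(1) _ _ Xk(1-3)]) (fact Z(1) commuting_onD[OF ZZ] comm)+
  then obtain H where H: "in_corner d H" "star H = H" "mult_bound 1 H" "\<And>j. j \<in> J \<Longrightarrow> Z j * H = H * Z j"
    "norm (H - X k) \<le> (2 ^ card J - 1) * ((1 + 2 * C) * \<delta>)"
    by blast
  obtain S where S: "obs d S" "norm (S - H) \<le> norm (H * H - eye d)"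
    "\<And>B. in_corner d B \<Longrightarrow> H * B = B * H \<Longrightarrow> S * B = B * S"
    by (rule sign_round[OF H(1,2)], rule that, assumption, assumption, blast)
  \<comment> \<open>The unit is the square of \<open>X k\<close>, so this is a difference of two
    products of contractions.\<close>
  have "norm (H * H - eye d) \<le> norm (H - X k) + norm (H - X k)"
    using norm_mult_diff_le[OF Xk(3) H(3), of H "X k"] Xk by simp
  moreover have "norm (S - X k) \<le> norm (S - H) + norm (H - X k)"
    using norm_triangle_ineq[of "S - H" "H - X k"] by simp
  ultimately have "norm (S - X k) \<le> 3 * ((2 ^ card J - 1) * ((1 + 2 * C) * \<delta>))"
    using S(2) H(5) by linarith
  also have "\<dots> \<le> C' * \<delta>" using C \<delta> by (simp add: C'_eq algebra_simps)
  finally have SX: "norm (S - X k) \<le> C' * \<delta>" .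
  have "C * \<delta> \<le> C' * \<delta>" using C \<delta> by (simp add: C'_eq mult_right_mono)
  then have ZX: "norm (Z j - X j) \<le> C' * \<delta>" if "j \<in> J" for j
    using Z(2)[OF that] by simp
  have SZ: "S * Z j = Z j * S" if "j \<in> J" for j
    using that Z(1) H(4) by (metis S(3) obsD(1))
  have "commuting_on (insert k J) (Z(k := S))"
  proof (rule commuting_onI)
    fix i j assume "i \<in> insert k J" "j \<in> insert k J"
    then show "(Z(k := S)) i * (Z(k := S)) j = (Z(k := S)) j * (Z(k := S)) i"
      using commuting_onD[OF ZZ] SZ by (cases "i = k"; cases "j = k") auto
  qed
  moreover have "\<forall>j\<in>insert k J. obs d ((Z(k := S)) j) \<and> norm ((Z(k := S)) j - X j) \<le> C' * \<delta>"
    using Z(1) S(1) SX ZX insert.hyps(2) by auto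
  ultimately show ?case unfolding C'_def[symmetric] by blast
qed

section \<open>Orthogonalisation and projective measurements\<close>

lemma proj_sum:
  assumes "finite A" "\<And>a. a \<in> A \<Longrightarrow> proj d (Q a)"
    "\<And>a b. a \<in> A \<Longrightarrow> b \<in> A \<Longrightarrow> a \<noteq> b \<Longrightarrow> Q a * Q b = 0"
  shows "proj d (\<Sum>a\<in>A. Q a)" "b \<in> A \<Longrightarrow> (\<Sum>a\<in>A. Q a) * Q b = Q b" "b \<in> A \<Longrightarrow> Q b * (\<Sum>a\<in>A. Q a) = Q b"
proof -
  have QQ: "Q a * Q b = (if a = b then Q b else 0)" if "a \<in> A" "b \<in> A" for a b
    using assms(2,3) that by (cases "a = b") (simp_all add: projD(3)[of d])
  show l: "(\<Sum>a\<in>A. Q a) * Q b = Q b" if "b \<in> A" for b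
  proof -
    have "(\<Sum>a\<in>A. Q a) * Q b = (\<Sum>a\<in>A. if a = b then Q b else 0)"
      unfolding sum_distrib_right using QQ that by (intro sum.cong refl) auto
    then show ?thesis using assms(1) that by simp
  qed
  show "Q b * (\<Sum>a\<in>A. Q a) = Q b" if "b \<in> A"
  proof -
    have "Q b * (\<Sum>a\<in>A. Q a) = (\<Sum>a\<in>A. if a = b then Q b else 0)"
      unfolding sum_distrib_left using QQ that by (intro sum.cong refl) auto
    then show ?thesis using assms(1) that by simp
  qed
  have "(\<Sum>a\<in>A. Q a) * (\<Sum>b\<in>A. Q b) = (\<Sum>b\<in>A. Q b)"
    unfolding sum_distrib_left[of "\<Sum>a\<in>A. Q a"] using l by (intro sum.cong refl) auto
  then show "proj d (\<Sum>a\<in>A. Q a)"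
    using assms(2) by (auto simp: proj_def)
qed

lemma proj_diff:
  assumes "proj d P" "proj d R" "P * R = R * P"
  shows "proj d (P - P * R)"
proof -
  have "P * R * (P * R) = P * R"
    using assms by (metis mult.assoc projD(3))
  moreover have "P * (P * R) = P * R" using proj_mult_mult[OF assms(1)] .
  moreover have "P * R * P = P * R" using assms by (metis mult.assoc projD(3))
  ultimately show ?thesis
    using assms by (auto simp: proj_def algebra_simps)
qed

text \<open>The next projection loses its product with each of the n projections already built, and
  each such product has norm at most (1 + C) \<delta>.\<close>

fun orthogonal_const :: "nat \<Rightarrow> real" where
  "orthogonal_const 0 = 0"
| "orthogonal_const (Suc n) = orthogonal_const n + real n * (1 + orthogonal_const n)"

lemma orthogonal_const_nonneg: "0 \<le> orthogonal_const n"
  by (induction n) simp_all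

text \<open>Induction invariant of \<open>orthogonalize\<close>: the projections already replaced
  still commute with the original ones that are yet to come.\<close>

definition in_bicommutant :: "'i set \<Rightarrow> ('i \<Rightarrow> finmat) \<Rightarrow> finmat \<Rightarrow> bool" where
  "in_bicommutant A P T \<longleftrightarrow> (\<forall>B. (\<forall>a\<in>A. P a * B = B * P a) \<longrightarrow> T * B = B * T)"

lemma in_bicommutantI:
  assumes "\<And>B. (\<And>a. a \<in> A \<Longrightarrow> P a * B = B * P a) \<Longrightarrow> T * B = B * T"
  shows "in_bicommutant A P T"
  unfolding in_bicommutant_def
proof (intro allI impI)
  fix B assume "\<forall>a\<in>A. P a * B = B * P a"
  then show "T * B = B * T" by (intro assms) (rule bspec)
qed

lemma in_bicommutantD:
  assumes "in_bicommutant A P T" "\<And>a. a \<in> A \<Longrightarrow> P a * B = B * P a"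
  shows "T * B = B * T"
  by (rule assms(1)[unfolded in_bicommutant_def, THEN spec, THEN mp]) (intro ballI assms(2))

text \<open>Gram-Schmidt for commuting projections. With \<open>R\<close> the sum of those already
  built, the next one is P k (1 - R); it is a projection because \<open>P k\<close> commutes with
  every \<open>Q a\<close>, by the bicommutant invariant.\<close>

lemma orthogonalize:
  assumes "finite A" "\<And>a. a \<in> A \<Longrightarrow> proj d (P a)" "commuting_on A P"
    "\<And>a b. a \<in> A \<Longrightarrow> b \<in> A \<Longrightarrow> a \<noteq> b \<Longrightarrow> norm (P a * P b) \<le> \<delta>" "0 \<le> \<delta>"
  shows "\<exists>Q. (\<forall>a\<in>A. proj d (Q a) \<and> norm (Q a - P a) \<le> orthogonal_const (card A) * \<delta> \<and> in_bicommutant A P (Q a)) \<and>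
    (\<forall>a\<in>A. \<forall>b\<in>A. a \<noteq> b \<longrightarrow> Q a * Q b = 0)"
  using assms
proof (induction A)
  case empty
  show ?case by simp
next
  case (insert k A)
  define C where "C = orthogonal_const (card A)"
  define C' where "C' = orthogonal_const (card (insert k A))"
  have C'_eq: "C' = C + card A * (1 + C)" using insert.hyps by (simp add: C'_def C_def)
  have C: "0 \<le> C" by (simp add: C_def orthogonal_const_nonneg)
  note P = insert.prems(1) commuting_onD[OF insert.prems(2)] insert.prems(3)
  note \<delta> = insert.prems(4)
  have "commuting_on A P" by (rule commuting_onI) (use P(2) in simp)
  then have "\<exists>Q. (\<forall>a\<in>A. proj d (Q a) \<and> norm (Q a - P a) \<le> C * \<delta> \<and> in_bicommutant A P (Q a)) \<and>
    (\<forall>a\<in>A. \<forall>b\<in>A. a \<noteq> b \<longrightarrow> Q a * Q b = 0)"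
    unfolding C_def by (intro insert.IH P(1,3) \<delta> insertI2)
  then obtain Q where
    Q0: "\<forall>a\<in>A. proj d (Q a) \<and> norm (Q a - P a) \<le> C * \<delta> \<and> in_bicommutant A P (Q a)"
    and QQ: "\<forall>a\<in>A. \<forall>b\<in>A. a \<noteq> b \<longrightarrow> Q a * Q b = 0"
    by (elim exE conjE) (rule that)
  then have Q: "proj d (Q a)" "norm (Q a - P a) \<le> C * \<delta>" "in_bicommutant A P (Q a)" if "a \<in> A" for a
    using that by auto
  define R where "R = (\<Sum>a\<in>A. Q a)"
  have R: "proj d R" "\<And>b. b \<in> A \<Longrightarrow> R * Q b = Q b"
    unfolding R_def using proj_sum[of A d Q] insert.hyps Q(1) QQ by auto
  have Pk: "proj d (P k)" using P by simp
  have QP: "Q a * P k = P k * Q a" if "a \<in> A" for a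
    by (rule in_bicommutantD[OF Q(3)[OF that]]) (use P(2) in auto)
  then have PR: "P k * R = R * P k" by (simp add: R_def sum_distrib_left sum_distrib_right)
  define T where "T = P k - P k * R"
  have T: "proj d T" unfolding T_def using proj_diff[OF Pk R(1) PR] .
  have TQ: "T * Q b = 0" if "b \<in> A" for b
    using R(2)[OF that] by (simp add: T_def left_diff_distrib mult.assoc)
  have QT: "Q b * T = 0" if "b \<in> A" for b
  proof -
    have "Q b * T = star (T * Q b)" using projD(2)[OF T] projD(2)[OF Q(1)[OF that]] by simp
    then show ?thesis using TQ[OF that] by simp
  qed
  have "norm (P k * Q b) \<le> (1 + C) * \<delta>" if b: "b \<in> A" for b
  proof -
    have "P k * Q b = P k * P b + P k * (Q b - P b)" by (simp add: algebra_simps)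
    also have "norm \<dots> \<le> \<delta> + C * \<delta>"
      using b insert.hyps P(3)[of k b] order_trans[OF norm_mult_le1(1)[OF mult_bound_projD[OF Pk]] Q(2)[OF b]]
      by (intro norm_triangle_mono) auto
    finally show ?thesis by (simp add: algebra_simps)
  qed
  then have "norm (\<Sum>b\<in>A. P k * Q b) \<le> (\<Sum>b\<in>A. (1 + C) * \<delta>)" by (rule sum_norm_le)
  moreover have "T - P k = - (\<Sum>b\<in>A. P k * Q b)" by (simp add: T_def R_def sum_distrib_left)
  ultimately have "norm (T - P k) \<le> card A * ((1 + C) * \<delta>)" by simp
  also have "\<dots> \<le> C' * \<delta>" using C \<delta> by (simp add: C'_eq algebra_simps)
  finally have TP: "norm (T - P k) \<le> C' * \<delta>" .
  have "C * \<delta> \<le> C' * \<delta>" using C \<delta> by (simp add: C'_eq mult_right_mono)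
  then have QP': "norm (Q j - P j) \<le> C' * \<delta>" if "j \<in> A" for j
    using Q(2)[OF that] by simp
  have Qb: "in_bicommutant (insert k A) P (Q a)" if "a \<in> A" for a
    by (rule in_bicommutantI, rule in_bicommutantD[OF Q(3)[OF that]]) simp
  have "in_bicommutant (insert k A) P T"
  proof (rule in_bicommutantI)
    fix B assume B: "\<And>a. a \<in> insert k A \<Longrightarrow> P a * B = B * P a"
    have "Q a * B = B * Q a" if "a \<in> A" for a by (rule in_bicommutantD[OF Qb[OF that] B])
    then have "R * B = B * R" by (simp add: R_def sum_distrib_left sum_distrib_right)
    then have "P k * R * B = B * (P k * R)" using B[of k] by (metis insertI1 mult.assoc)
    then show "T * B = B * T" using B[of k] by (simp add: T_def left_diff_distrib right_diff_distrib)
  qed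
  then show ?case
    unfolding C'_def[symmetric] using Q(1) QQ T TP QP' TQ QT Qb insert.hyps(2)
    by (intro exI[of _ "Q(k := T)"]) auto
qed

text \<open>C1 is the cost of rounding to projections, C2 their failure of orthogonality, C3 the
  cost of making them commute, and C4 the distance to \<phi> after orthogonalisation. The last
  summand pays for completing the sum to the unit.\<close>

definition pvm_const :: "real \<Rightarrow> nat \<Rightarrow> real" where
  "pvm_const K n = (let C1 = 8 + 8 * K; C2 = C1 + K * C1 + 1; C3 = commuting_const n * (4 * C2);
     C4 = orthogonal_const n * (C2 + 2 * C3) + C3 + C1 in C4 + (1 + real n * C4))"

lemma pvm_const_nonneg: "0 \<le> K \<Longrightarrow> 0 \<le> pvm_const K n"
  using commuting_const_nonneg[of n] orthogonal_const_nonneg[of n] by (simp add: pvm_const_def Let_def)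

lemma pvm_round:
  assumes A: "finite A" "a0 \<in> A" and K: "0 \<le> K"
    and \<phi>: "\<And>a. a \<in> A \<Longrightarrow> in_corner d (\<phi> a)" "\<And>a. a \<in> A \<Longrightarrow> mult_bound K (\<phi> a)"
      "\<And>a. a \<in> A \<Longrightarrow> norm (\<phi> a - star (\<phi> a)) \<le> \<delta>" "\<And>a. a \<in> A \<Longrightarrow> norm (\<phi> a * \<phi> a - \<phi> a) \<le> \<delta>"
      "\<And>a b. a \<in> A \<Longrightarrow> b \<in> A \<Longrightarrow> a \<noteq> b \<Longrightarrow> norm (\<phi> a * \<phi> b) \<le> \<delta>"
      "norm ((\<Sum>a\<in>A. \<phi> a) - eye d) \<le> \<delta>"
  shows "\<exists>Q. (\<forall>a\<in>A. proj d (Q a) \<and> norm (Q a - \<phi> a) \<le> pvm_const K (card A) * \<delta>) \<and> (\<Sum>a\<in>A. Q a) = eye d"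
proof -
  define C1 where "C1 = 8 + 8 * K"
  define C2 where "C2 = C1 + K * C1 + 1"
  define C3 where "C3 = commuting_const (card A) * (4 * C2)"
  define C4 where "C4 = orthogonal_const (card A) * (C2 + 2 * C3) + C3 + C1"
  define C5 where "C5 = C4 + (1 + card A * C4)"
  have C5_eq: "pvm_const K (card A) = C5"
    by (simp only: pvm_const_def Let_def C1_def C2_def C3_def C4_def C5_def)
  have pos: "0 \<le> C1" "0 \<le> C2" "0 \<le> C3" "0 \<le> C4"
    using K commuting_const_nonneg[of "card A"] orthogonal_const_nonneg[of "card A"]
    by (simp_all add: C1_def C2_def C3_def C4_def)
  have \<delta>: "0 \<le> \<delta>" using \<phi>(6) norm_ge_zero order_trans by blast
  have "\<forall>a\<in>A. \<exists>P. proj d P \<and> norm (P - \<phi> a) \<le> C1 * \<delta>"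
    using round_proj \<phi>(1-4) unfolding C1_def by blast
  then obtain P where P: "\<And>a. a \<in> A \<Longrightarrow> proj d (P a)" "\<And>a. a \<in> A \<Longrightarrow> norm (P a - \<phi> a) \<le> C1 * \<delta>"
    by metis
  have PP: "norm (P a * P b) \<le> C2 * \<delta>" if ab: "a \<in> A" "b \<in> A" "a \<noteq> b" for a b
  proof -
    have "P a * P b = (P a - \<phi> a) * P b + \<phi> a * (P b - \<phi> b) + \<phi> a * \<phi> b" by (simp add: algebra_simps)
    moreover have "norm ((P a - \<phi> a) * P b) \<le> C1 * \<delta>"
      by (rule order_trans[OF norm_mult_le1(2)[OF mult_bound_projD[OF P(1)[OF ab(2)]]] P(2)[OF ab(1)]])
    moreover have "norm (\<phi> a * (P b - \<phi> b)) \<le> K * (C1 * \<delta>)"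
      by (rule order_trans[OF mult_boundD(1)[OF \<phi>(2)[OF ab(1)]]]) (intro mult_left_mono P ab K)
    moreover have "norm (\<phi> a * \<phi> b) \<le> \<delta>" by (rule \<phi>(5)[OF ab])
    ultimately have "norm (P a * P b) \<le> C1 * \<delta> + K * (C1 * \<delta>) + \<delta>" by (metis norm_triangle_mono)
    then show ?thesis by (simp add: C2_def algebra_simps)
  qed
  \<comment> \<open>Commuting rounding works on observables, so it is applied to reflections. The
    commutator grows by the factor 4 and the distance is halved on the way back.\<close>
  define X where "X = (\<lambda>a. 2 *\<^sub>R P a - eye d)"
  have XX: "norm (X a * X b - X b * X a) \<le> 8 * C2 * \<delta>" if ab: "a \<in> A" "b \<in> A" for a b
  proof (cases "a = b")
    case False
    have "X a * X b - X b * X a = 4 *\<^sub>R (P a * P b - P b * P a)"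
      using P(1)[OF ab(1)] P(1)[OF ab(2)] by (simp add: X_def algebra_simps projD)
    then have "norm (X a * X b - X b * X a) = 4 * norm (P a * P b - P b * P a)" by simp
    also have "\<dots> \<le> 4 * (C2 * \<delta> + C2 * \<delta>)"
      using PP[of a b] PP[of b a] ab False norm_triangle_ineq4[of "P a * P b" "P b * P a"] by fastforce
    finally show ?thesis by simp
  qed (use pos \<delta> in simp)
  have "obs d (X a)" if "a \<in> A" for a unfolding X_def by (rule obs_of_proj[OF P(1)[OF that]])
  from commuting_round[of A d X, OF A(1) this XX] obtain Z where
    Z0: "\<forall>a\<in>A. obs d (Z a) \<and> norm (Z a - X a) \<le> commuting_const (card A) * (8 * C2 * \<delta>)" and ZZ: "commuting_on A Z"
    by blast
  then have Z: "obs d (Z a)" "norm (Z a - X a) \<le> commuting_const (card A) * (8 * C2 * \<delta>)" if "a \<in> A" for a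
    using that by auto
  define P' where "P' = (\<lambda>a. (1/2) *\<^sub>R (Z a + eye d))"
  have P': "proj d (P' a)" if "a \<in> A" for a unfolding P'_def by (rule proj_of_obs[OF Z(1)[OF that]])
  have P'P: "norm (P' a - P a) \<le> C3 * \<delta>" if "a \<in> A" for a
  proof -
    have "P' a - P a = (1/2) *\<^sub>R (Z a - X a)" by (simp add: P'_def X_def algebra_simps)
    then have "norm (P' a - P a) = (1/2) * norm (Z a - X a)" by simp
    then show ?thesis using Z(2)[OF that] by (simp add: C3_def)
  qed
  have P'c: "commuting_on A P'"
  proof (rule commuting_onI)
    fix a b assume ab: "a \<in> A" "b \<in> A"
    show "P' a * P' b = P' b * P' a"
      using commuting_onD[OF ZZ ab] Z(1)[OF ab(1)] Z(1)[OF ab(2)]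
      by (simp add: P'_def distrib_left distrib_right obsD scaleR_add_right add_ac)
  qed
  have P'o: "norm (P' a * P' b) \<le> (C2 + 2 * C3) * \<delta>" if "a \<in> A" "b \<in> A" "a \<noteq> b" for a b
  proof -
    have "norm (P' a * P' b - P a * P b) \<le> C3 * \<delta> + C3 * \<delta>"
      using norm_mult_diff_le[OF mult_bound_projD[OF P(1)] mult_bound_projD[OF P'], of a b "P' a" "P b"]
        P'P[OF that(1)] P'P[OF that(2)] that(1,2) by linarith
    from norm_triangle_mono[OF PP[OF that] this] show ?thesis by (simp add: algebra_simps)
  qed
  have nonneg: "0 \<le> (C2 + 2 * C3) * \<delta>" using pos \<delta> by simp
  have "\<exists>Q. (\<forall>a\<in>A. proj d (Q a) \<and> norm (Q a - P' a) \<le> orthogonal_const (card A) * ((C2 + 2 * C3) * \<delta>) \<and>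
    in_bicommutant A P' (Q a)) \<and> (\<forall>a\<in>A. \<forall>b\<in>A. a \<noteq> b \<longrightarrow> Q a * Q b = 0)"
    by (rule orthogonalize[OF A(1) P' P'c P'o nonneg])
  then obtain Q where
    Q: "\<And>a. a \<in> A \<Longrightarrow> proj d (Q a)" "\<And>a. a \<in> A \<Longrightarrow> norm (Q a - P' a) \<le> orthogonal_const (card A) * ((C2 + 2 * C3) * \<delta>)"
    and QQ: "\<forall>a\<in>A. \<forall>b\<in>A. a \<noteq> b \<longrightarrow> Q a * Q b = 0"
    by (elim exE conjE) (rule that, auto)
  have Q\<phi>: "norm (Q a - \<phi> a) \<le> C4 * \<delta>" if "a \<in> A" for a
    using norm_triangle_mono[OF norm_triangle_mono[OF Q(2)[OF that] P'P[OF that]] P(2)[OF that]]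
    by (simp add: C4_def algebra_simps)
  define R where "R = (\<Sum>a\<in>A. Q a)"
  have R: "proj d R" "Q a0 * R = Q a0" "R * Q a0 = Q a0"
    unfolding R_def using proj_sum[of A d Q] A Q(1) QQ by auto
  have "norm (R - (\<Sum>a\<in>A. \<phi> a)) \<le> card A * (C4 * \<delta>)"
    unfolding R_def sum_subtractf[symmetric] using sum_norm_le[of A "\<lambda>a. Q a - \<phi> a" "\<lambda>_. C4 * \<delta>"] Q\<phi> by simp
  then have Re: "norm (eye d - R) \<le> (1 + card A * C4) * \<delta>"
    using \<phi>(6) norm_triangle_ineq4[of "eye d - (\<Sum>a\<in>A. \<phi> a)" "R - (\<Sum>a\<in>A. \<phi> a)"]
    by (simp add: norm_minus_commute algebra_simps)
  \<comment> \<open>The orthogonal projections may sum to less than the unit. The missing projection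
    \<open>eye d - R\<close> is small because the \<phi> a almost sum to the unit, and the outcome
    \<open>a0\<close> absorbs it.\<close>
  define Q' where "Q' = Q(a0 := Q a0 + (eye d - R))"
  have eR: "proj d (eye d - R)" using proj_diff[of d "eye d" R] R by (simp add: proj_def)
  have "proj d (Q a0 + (eye d - R))"
    using proj_sum(1)[of "{True, False}" d "\<lambda>b. if b then Q a0 else eye d - R"] Q(1)[OF A(2)] eR R
    by (simp add: algebra_simps projD)
  then have Q': "proj d (Q' a)" if "a \<in> A" for a using Q(1) that by (simp add: Q'_def)
  have "norm (Q a0 + (eye d - R) - \<phi> a0) \<le> C5 * \<delta>"
    using norm_triangle_mono[OF Q\<phi>[OF A(2)] Re] by (simp add: C5_def algebra_simps)
  moreover have "C4 * \<delta> \<le> C5 * \<delta>" using pos \<delta> by (simp add: C5_def mult_right_mono)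
  ultimately have Q'\<phi>: "norm (Q' a - \<phi> a) \<le> C5 * \<delta>" if "a \<in> A" for a
    using Q\<phi>[OF that] by (simp add: Q'_def)
  have "(\<Sum>a\<in>A. Q' a) = (\<Sum>a\<in>A. Q a + (if a = a0 then eye d - R else 0))"
    by (intro sum.cong refl) (simp add: Q'_def)
  then have "(\<Sum>a\<in>A. Q' a) = eye d" using A by (simp add: sum.distrib R_def)
  then show ?thesis unfolding C5_eq using Q' Q'\<phi> by blast
qed

section \<open>Synchronous games\<close>

lemma some_enumeration:
  assumes "finite A"
  shows "distinct (SOME xs. distinct xs \<and> set xs = A) \<and> set (SOME xs. distinct xs \<and> set xs = A) = A"
  by (rule someI_ex) (use finite_distinct_list[OF assms] in blast)

lemma norm_le_iff_lfrob_le: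
  assumes "A \<in> carrier_mat d d" "d \<ge> 1"
  shows "lfrob A \<le> r \<longleftrightarrow> norm (fin A) \<le> r * sqrt (real d)"
  using assms by (simp add: lfrob_eq[of _ d] pos_divide_le_eq)

context
  fixes d :: nat and \<phi> :: "'g \<Rightarrow> complex mat"
  assumes \<phi>: "\<And>s. \<phi> s \<in> carrier_mat d d"
begin

lemma fin_seval_Mul: "fin (seval d \<phi> (Mul p q)) = fin (seval d \<phi> p) * fin (seval d \<phi> q)"
  by (simp add: fin_mult[OF seval_carrier[OF \<phi>] seval_carrier[OF \<phi>]])

lemma fin_seval_Add: "fin (seval d \<phi> (Add p q)) = fin (seval d \<phi> p) + fin (seval d \<phi> q)"
  by (simp add: fin_add[OF seval_carrier[OF \<phi>] seval_carrier[OF \<phi>]])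

lemma fin_seval_Star: "fin (seval d \<phi> (Star p)) = star (fin (seval d \<phi> p))"
  by (simp add: fin_cadj[where d = d] seval_carrier \<phi>)

lemma fin_seval_Cst: "fin (seval d \<phi> (Cst (complex_of_real r))) = r *\<^sub>R eye d"
  by (simp add: fin_smult[where d = d])

lemma fin_seval_Cst_neg_one: "fin (seval d \<phi> (Cst (-1))) = - eye d"
  using fin_seval_Cst[of "-1"] by simp

lemma fin_seval_Cst_one: "fin (seval d \<phi> (Cst 1)) = eye d"
  using fin_seval_Cst[of 1] by simp

lemma fin_seval_Sub: "fin (seval d \<phi> (Sub p q)) = fin (seval d \<phi> p) - fin (seval d \<phi> q)"
  unfolding Sub_def fin_seval_Add fin_seval_Mul fin_seval_Cst_neg_one
  by (simp add: seval_carrier \<phi>)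

lemma fin_seval_ssum:
  assumes "finite A"
  shows "fin (seval d \<phi> (ssum f A)) = (\<Sum>x\<in>A. fin (seval d \<phi> (f x)))"
proof -
  define xs where "xs = (SOME xs. distinct xs \<and> set xs = A)"
  have xs: "distinct xs" "set xs = A"
    using some_enumeration[OF assms] by (simp_all only: xs_def)
  have "fin (seval d \<phi> (foldr (\<lambda>x. Add (f x)) xs (Cst 0))) = (\<Sum>x\<leftarrow>xs. fin (seval d \<phi> (f x)))"
  proof (induction xs)
    case Nil
    then show ?case using fin_seval_Cst[of 0] by simp
  qed (simp add: fin_seval_Add del: seval.simps)
  then show ?thesis
    using xs by (simp add: ssum_def xs_def[symmetric] sum_list_distinct_conv_sum_set)
qed

lemmas fin_seval = fin_seval_Mul fin_seval_Add fin_seval_Star fin_seval_Cst_neg_one fin_seval_Cst_one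
  fin_seval_Cst fin_seval_Sub seval.simps(1)

lemma eps_rep_norm:
  assumes "eps_rep lfrob d R \<epsilon> \<phi>" "r \<in> R" "d \<ge> 1"
  shows "norm (fin (seval d \<phi> r)) \<le> \<epsilon> * sqrt (real d)"
  using assms norm_le_iff_lfrob_le[of "seval d \<phi> r" d \<epsilon>]
  by (simp add: eps_rep_def seval_carrier \<phi>)

end

lemma lfrob_of_fin_diff_le:
  assumes "in_corner d X" "A \<in> carrier_mat d d" "d \<ge> 1" "norm (X - fin A) \<le> L * (\<epsilon> * sqrt (real d))"
    "L \<le> D" "0 \<le> \<epsilon>"
  shows "lfrob (of_fin d X - A) \<le> D * \<epsilon>"
proof -
  have "norm (fin (of_fin d X - A)) \<le> L * \<epsilon> * sqrt (real d)"
    using assms(1,2,4) fin_diff[OF of_fin_carrier assms(2), of X] by (simp add: mult.assoc)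
  then have "lfrob (of_fin d X - A) \<le> L * \<epsilon>"
    using norm_le_iff_lfrob_le[OF minus_carrier_mat[OF assms(2)] assms(3)] by blast
  then show ?thesis using mult_right_mono[OF assms(5,6)] by simp
qed

lemma prob_dist_average_ge:
  assumes "prob_dist \<eta>" "\<And>i j. v \<le> w i j"
  shows "v \<le> (\<Sum>i\<in>UNIV. \<Sum>j\<in>UNIV. \<eta> i j * w i j)"
proof -
  have "v = (\<Sum>i\<in>UNIV. \<Sum>j\<in>UNIV. \<eta> i j * v)"
    using assms(1) by (simp add: prob_dist_def flip: sum_distrib_right)
  also have "\<dots> \<le> (\<Sum>i\<in>UNIV. \<Sum>j\<in>UNIV. \<eta> i j * w i j)"
    using assms(1) by (intro sum_mono mult_left_mono assms(2)) (simp add: prob_dist_def)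
  finally show ?thesis .
qed

lemma inner_proj: assumes "proj d P" "proj d Q" shows "inner P Q = (norm (P * Q))\<^sup>2"
proof -
  have "(norm (P * Q))\<^sup>2 = inner Q (P * (P * Q))"
    using assms by (simp add: power2_norm_eq_inner inner_mult_left projD)
  also have "\<dots> = inner (P * Q) Q" using assms by (simp add: proj_mult_mult inner_commute)
  also have "\<dots> = inner P (Q * Q)" using assms by (simp add: inner_mult_right projD)
  finally show ?thesis using assms by (simp add: projD)
qed

lemma is_obs_cconj_of_fin:
  assumes "obs d F" shows "is_obs d (cconj (of_fin d F))"
proof -
  have "obs d (fconj F)"
    using assms unfolding obs_def by (metis corner_fconj fconj_eye fconj_mult fconj_star)
  moreover have "fin (cconj (of_fin d F)) = fconj F"
    using assms by (simp add: fin_cconj[where d = d] obs_def)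
  ultimately show ?thesis
    using is_obs_of_fin[of d "fin (cconj (of_fin d F))"] of_fin_fin[of "cconj (of_fin d F)" d] by simp
qed

lemma foldr_add_fin:
  assumes "\<And>a. f a \<in> carrier_mat d d"
  shows "foldr (+) (map f xs) (0\<^sub>m d d) \<in> carrier_mat d d"
    and "fin (foldr (+) (map f xs) (0\<^sub>m d d)) = (\<Sum>x\<leftarrow>xs. fin (f x))"
proof -
  show *: "foldr (+) (map f xs) (0\<^sub>m d d) \<in> carrier_mat d d" for xs
    by (induction xs) (simp_all add: assms)
  show "fin (foldr (+) (map f xs) (0\<^sub>m d d)) = (\<Sum>x\<leftarrow>xs. fin (f x))"
    by (induction xs) (simp_all add: fin_add[OF assms *])
qed

lemma sync_strategyI:
  fixes Q :: "'i::finite \<Rightarrow> 'a::finite \<Rightarrow> finmat"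
  assumes "\<And>i a. proj d (Q i a)" "\<And>i. (\<Sum>a\<in>UNIV. Q i a) = eye d"
  shows "sync_strategy d (\<lambda>(i, a). of_fin d (Q i a))"
  unfolding sync_strategy_def
proof (intro conjI allI)
  fix ia :: "'i \<times> 'a"
  show "is_proj d (case ia of (i, a) \<Rightarrow> of_fin d (Q i a))"
    using assms(1) is_proj_of_fin by (cases ia) auto
next
  fix i :: 'i
  define xs where "xs = (SOME xs. distinct xs \<and> set xs = (UNIV :: 'a set))"
  have xs: "distinct xs" "set xs = UNIV"
    using some_enumeration[OF finite[of "UNIV :: 'a set"]] by (simp_all only: xs_def)
  let ?S = "foldr (+) (map (\<lambda>a. of_fin d (Q i a)) xs) (0\<^sub>m d d)"
  have "fin ?S = (\<Sum>a\<leftarrow>xs. fin (of_fin d (Q i a)))" by (rule foldr_add_fin) simp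
  also have "\<dots> = (\<Sum>a\<in>UNIV. Q i a)"
    using xs assms(1) by (simp add: sum_list_distinct_conv_sum_set projD)
  finally have "fin ?S = fin (1\<^sub>m d)" using assms(2) by simp
  moreover have "?S \<in> carrier_mat d d" by (rule foldr_add_fin) simp
  ultimately have "?S = 1\<^sub>m d" by (subst (asm) fin_inject[where d = d]) auto
  then show "foldr (+) (map (\<lambda>a. case (i, a) of (i, a) \<Rightarrow> of_fin d (Q i a))
      (SOME xs. distinct xs \<and> set xs = UNIV)) (0\<^sub>m d d) = 1\<^sub>m d"
    by (simp add: xs_def)
qed

text \<open>An answer pair has probability tr(PQ)/d = |PQ|^2/d by \<open>inner_proj\<close>, so a
  losing pair costs at most M^2, and each question pair has CARD('a)^2 answer pairs.\<close>

lemma sync_winprob_ge: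
  fixes Q :: "'i::finite \<Rightarrow> 'a::finite \<Rightarrow> finmat"
  assumes "prob_dist \<eta>" "d \<ge> 1" "\<And>i a. proj d (Q i a)" "\<And>i. (\<Sum>a\<in>UNIV. Q i a) = eye d"
    and lose: "\<And>i j a b. \<not> V a b i j \<Longrightarrow> norm (Q i a * Q j b) \<le> M * sqrt (real d)" and M: "0 \<le> M"
  shows "sync_winprob \<eta> V (\<lambda>(i, a). of_fin d (Q i a)) (max_ent d) \<ge> 1 - (real CARD('a) * M)\<^sup>2"
proof -
  define p where "p = (\<lambda>i j a b. inner (Q i a) (Q j b) / real d)"
  define L where "L = (real CARD('a) * M)\<^sup>2"
  have sum1: "(\<Sum>a\<in>UNIV. \<Sum>b\<in>UNIV. p i j a b) = 1" for i j
  proof -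
    have "(\<Sum>a\<in>UNIV. \<Sum>b\<in>UNIV. p i j a b) = inner (\<Sum>a\<in>UNIV. Q i a) (\<Sum>b\<in>UNIV. Q j b) / real d"
      by (simp only: p_def inner_sum_left sum_divide_distrib) (simp only: inner_sum_right sum_divide_distrib)
    then show ?thesis
      using assms(2) by (simp add: assms(4) norm_eye flip: power2_norm_eq_inner)
  qed
  have "p i j a b \<le> M\<^sup>2" if "\<not> V a b i j" for i j a b
  proof -
    have "(norm (Q i a * Q j b))\<^sup>2 \<le> (M * sqrt (real d))\<^sup>2" by (intro power_mono lose that) simp
    then show ?thesis
      using assms(2) inner_proj[OF assms(3,3), of i a j b] by (simp add: p_def pos_divide_le_eq power_mult_distrib)
  qed
  \<comment> \<open>M^2 is subtracted for winning pairs as well, so that the left-hand side sums to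
    exactly 1 - L.\<close>
  then have "p i j a b - M\<^sup>2 \<le> of_bool (V a b i j) * p i j a b" for i j a b
    by (cases "V a b i j") (auto simp: M)
  then have "(\<Sum>a\<in>UNIV. \<Sum>b\<in>UNIV. p i j a b - M\<^sup>2) \<le> (\<Sum>a\<in>UNIV. \<Sum>b\<in>UNIV. of_bool (V a b i j) * p i j a b)" for i j
    by (intro sum_mono)
  moreover have "(\<Sum>a\<in>UNIV. \<Sum>b\<in>UNIV. p i j a b - M\<^sup>2) = 1 - L" for i j
    by (simp add: sum_subtractf sum1 L_def power2_eq_square mult_ac)
  ultimately have win: "1 - L \<le> (\<Sum>a\<in>UNIV. \<Sum>b\<in>UNIV. of_bool (V a b i j) * p i j a b)" for i j by simp
  have "1 - L \<le> (\<Sum>i\<in>UNIV. \<Sum>j\<in>UNIV. \<eta> i j * (\<Sum>a\<in>UNIV. \<Sum>b\<in>UNIV. of_bool (V a b i j) * p i j a b))"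
    by (rule prob_dist_average_ge[OF assms(1) win])
  also have "\<dots> = sync_winprob \<eta> V (\<lambda>(i, a). of_fin d (Q i a)) (max_ent d)"
    using assms(3) by (simp add: sync_winprob_def p_def Re_expect_max_ent[of _ d] projD)
  finally show ?thesis by (simp add: L_def)
qed

lemma sync_relsI:
  "Sub (Mul (Gen (i, a)) (Gen (i, a))) (Gen (i, a)) \<in> sync_rels V"
  "Sub (Gen (i, a)) (Star (Gen (i, a))) \<in> sync_rels V"
  "Sub (ssum (\<lambda>a. Gen (i, a)) UNIV) (Cst 1) \<in> sync_rels V"
  "\<not> V a b i j \<Longrightarrow> Mul (Gen (i, a)) (Gen (j, b)) \<in> sync_rels V"
  unfolding sync_rels_def by blast+

text \<open>Synchronicity puts p^i_a p^i_b with distinct answers among the relations, so each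
  question can be rounded on its own by \<open>pvm_round\<close>. Relations between different
  questions then bound the losing products.\<close>

theorem synchronous_stability:
  fixes \<eta> :: "'i::finite \<Rightarrow> 'i \<Rightarrow> real" and V :: "'a::finite \<Rightarrow> 'a \<Rightarrow> 'i \<Rightarrow> 'i \<Rightarrow> bool"
  assumes K: "K > 0" and game: "sync_game \<eta> V"
  shows "\<exists>C>0. \<exists>\<epsilon>0>0. \<forall>\<epsilon> (d::nat) (\<phi> :: 'i \<times> 'a \<Rightarrow> complex mat).
         0 \<le> \<epsilon> \<and> \<epsilon> \<le> \<epsilon>0 \<and> d \<ge> 1 \<and> eps_rep lfrob d (sync_rels V) \<epsilon> \<phi> \<and>
         (\<forall>ia. op_norm (\<phi> ia) \<le> K) \<longrightarrow>
         (\<exists>Q. sync_strategy d Q \<and> (\<forall>ia. lfrob (Q ia - \<phi> ia) \<le> C * \<epsilon>) \<and>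
              sync_winprob \<eta> V Q (max_ent d) \<ge> 1 - C * \<epsilon>\<^sup>2)"
proof -
  define C where "C = pvm_const K CARD('a)"
  have C: "0 \<le> C" using K by (simp add: C_def pvm_const_nonneg)
  \<comment> \<open>Comparing a losing product \<open>Q i a * Q j b\<close> with
    \<open>F i a * F j b\<close>: replacing the first factor costs C, the second K * C, and the
    relation itself contributes 1.\<close>
  define M where "M = C + K * C + 1"
  define D where "D = C + (real CARD('a) * M)\<^sup>2 + 1"
  have D: "D > 0" "C \<le> D" "(real CARD('a) * M)\<^sup>2 \<le> D"
    using C by (simp_all add: D_def add_nonneg_pos)
  have M: "0 \<le> M" using C K by (simp add: M_def)
  show ?thesis
  proof (rule exI[of _ D], intro conjI D, rule exI[of _ 1], intro conjI allI impI)
    fix \<epsilon> :: real and d :: nat and \<phi> :: "'i \<times> 'a \<Rightarrow> complex mat"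
    assume "0 \<le> \<epsilon> \<and> \<epsilon> \<le> 1 \<and> d \<ge> 1 \<and> eps_rep lfrob d (sync_rels V) \<epsilon> \<phi> \<and> (\<forall>ia. op_norm (\<phi> ia) \<le> K)"
    then have \<epsilon>: "0 \<le> \<epsilon>" and d: "d \<ge> 1" and rep: "eps_rep lfrob d (sync_rels V) \<epsilon> \<phi>"
      and op: "\<And>ia. op_norm (\<phi> ia) \<le> K" by auto
    have \<phi>: "\<And>s. \<phi> s \<in> carrier_mat d d" using rep unfolding eps_rep_def by blast
    define \<delta> where "\<delta> = \<epsilon> * sqrt (real d)"
    define F where "F = (\<lambda>i a. fin (\<phi> (i, a)))"
    note rel = eps_rep_norm[OF \<phi> rep _ d, folded \<delta>_def]
    have F: "in_corner d (F i a)" "mult_bound K (F i a)" for i a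
      using \<phi> K op by (auto simp: F_def intro!: mult_bound_op_norm)
    note fs = F_def fin_seval[OF \<phi>] fin_seval_ssum[OF \<phi>]
    have F1: "norm (F i a * F i a - F i a) \<le> \<delta>" for i a
      using rel[OF sync_relsI(1)] by (simp add: fs del: seval.simps(2-))
    have F2: "norm (F i a - star (F i a)) \<le> \<delta>" for i a
      using rel[OF sync_relsI(2)] by (simp add: fs del: seval.simps(2-))
    have F3: "norm ((\<Sum>a\<in>UNIV. F i a) - eye d) \<le> \<delta>" for i
      using rel[OF sync_relsI(3)] by (simp add: fs del: seval.simps(2-))
    have F4: "norm (F i a * F j b) \<le> \<delta>" if "\<not> V a b i j" for i j a b
      using rel[OF sync_relsI(4)[of V a b i j]] that by (simp add: fs del: seval.simps(2-))
    \<comment> \<open>\<open>undefined\<close> merely selects some answer to absorb the defect of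
      the sum.\<close>
    have "\<exists>Q. (\<forall>a\<in>UNIV. proj d (Q a) \<and> norm (Q a - F i a) \<le> C * \<delta>) \<and> (\<Sum>a\<in>UNIV. Q a) = eye d" for i
      unfolding C_def using game K
      by (intro pvm_round[of UNIV undefined]) (auto simp: F F1 F2 F3 F4 sync_game_def)
    then obtain Q where Q: "\<And>i a. proj d (Q i a)" "\<And>i a. norm (Q i a - F i a) \<le> C * \<delta>"
      "\<And>i. (\<Sum>a\<in>UNIV. Q i a) = eye d"
      by (metis UNIV_I)
    define Qm where "Qm = (\<lambda>(i, a). of_fin d (Q i a))"
    have QQ: "norm (Q i a * Q j b) \<le> M * \<epsilon> * sqrt (real d)" if "\<not> V a b i j" for i j a b
    proof -
      have "Q i a * Q j b = (Q i a - F i a) * Q j b + F i a * (Q j b - F j b) + F i a * F j b"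
        by (simp add: algebra_simps)
      moreover have "norm ((Q i a - F i a) * Q j b) \<le> C * \<delta>"
        using norm_mult_le1(2)[OF mult_bound_projD[OF Q(1)]] Q(2) order_trans by blast
      moreover have "norm (F i a * (Q j b - F j b)) \<le> K * (C * \<delta>)"
        using K by (intro order_trans[OF mult_boundD(1)[OF F(2)]] mult_left_mono Q) simp
      ultimately have "norm (Q i a * Q j b) \<le> C * \<delta> + K * (C * \<delta>) + \<delta>"
        using F4[OF that] by (metis norm_triangle_mono)
      then show ?thesis by (simp add: M_def \<delta>_def algebra_simps)
    qed
    have "lfrob (Qm ia - \<phi> ia) \<le> D * \<epsilon>" for ia
      using lfrob_of_fin_diff_le[OF projD(1)[OF Q(1)] \<phi> d Q(2)[unfolded F_def \<delta>_def] D(2) \<epsilon>]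
      by (cases ia) (simp add: Qm_def)
    moreover have "sync_winprob \<eta> V Qm (max_ent d) \<ge> 1 - (real CARD('a) * (M * \<epsilon>))\<^sup>2"
      unfolding Qm_def using game M \<epsilon> by (intro sync_winprob_ge d Q QQ) (auto simp: sync_game_def)
    moreover have "(real CARD('a) * (M * \<epsilon>))\<^sup>2 \<le> D * \<epsilon>\<^sup>2"
      using mult_right_mono[OF D(3), of "\<epsilon>\<^sup>2"] by (simp add: power_mult_distrib mult_ac)
    ultimately show "\<exists>Q. sync_strategy d Q \<and> (\<forall>ia. lfrob (Q ia - \<phi> ia) \<le> D * \<epsilon>) \<and>
              sync_winprob \<eta> V Q (max_ent d) \<ge> 1 - D * \<epsilon>\<^sup>2"
      using sync_strategyI[of d Q, OF Q(1,3)] unfolding Qm_def[symmetric] by (intro exI[of _ Qm]) auto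
  qed simp
qed

section \<open>Joint spectral projections and multilinear polynomials\<close>

text \<open>Assignments are 1 outside their scope, so those on the smaller scope are the ones with
  value 1 at \<open>k\<close>, and flipping \<open>k\<close> gives the others.\<close>

lemma cube_insert:
  assumes "k \<notin> J"
  shows "cube (insert k J) = cube J \<union> (\<lambda>x. x(k := -1)) ` cube J"
proof (intro equalityI subsetI)
  fix x :: "'a \<Rightarrow> real" assume x: "x \<in> cube (insert k J)"
  have "x k = 1 \<or> x k = -1" using x by (simp add: cube_def)
  then show "x \<in> cube J \<union> (\<lambda>x. x(k := -1)) ` cube J"
  proof
    assume "x k = 1"
    then have "x \<in> cube J" using x by (auto simp: cube_def)
    then show ?thesis by simp
  next
    assume "x k = -1"
    then have "x = (x(k := 1))(k := -1)" by auto
    moreover have "x(k := 1) \<in> cube J" using x by (auto simp: cube_def)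
    ultimately show ?thesis by blast
  qed
next
  fix x :: "'a \<Rightarrow> real" assume "x \<in> cube J \<union> (\<lambda>x. x(k := -1)) ` cube J"
  then consider "x \<in> cube J" | y where "y \<in> cube J" "x = y(k := -1)" by blast
  then show "x \<in> cube (insert k J)"
  proof cases
    case 2
    then show ?thesis unfolding cube_def mem_Collect_eq fun_upd_apply by (metis insert_iff)
  qed (auto simp: cube_def)
qed

lemma cube_outside: "x \<in> cube J \<Longrightarrow> k \<notin> J \<Longrightarrow> x k = 1"
  by (simp add: cube_def)

lemma cube_values: "x \<in> cube J \<Longrightarrow> x k = 1 \<or> x k = -1"
  by (auto simp: cube_def)

lemma cube_square: "x \<in> cube J \<Longrightarrow> x k * x k = 1"
  using cube_values[of x J k] by auto

lemma cube_flip_inj: "k \<notin> J \<Longrightarrow> inj_on (\<lambda>x. x(k := -1)) (cube J)"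
  by (rule inj_onI) (metis cube_outside fun_upd_triv fun_upd_upd)

lemma cube_flip_disjoint: "k \<notin> J \<Longrightarrow> cube J \<inter> (\<lambda>x. x(k := -1)) ` cube J = {}"
  by (auto dest: cube_outside)

lemma cube_empty: "cube {} = {\<lambda>_. 1}"
  by (auto simp: cube_def)

lemma finite_cube: "finite J \<Longrightarrow> finite (cube J)"
  by (induction J rule: finite_induct) (simp_all add: cube_insert cube_empty)

lemma sum_cube_insert:
  fixes f :: "('a \<Rightarrow> real) \<Rightarrow> 'b::comm_monoid_add"
  assumes "finite J" "k \<notin> J"
  shows "(\<Sum>x\<in>cube (insert k J). f x) = (\<Sum>x\<in>cube J. f x) + (\<Sum>x\<in>cube J. f (x(k := -1)))"
  unfolding cube_insert[OF assms(2)]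
  by (subst sum.union_disjoint)
    (simp_all add: assms finite_cube cube_flip_disjoint sum.reindex cube_flip_inj)

lemma sum_Pow_insert:
  fixes f :: "'a set \<Rightarrow> 'b::comm_monoid_add"
  assumes "finite J" "k \<notin> J"
  shows "(\<Sum>\<alpha>\<in>Pow (insert k J). f \<alpha>) = (\<Sum>\<alpha>\<in>Pow J. f \<alpha>) + (\<Sum>\<alpha>\<in>Pow J. f (insert k \<alpha>))"
proof -
  have "inj_on (insert k) (Pow J)" using assms(2) by (auto simp: inj_on_def)
  moreover have "Pow J \<inter> insert k ` Pow J = {}" using assms(2) by auto
  ultimately show ?thesis
    unfolding Pow_insert by (subst sum.union_disjoint) (simp_all add: assms sum.reindex)
qed

section \<open>Multilinear polynomials on the cube\<close>

definition mlin :: "('a set \<Rightarrow> real) \<Rightarrow> 'a set \<Rightarrow> ('a \<Rightarrow> real) \<Rightarrow> real" where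
  "mlin f J x = (\<Sum>\<alpha>\<in>Pow J. f \<alpha> * (\<Prod>j\<in>\<alpha>. x j))"

lemma mlin_insert:
  assumes J: "finite J" "k \<notin> J"
  shows "mlin f (insert k J) x = mlin f J x + x k * mlin (\<lambda>\<alpha>. f (insert k \<alpha>)) J x"
proof -
  have "(\<Prod>j\<in>insert k \<alpha>. x j) = x k * (\<Prod>j\<in>\<alpha>. x j)" if "\<alpha> \<in> Pow J" for \<alpha>
    using that J finite_subset[of \<alpha> J] by (subst prod.insert) auto
  then show ?thesis
    by (simp add: mlin_def sum_Pow_insert[OF J] sum_distrib_left mult_ac)
qed

lemma mlin_cong_outside: "k \<notin> J \<Longrightarrow> mlin f J (x(k := c)) = mlin f J x"
  unfolding mlin_def by (intro sum.cong refl arg_cong2[where f = "(*)"] prod.cong) auto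

text \<open>Write the polynomial as f0 + x_k f1. Its values at x_k = 1 and x_k = -1 vanish, hence so
  do f0 and f1 on the smaller cube.\<close>

lemma mlin_zero:
  assumes "finite J" "\<And>x. x \<in> cube J \<Longrightarrow> mlin f J x = 0" "\<alpha> \<subseteq> J"
  shows "f \<alpha> = 0"
  using assms
proof (induction J arbitrary: f \<alpha>)
  case empty
  then show ?case by (simp add: mlin_def cube_empty)
next
  case (insert k J)
  have "mlin f J x = 0 \<and> mlin (\<lambda>\<alpha>. f (insert k \<alpha>)) J x = 0" if x: "x \<in> cube J" for x
  proof -
    have "mlin f (insert k J) x = 0" "mlin f (insert k J) (x(k := -1)) = 0"
      using insert.prems(1) x by (auto simp: cube_insert[OF insert.hyps(2)])
    then show ?thesis
      using insert.hyps cube_outside[OF x] by (simp add: mlin_insert mlin_cong_outside)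
  qed
  then have IH: "\<beta> \<subseteq> J \<Longrightarrow> f \<beta> = 0" "\<beta> \<subseteq> J \<Longrightarrow> f (insert k \<beta>) = 0" for \<beta>
    using insert.IH[of f \<beta>] insert.IH[of "\<lambda>\<alpha>. f (insert k \<alpha>)" \<beta>] by auto
  show ?case
  proof (cases "k \<in> \<alpha>")
    case True
    then have "\<alpha> = insert k (\<alpha> - {k})" "\<alpha> - {k} \<subseteq> J" using insert.prems(2) by auto
    then show ?thesis using IH(2)[of "\<alpha> - {k}"] by metis
  qed (use IH insert.prems(2) in auto)
qed

text \<open>The induction interpolates the even and the odd part of \<open>F\<close> in the variable
  k and combines them.\<close>

lemma mlin_exists:
  assumes "finite J"
  shows "\<exists>f. (\<forall>\<alpha>. \<not> \<alpha> \<subseteq> J \<longrightarrow> f \<alpha> = 0) \<and> (\<forall>x\<in>cube J. mlin f J x = F x)"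
  using assms
proof (induction J arbitrary: F)
  case empty
  show ?case
    by (rule exI[of _ "\<lambda>\<alpha>. if \<alpha> = {} then F (\<lambda>_. 1) else 0"]) (simp add: mlin_def cube_empty)
next
  case (insert k J)
  obtain f where f: "\<forall>\<alpha>. \<not> \<alpha> \<subseteq> J \<longrightarrow> f \<alpha> = 0"
    "\<forall>x\<in>cube J. mlin f J x = (F x + F (x(k := -1))) / 2"
    using insert.IH[of "\<lambda>x. (F x + F (x(k := -1))) / 2"] by blast
  obtain g where g: "\<forall>\<alpha>. \<not> \<alpha> \<subseteq> J \<longrightarrow> g \<alpha> = 0"
    "\<forall>x\<in>cube J. mlin g J x = (F x - F (x(k := -1))) / 2"
    using insert.IH[of "\<lambda>x. (F x - F (x(k := -1))) / 2"] by blast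
  define h where "h = (\<lambda>\<alpha>. if k \<in> \<alpha> then g (\<alpha> - {k}) else f \<alpha>)"
  have *: "mlin h J x = mlin f J x" "mlin (\<lambda>\<alpha>. h (insert k \<alpha>)) J x = mlin g J x" for x
  proof -
    have "k \<notin> \<alpha>" if "\<alpha> \<in> Pow J" for \<alpha> using that insert.hyps(2) by auto
    then show "mlin h J x = mlin f J x" "mlin (\<lambda>\<alpha>. h (insert k \<alpha>)) J x = mlin g J x"
      unfolding mlin_def by (auto intro!: sum.cong simp: h_def)
  qed
  then have "mlin h (insert k J) x = F x" if x: "x \<in> cube (insert k J)" for x
  proof -
    consider "x \<in> cube J" | y where "y \<in> cube J" "x = y(k := -1)"
      using x unfolding cube_insert[OF insert.hyps(2)] by blast
    then show ?thesis
    proof cases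
      case 1
      have "mlin h (insert k J) x = mlin f J x + mlin g J x"
        using insert.hyps by (simp add: mlin_insert * cube_outside[OF 1])
      then show ?thesis using f(2) g(2) 1 by (simp add: field_simps)
    next
      case 2
      have "mlin h (insert k J) x = mlin f J y - mlin g J y"
        using insert.hyps by (simp add: mlin_insert * 2(2) mlin_cong_outside)
      moreover have "\<dots> = (F y + F x) / 2 - (F y - F x) / 2"
        unfolding 2(2) using bspec[OF f(2) 2(1)] bspec[OF g(2) 2(1)] by argo
      ultimately show ?thesis by (simp add: field_simps)
    qed
  qed
  moreover have "h \<alpha> = 0" if "\<not> \<alpha> \<subseteq> insert k J" for \<alpha>
    unfolding h_def using that f(1)[rule_format, of \<alpha>] g(1)[rule_format, of "\<alpha> - {k}"] by auto
  ultimately show ?case by blast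
qed

text \<open>Interpolation and uniqueness on the cube justify the definite description defining
  \<open>bcs_coef\<close>.\<close>

lemma bcs_coef_spec:
  fixes K :: "'c \<Rightarrow> 'v::finite set"
  shows "x \<in> cube (K i) \<Longrightarrow> mlin (bcs_coef K Sat i) (K i) x = (if x \<in> Sat i then -1 else 1)"
proof -
  define F where "F = (\<lambda>x. if x \<in> Sat i then -1 else (1::real))"
  have "\<exists>!f. (\<forall>\<alpha>. \<not> \<alpha> \<subseteq> K i \<longrightarrow> f \<alpha> = 0) \<and> (\<forall>x\<in>cube (K i). mlin f (K i) x = F x)"
  proof (rule ex_ex1I)
    show "\<exists>f. (\<forall>\<alpha>. \<not> \<alpha> \<subseteq> K i \<longrightarrow> f \<alpha> = 0) \<and> (\<forall>x\<in>cube (K i). mlin f (K i) x = F x)"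
      by (rule mlin_exists) simp
    fix f g
    assume f: "(\<forall>\<alpha>. \<not> \<alpha> \<subseteq> K i \<longrightarrow> f \<alpha> = 0) \<and> (\<forall>x\<in>cube (K i). mlin f (K i) x = F x)"
      and g: "(\<forall>\<alpha>. \<not> \<alpha> \<subseteq> K i \<longrightarrow> g \<alpha> = 0) \<and> (\<forall>x\<in>cube (K i). mlin g (K i) x = F x)"
    have "mlin (\<lambda>\<alpha>. f \<alpha> - g \<alpha>) (K i) x = mlin f (K i) x - mlin g (K i) x" for x
      by (simp add: mlin_def left_diff_distrib sum_subtractf)
    then have "f \<alpha> - g \<alpha> = 0" if "\<alpha> \<subseteq> K i" for \<alpha>
      using mlin_zero[of "K i" "\<lambda>\<alpha>. f \<alpha> - g \<alpha>" \<alpha>] f g that by simp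
    then show "f = g" using f g by (intro ext) (metis eq_iff_diff_eq_0)
  qed
  from theI'[OF this] show "x \<in> cube (K i) \<Longrightarrow> ?thesis"
    unfolding bcs_coef_def mlin_def F_def by blast
qed

section \<open>Joint spectral projections of commuting observables\<close>

lemma proj_mult:
  assumes "proj d P" "proj d R" "P * R = R * P"
  shows "proj d (P * R)"
proof -
  have "P * R * (P * R) = P * (R * P) * R" by (simp only: mult.assoc)
  also have "\<dots> = (P * P) * (R * R)" by (simp only: assms(3)[symmetric] mult.assoc)
  finally have "P * R * (P * R) = P * R" using assms by (simp only: projD)
  moreover have "star (P * R) = P * R" by (simp only: star_mult projD(2)[OF assms(1)] projD(2)[OF assms(2)] assms(3))
  ultimately show ?thesis using assms unfolding proj_def by (simp only: corner_mult simp_thms)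
qed

text \<open>All sign patterns on \<open>J\<close> index the family, so some of the projections may
  be zero.\<close>

definition joint_spectral :: "nat \<Rightarrow> 'v set \<Rightarrow> ('v \<Rightarrow> finmat) \<Rightarrow> (('v \<Rightarrow> real) \<Rightarrow> finmat) \<Rightarrow> bool" where
  "joint_spectral d J Z p \<longleftrightarrow>
    (\<forall>x\<in>cube J. proj d (p x)) \<and> (\<forall>x\<in>cube J. \<forall>y\<in>cube J. x \<noteq> y \<longrightarrow> p x * p y = 0) \<and>
    (\<Sum>x\<in>cube J. p x) = eye d \<and> (\<forall>j\<in>J. \<forall>x\<in>cube J. Z j * p x = x j *\<^sub>R p x)"

lemma joint_spectralD:
  assumes "joint_spectral d J Z p"
  shows "x \<in> cube J \<Longrightarrow> proj d (p x)" "x \<in> cube J \<Longrightarrow> y \<in> cube J \<Longrightarrow> x \<noteq> y \<Longrightarrow> p x * p y = 0"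
    "(\<Sum>x\<in>cube J. p x) = eye d" "j \<in> J \<Longrightarrow> x \<in> cube J \<Longrightarrow> Z j * p x = x j *\<^sub>R p x"
proof -
  note h = assms[unfolded joint_spectral_def]
  show "x \<in> cube J \<Longrightarrow> proj d (p x)" by (rule bspec[OF h[THEN conjunct1]])
  show "x \<in> cube J \<Longrightarrow> y \<in> cube J \<Longrightarrow> x \<noteq> y \<Longrightarrow> p x * p y = 0"
    by (rule bspec[OF bspec[OF h[THEN conjunct2, THEN conjunct1]], THEN mp])
  show "(\<Sum>x\<in>cube J. p x) = eye d" by (rule h[THEN conjunct2, THEN conjunct2, THEN conjunct1])
  show "j \<in> J \<Longrightarrow> x \<in> cube J \<Longrightarrow> Z j * p x = x j *\<^sub>R p x"
    by (rule bspec[OF bspec[OF h[THEN conjunct2, THEN conjunct2, THEN conjunct2]]])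
qed

text \<open>Each projection is multiplied by a spectral projection (1 + s Z k)/2 of the next
  observable. The bicommutant clause makes the two commute, so the product is again a
  projection.\<close>

lemma joint_spectral_exists:
  assumes "finite J" "\<And>j. j \<in> J \<Longrightarrow> obs d (Z j)" "commuting_on J Z"
  shows "\<exists>p. joint_spectral d J Z p \<and>
    (\<forall>B. in_corner d B \<longrightarrow> (\<forall>j\<in>J. Z j * B = B * Z j) \<longrightarrow> (\<forall>x\<in>cube J. p x * B = B * p x))"
  using assms
proof (induction J)
  case empty
  have "proj d (eye d)" by (simp add: proj_def)
  then show ?case by (intro exI[of _ "\<lambda>_. eye d"]) (simp add: cube_empty joint_spectral_def)
next
  case (insert k J)
  have "\<exists>p. joint_spectral d J Z p \<and>
      (\<forall>B. in_corner d B \<longrightarrow> (\<forall>j\<in>J. Z j * B = B * Z j) \<longrightarrow> (\<forall>x\<in>cube J. p x * B = B * p x))"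
    by (rule insert.IH, rule insert.prems, simp)
      (rule commuting_onI, rule commuting_onD[OF insert.prems(2)], simp_all)
  then obtain p where h: "joint_spectral d J Z p \<and>
      (\<forall>B. in_corner d B \<longrightarrow> (\<forall>j\<in>J. Z j * B = B * Z j) \<longrightarrow> (\<forall>x\<in>cube J. p x * B = B * p x))"
    by (elim exE)
  note pp = joint_spectralD[OF h[THEN conjunct1]]
  note bic = bspec[OF mp[OF mp[OF spec[OF h[THEN conjunct2]]]]]
  have Zk: "obs d (Z k)" "in_corner d (Z k)" "Z k * Z k = eye d" "star (Z k) = Z k"
    using insert.prems(1)[of k] by (auto dest: obsD)
  define E where "E = (\<lambda>s. (1/2) *\<^sub>R (eye d + s *\<^sub>R Z k))"
  have E: "proj d (E s)" "Z k * E s = s *\<^sub>R E s" if "s = 1 \<or> s = -1" for s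
    using that Zk by (auto simp: E_def proj_def algebra_simps) (simp_all flip: scaleR_add_left)
  have EE: "E 1 * E (-1) = 0" "E (-1) * E 1 = 0" "E 1 + E (-1) = eye d"
    using Zk by (simp_all add: E_def algebra_simps) (simp flip: scaleR_add_left)
  have pE: "p x * E s = E s * p x" if "x \<in> cube J" for x s
  proof -
    have "p x * Z k = Z k * p x" by (rule bic[OF Zk(2) _ that], rule ballI, rule commuting_onD[OF insert.prems(2)]) simp_all
    moreover have "p x * eye d = eye d * p x" using pp(1)[OF that] by (simp add: projD)
    ultimately show ?thesis by (simp add: E_def distrib_left distrib_right)
  qed
  \<comment> \<open>\<open>x(k := 1)\<close> is the restriction of \<open>x\<close> to
    \<open>J\<close> in the encoding by \<open>cube\<close>.\<close>
  define p' where "p' = (\<lambda>x. p (x(k := 1)) * E (x k))"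
  have restr: "x(k := 1) \<in> cube J" if "x \<in> cube (insert k J)" for x
    using that by (auto simp: cube_def)
  have vals: "x k = 1 \<or> x k = -1" if "x \<in> cube (insert k J)" for x
    using that by (rule cube_values)
  have "joint_spectral d (insert k J) Z p'"
    unfolding joint_spectral_def
  proof (intro conjI ballI impI)
    fix x assume x: "x \<in> cube (insert k J)"
    show "proj d (p' x)" unfolding p'_def
      by (intro proj_mult pp E pE restr vals x)
    fix y assume y: "y \<in> cube (insert k J)" "x \<noteq> y"
    have *: "p' x * p' y = p (x(k := 1)) * p (y(k := 1)) * (E (x k) * E (y k))"
      unfolding p'_def using pE[OF restr[OF y(1)], of "x k"] by (metis mult.assoc)
    show "p' x * p' y = 0"
    proof (cases "x(k := 1) = y(k := 1)")
      case True
      then have "x k \<noteq> y k" using y(2) by (metis fun_upd_triv fun_upd_upd)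
      then have "E (x k) * E (y k) = 0" using vals[OF x] vals[OF y(1)] EE by auto
      then show ?thesis by (simp add: *)
    next
      case False
      then show ?thesis by (simp add: * pp(2)[OF restr[OF x] restr[OF y(1)]])
    qed
  next
    have eq: "x(k := 1) = x" "x k = 1" if "x \<in> cube J" for x :: "'a \<Rightarrow> real"
      using cube_outside[OF that insert.hyps(2)] by auto
    have "(\<Sum>x\<in>cube (insert k J). p' x) = (\<Sum>x\<in>cube J. p x * E 1) + (\<Sum>x\<in>cube J. p x * E (-1))"
      unfolding sum_cube_insert[OF insert.hyps]
      by (intro arg_cong2[where f = "(+)"] sum.cong refl) (simp_all only: p'_def eq fun_upd_same fun_upd_upd)
    also have "\<dots> = eye d"
      unfolding sum_distrib_right[symmetric] pp(3) using EE E projD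
      by (simp flip: distrib_left)
    finally show "(\<Sum>x\<in>cube (insert k J). p' x) = eye d" .
  next
    fix j x assume j: "j \<in> insert k J" and x: "x \<in> cube (insert k J)"
    show "Z j * p' x = x j *\<^sub>R p' x"
    proof (cases "j = k")
      case True
      have "Z k * p' x = Z k * E (x k) * p (x(k := 1))"
        by (simp add: p'_def pE[OF restr[OF x]] mult.assoc)
      also have "\<dots> = x k *\<^sub>R p' x" using E(2)[OF vals[OF x]] by (simp add: p'_def pE[OF restr[OF x]])
      finally show ?thesis using True by simp
    next
      case False
      then have "Z j * p' x = (x j *\<^sub>R p (x(k := 1))) * E (x k)"
        using j pp(4)[of j, OF _ restr[OF x]] by (simp add: p'_def mult.assoc[symmetric])
      then show ?thesis by (simp add: p'_def)
    qed
  qed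
  moreover have "p' x * B = B * p' x"
    if B: "in_corner d B" "\<forall>j\<in>insert k J. Z j * B = B * Z j" "x \<in> cube (insert k J)" for B x
  proof -
    have 1: "p (x(k := 1)) * B = B * p (x(k := 1))"
      by (rule bic[OF B(1) _ restr[OF B(3)]], rule ballI, rule bspec[OF B(2)]) simp
    have "Z k * B = B * Z k" by (rule bspec[OF B(2)]) simp
    then have 2: "E (x k) * B = B * E (x k)" using B(1) by (simp add: E_def distrib_left distrib_right)
    show ?thesis unfolding p'_def using 1 2 by (metis mult.assoc)
  qed
  ultimately show ?case by (intro exI[of _ p'] conjI allI impI ballI)
qed

section \<open>Multilinear polynomials in matrices\<close>

definition mono_prod :: "nat \<Rightarrow> ('v \<Rightarrow> finmat) \<Rightarrow> 'v list \<Rightarrow> finmat" where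
  "mono_prod d W xs = foldr (\<lambda>j acc. W j * acc) xs (eye d)"

lemma mono_prod_simps [simp]: "mono_prod d W [] = eye d" "mono_prod d W (j # xs) = W j * mono_prod d W xs"
  by (simp_all add: mono_prod_def)

definition mpoly :: "nat \<Rightarrow> ('v::linorder set \<Rightarrow> real) \<Rightarrow> 'v set \<Rightarrow> ('v \<Rightarrow> finmat) \<Rightarrow> finmat" where
  "mpoly d f J W = (\<Sum>\<alpha>\<in>Pow J. f \<alpha> *\<^sub>R mono_prod d W (sorted_list_of_set \<alpha>))"

lemma fin_seval_bcs_poly:
  fixes K :: "'c \<Rightarrow> 'v::{finite,linorder} set"
  assumes \<phi>: "\<And>s. \<phi> s \<in> carrier_mat d d"
  shows "fin (seval d \<phi> (bcs_poly K Sat i)) = mpoly d (bcs_coef K Sat i) (K i) (\<lambda>j. fin (\<phi> j))"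
proof -
  have "fin (seval d \<phi> (foldr (\<lambda>j. Mul (Gen j)) xs (Cst 1))) = mono_prod d (\<lambda>j. fin (\<phi> j)) xs" for xs
    by (induction xs)
      (simp_all add: fin_seval_Mul[OF \<phi>] fin_seval_Cst_one[OF \<phi>] del: seval.simps(2-))
  moreover have "eye d * mono_prod d (\<lambda>j. fin (\<phi> j)) xs = mono_prod d (\<lambda>j. fin (\<phi> j)) xs" for xs
    using \<phi> by (cases xs) simp_all
  ultimately show ?thesis
    by (simp add: bcs_poly_def fin_seval_ssum[OF \<phi>] fin_seval_Mul[OF \<phi>] fin_seval_Cst[OF \<phi>] smono_def
        mpoly_def seval_carrier[OF \<phi>] del: seval.simps(2-))
qed

lemma mono_prod_eigen:
  assumes "in_corner d P" "\<And>j. j \<in> set xs \<Longrightarrow> W j * P = x j *\<^sub>R P"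
  shows "mono_prod d W xs * P = prod_list (map x xs) *\<^sub>R P"
  using assms(2) by (induction xs) (simp_all add: assms(1) mult.assoc)

text \<open>On a joint eigenprojection every ordered monomial acts as a scalar, so the
  noncommutative polynomial acts as its value at the eigenvalues.\<close>

lemma mpoly_eigen:
  assumes "finite J" "in_corner d P" "\<And>j. j \<in> J \<Longrightarrow> W j * P = x j *\<^sub>R P"
  shows "mpoly d f J W * P = mlin f J x *\<^sub>R P"
proof -
  have "mono_prod d W (sorted_list_of_set \<alpha>) * P = (\<Prod>j\<in>\<alpha>. x j) *\<^sub>R P" if "\<alpha> \<in> Pow J" for \<alpha>
  proof -
    have "finite \<alpha>" using that assms(1) finite_subset by auto
    then show ?thesis
      using that assms(2,3) by (subst mono_prod_eigen[where x = x]) (auto simp: prod.distinct_set_conv_list[symmetric])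
  qed
  then show ?thesis
    by (simp add: mpoly_def mlin_def sum_distrib_right scaleR_sum_left)
qed

lemma mult_bound_mono_prod:
  "(\<And>j. j \<in> set xs \<Longrightarrow> mult_bound 1 (W j)) \<Longrightarrow> mult_bound 1 (mono_prod d W xs)"
proof (induction xs)
  case (Cons j xs)
  then have "mult_bound (1 * 1) (W j * mono_prod d W xs)" by (intro mult_bound_mult) auto
  then show ?case by simp
qed (simp add: mult_bound_eye)

text \<open>From W M - W' M' = (W - W') M' + W (M - M'), where M' is a contraction and W has bound
  K.\<close>

fun mono_const :: "real \<Rightarrow> nat \<Rightarrow> real" where
  "mono_const K 0 = 0"
| "mono_const K (Suc n) = 1 + K * mono_const K n"

lemma mono_const_nonneg: "0 \<le> K \<Longrightarrow> 0 \<le> mono_const K n"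
  by (induction n) simp_all

lemma mono_prod_diff:
  assumes "0 \<le> K" "\<And>j. j \<in> set xs \<Longrightarrow> mult_bound K (W j)" "\<And>j. j \<in> set xs \<Longrightarrow> mult_bound 1 (W' j)"
    "\<And>j. j \<in> set xs \<Longrightarrow> norm (W j - W' j) \<le> \<delta>"
  shows "norm (mono_prod d W xs - mono_prod d W' xs) \<le> mono_const K (length xs) * \<delta>"
  using assms(2-)
proof (induction xs)
  case (Cons k xs)
  let ?M = "mono_prod d W xs" and ?M' = "mono_prod d W' xs"
  have "W k * ?M - W' k * ?M' = (W k - W' k) * ?M' + W k * (?M - ?M')" by (simp add: algebra_simps)
  moreover have "norm ((W k - W' k) * ?M') \<le> \<delta>"
    using Cons.prems by (intro order_trans[OF norm_mult_le1(2)[OF mult_bound_mono_prod]]) auto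
  moreover have "norm (W k * (?M - ?M')) \<le> K * (mono_const K (length xs) * \<delta>)"
    using Cons assms(1) by (intro order_trans[OF mult_boundD(1)[of K]] mult_left_mono) auto
  ultimately have "norm (W k * ?M - W' k * ?M') \<le> \<delta> + K * (mono_const K (length xs) * \<delta>)"
    by (metis norm_triangle_mono)
  then show ?case by (simp add: algebra_simps)
qed simp

definition mpoly_const :: "real \<Rightarrow> ('v set \<Rightarrow> real) \<Rightarrow> 'v set \<Rightarrow> real" where
  "mpoly_const K f J = (\<Sum>\<alpha>\<in>Pow J. \<bar>f \<alpha>\<bar> * mono_const K (card \<alpha>))"

lemma mpoly_const_nonneg: "0 \<le> K \<Longrightarrow> 0 \<le> mpoly_const K f J"
  by (simp add: mpoly_const_def sum_nonneg mono_const_nonneg)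

lemma mpoly_diff:
  assumes "0 \<le> K" "finite J" "\<And>j. j \<in> J \<Longrightarrow> mult_bound K (W j)" "\<And>j. j \<in> J \<Longrightarrow> mult_bound 1 (W' j)"
    "\<And>j. j \<in> J \<Longrightarrow> norm (W j - W' j) \<le> \<delta>"
  shows "norm (mpoly d f J W - mpoly d f J W') \<le> mpoly_const K f J * \<delta>"
proof -
  let ?m = "\<lambda>W \<alpha>. mono_prod d W (sorted_list_of_set \<alpha>)"
  have "norm (f \<alpha> *\<^sub>R ?m W \<alpha> - f \<alpha> *\<^sub>R ?m W' \<alpha>) \<le> \<bar>f \<alpha>\<bar> * (mono_const K (card \<alpha>) * \<delta>)" if "\<alpha> \<in> Pow J" for \<alpha>
  proof -
    have \<alpha>: "finite \<alpha>" using that assms(2) finite_subset by auto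
    have "norm (?m W \<alpha> - ?m W' \<alpha>) \<le> mono_const K (length (sorted_list_of_set \<alpha>)) * \<delta>"
      using \<alpha> that assms by (intro mono_prod_diff) auto
    then show ?thesis by (simp add: mult_left_mono flip: scaleR_diff_right)
  qed
  then have "norm (\<Sum>\<alpha>\<in>Pow J. f \<alpha> *\<^sub>R ?m W \<alpha> - f \<alpha> *\<^sub>R ?m W' \<alpha>) \<le> (\<Sum>\<alpha>\<in>Pow J. \<bar>f \<alpha>\<bar> * (mono_const K (card \<alpha>) * \<delta>))"
    by (rule sum_norm_le)
  then show ?thesis
    by (simp add: mpoly_def mpoly_const_def sum_subtractf sum_distrib_right mult.assoc)
qed

lemma proj_family_calculus:
  assumes "joint_spectral d J Z p" "finite J"
  shows "(\<Sum>x\<in>cube J. a x *\<^sub>R p x) * (\<Sum>x\<in>cube J. b x *\<^sub>R p x) = (\<Sum>x\<in>cube J. (a x * b x) *\<^sub>R p x)"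
    and "star (\<Sum>x\<in>cube J. a x *\<^sub>R p x) = (\<Sum>x\<in>cube J. a x *\<^sub>R p x)"
    and "in_corner d (\<Sum>x\<in>cube J. a x *\<^sub>R p x)"
    and "x \<in> cube J \<Longrightarrow> (\<Sum>x\<in>cube J. a x *\<^sub>R p x) * p x = a x *\<^sub>R p x"
proof -
  note p = joint_spectralD[OF assms(1)]
  show 4: "(\<Sum>x\<in>cube J. a x *\<^sub>R p x) * p x = a x *\<^sub>R p x" if x: "x \<in> cube J" for x a
  proof -
    have "(\<Sum>y\<in>cube J. a y *\<^sub>R p y) * p x = (\<Sum>y\<in>cube J. if y = x then a x *\<^sub>R p x else 0)"
      unfolding sum_distrib_right using p(2)[OF _ x] projD(3)[OF p(1)[OF x]] by (intro sum.cong refl) auto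
    then show ?thesis using x finite_cube[OF assms(2)] by simp
  qed
  show "(\<Sum>x\<in>cube J. a x *\<^sub>R p x) * (\<Sum>x\<in>cube J. b x *\<^sub>R p x) = (\<Sum>x\<in>cube J. (a x * b x) *\<^sub>R p x)"
    unfolding sum_distrib_left[of "\<Sum>x\<in>cube J. a x *\<^sub>R p x"] using 4 by (intro sum.cong refl) simp
  show "star (\<Sum>x\<in>cube J. a x *\<^sub>R p x) = (\<Sum>x\<in>cube J. a x *\<^sub>R p x)"
    unfolding star_sum by (intro sum.cong refl) (simp add: projD(2)[OF p(1)])
  show "in_corner d (\<Sum>x\<in>cube J. a x *\<^sub>R p x)" using p(1) by (simp add: projD)
qed

section \<open>BCS games\<close>

lemma corner_mpoly:
  assumes "finite J" "\<And>j. j \<in> J \<Longrightarrow> in_corner d (W j)"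
  shows "in_corner d (mpoly d f J W)"
proof -
  have mono: "in_corner d (mono_prod d W xs)" if "set xs \<subseteq> J" for xs
    using that assms(2) by (induction xs) auto
  have "set (sorted_list_of_set \<alpha>) \<subseteq> J" if "\<alpha> \<in> Pow J" for \<alpha>
    using that finite_subset[OF _ assms(1), of \<alpha>] by simp
  then show ?thesis
    unfolding mpoly_def by (intro corner_sum corner_scaleR mono)
qed

text \<open>C2 bounds the distance from \<phi> to commuting observables: 3 + 2K comes from two
  comparisons of products, 1 + K each, and the commutator itself. Then
  \<open>mpoly_const K f J * C2 + 1\<close> bounds the violation of the constraint, and moving an
  assignment changes an eigenvalue by at most 2.\<close>

definition constraint_const :: "real \<Rightarrow> ('v set \<Rightarrow> real) \<Rightarrow> 'v set \<Rightarrow> real" where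
  "constraint_const K f J = (let C2 = commuting_const (card J) * (3 + 2 * K) + 1 in
     C2 + card (cube J) * (2 * (mpoly_const K f J * C2 + 1)))"

text \<open>On the spectral projection \<open>p x\<close> of an unsatisfying x the polynomial acts
  as +1, whereas it is close to -1 everywhere. So 2 \<open>p x\<close> is bounded by the violation
  of the constraint.\<close>

lemma constraint_round:
  fixes J :: "'v::linorder set"
  assumes J: "finite J" and K: "0 \<le> K" and S: "x0 \<in> S" "S \<subseteq> cube J"
    and f: "\<And>x. x \<in> cube J \<Longrightarrow> mlin f J x = (if x \<in> S then -1 else 1)"
    and X: "\<And>j. j \<in> J \<Longrightarrow> obs d (X j)" "\<And>j. j \<in> J \<Longrightarrow> norm (X j - \<phi> j) \<le> \<delta>"
    and \<phi>: "\<And>j. j \<in> J \<Longrightarrow> mult_bound K (\<phi> j)"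
      "\<And>i j. i \<in> J \<Longrightarrow> j \<in> J \<Longrightarrow> norm (\<phi> i * \<phi> j - \<phi> j * \<phi> i) \<le> \<delta>"
      "norm (mpoly d f J \<phi> + eye d) \<le> \<delta>"
  shows "\<exists>Z. (\<forall>j\<in>J. obs d (Z j) \<and> norm (Z j - \<phi> j) \<le> constraint_const K f J * \<delta>) \<and> commuting_on J Z \<and>
    mpoly d f J Z = - eye d"
proof -
  define C1 where "C1 = commuting_const (card J)"
  define C2 where "C2 = C1 * (3 + 2 * K) + 1"
  define C3 where "C3 = mpoly_const K f J"
  define C4 where "C4 = C3 * C2 + 1"
  have C_eq: "constraint_const K f J = C2 + card (cube J) * (2 * C4)"
    by (simp only: constraint_const_def Let_def C1_def C2_def C3_def C4_def)
  have pos: "0 \<le> C2" "0 \<le> C4"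
    using K commuting_const_nonneg[of "card J"] mpoly_const_nonneg[OF K, of f J]
    by (simp_all add: C1_def C2_def C3_def C4_def)
  have \<delta>: "0 \<le> \<delta>" using \<phi>(3) norm_ge_zero order_trans by blast
  have XX\<phi>: "norm (X i * X j - \<phi> i * \<phi> j) \<le> (1 + K) * \<delta>" if ij: "i \<in> J" "j \<in> J" for i j
  proof -
    have "X i * X j - \<phi> i * \<phi> j = (X i - \<phi> i) * X j + \<phi> i * (X j - \<phi> j)" by (simp add: algebra_simps)
    moreover have "norm ((X i - \<phi> i) * X j) \<le> \<delta>"
      by (rule order_trans[OF norm_mult_le1(2)[OF mult_bound_obs[OF X(1)[OF ij(2)]]] X(2)[OF ij(1)]])
    moreover have "norm (\<phi> i * (X j - \<phi> j)) \<le> K * \<delta>"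
      by (rule order_trans[OF mult_boundD(1)[OF \<phi>(1)[OF ij(1)]]]) (intro mult_left_mono X ij K)
    ultimately have "norm (X i * X j - \<phi> i * \<phi> j) \<le> \<delta> + K * \<delta>" by (metis norm_triangle_mono)
    then show ?thesis by (simp add: algebra_simps)
  qed
  have XX: "norm (X i * X j - X j * X i) \<le> (3 + 2 * K) * \<delta>" if ij: "i \<in> J" "j \<in> J" for i j
  proof -
    have "X i * X j - X j * X i = (X i * X j - \<phi> i * \<phi> j) - (X j * X i - \<phi> j * \<phi> i) + (\<phi> i * \<phi> j - \<phi> j * \<phi> i)"
      by simp
    also have "norm \<dots> \<le> (1 + K) * \<delta> + (1 + K) * \<delta> + \<delta>"
      by (intro norm_triangle_mono order_trans[OF norm_triangle_ineq4 add_mono] XX\<phi> \<phi>(2) ij)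
    finally show ?thesis by (simp add: algebra_simps)
  qed
  from commuting_round[of J d X, OF J X(1) XX] obtain W where
    W0: "\<forall>j\<in>J. obs d (W j) \<and> norm (W j - X j) \<le> C1 * ((3 + 2 * K) * \<delta>)" and WW: "commuting_on J W"
    unfolding C1_def by blast
  then have W: "obs d (W j)" "norm (W j - X j) \<le> C1 * ((3 + 2 * K) * \<delta>)" if "j \<in> J" for j
    using that by auto
  have W\<phi>: "norm (W j - \<phi> j) \<le> C2 * \<delta>" if "j \<in> J" for j
    using norm_triangle_mono[OF W(2)[OF that] X(2)[OF that]] by (simp add: C2_def algebra_simps)
  have "norm (mpoly d f J \<phi> - mpoly d f J W) \<le> C3 * (C2 * \<delta>)"
    unfolding C3_def using W\<phi> by (intro mpoly_diff K J \<phi>(1) mult_bound_obs[OF W(1)]) (simp_all add: norm_minus_commute)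
  from norm_triangle_mono[OF order_trans[OF norm_minus_commute[THEN eq_refl] this] \<phi>(3)]
  have Wf: "norm (mpoly d f J W + eye d) \<le> C4 * \<delta>" by (simp add: C4_def algebra_simps)
  have "\<exists>p. joint_spectral d J W p \<and>
    (\<forall>B. in_corner d B \<longrightarrow> (\<forall>j\<in>J. W j * B = B * W j) \<longrightarrow> (\<forall>x\<in>cube J. p x * B = B * p x))"
    by (rule joint_spectral_exists[OF J W(1) WW])
  then obtain p where p: "joint_spectral d J W p" by blast
  note pp = joint_spectralD(1,3,4)[OF p]
  have small: "norm (p x) \<le> C4 * \<delta>" if x: "x \<in> cube J" "x \<notin> S" for x
  proof -
    have "(mpoly d f J W + eye d) * p x = 2 *\<^sub>R p x"
      using mpoly_eigen[OF J projD(1)[OF pp(1)[OF x(1)]] pp(3)[OF _ x(1)], where f = f] f[OF x(1)] x pp(1)[OF x(1)]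
      by (simp add: distrib_right projD scaleR_2)
    then have "2 * norm (p x) = norm ((mpoly d f J W + eye d) * p x)" by simp
    also have "\<dots> \<le> C4 * \<delta>"
      by (rule order_trans[OF norm_mult_le1(2)[OF mult_bound_projD[OF pp(1)[OF x(1)]]] Wf])
    finally show ?thesis using norm_ge_zero[of "p x"] by linarith
  qed
  \<comment> \<open>Only the eigenvalues change; the joint projections stay. Hence the
    \<open>Z j\<close> commute automatically, and since all joint eigenvalues are now satisfying,
    the constraint polynomial is exactly -1.\<close>
  define g where "g = (\<lambda>x. if x \<in> S then x else x0)"
  have g: "g x \<in> cube J" "g x \<in> S" for x using S by (auto simp: g_def)
  define Z where "Z = (\<lambda>j. \<Sum>x\<in>cube J. g x j *\<^sub>R p x)"
  note calc = proj_family_calculus[OF p J]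
  have Zobs: "obs d (Z j)" for j
    unfolding obs_def
  proof (intro conjI)
    have "Z j * Z j = (\<Sum>x\<in>cube J. (g x j * g x j) *\<^sub>R p x)" unfolding Z_def by (rule calc(1))
    also have "\<dots> = eye d" by (simp add: cube_square[OF g(1)] pp(2))
    finally show "Z j * Z j = eye d" .
  qed (simp_all only: Z_def calc)
  have Zcomm: "commuting_on J Z"
    by (rule commuting_onI) (simp add: Z_def calc(1) mult.commute)
  have Zp: "Z j * p x = g x j *\<^sub>R p x" if "x \<in> cube J" for j x
    unfolding Z_def by (rule calc(4)[OF that])
  have "mpoly d f J Z * p x = - p x" if x: "x \<in> cube J" for x
    using mpoly_eigen[OF J projD(1)[OF pp(1)[OF x]] Zp[OF x], where f = f] f[OF g(1), of x] g(2)[of x] by simp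
  then have "mpoly d f J Z * eye d = - eye d"
    unfolding pp(2)[symmetric] by (simp add: sum_distrib_left sum_negf)
  then have Zf: "mpoly d f J Z = - eye d"
    using corner_mpoly[OF J, of d Z f] Zobs by (simp add: obs_def)
  have ZW: "norm (Z j - W j) \<le> card (cube J) * (2 * C4 * \<delta>)" if j: "j \<in> J" for j
  proof -
    have "W j = W j * (\<Sum>x\<in>cube J. p x)" using W(1)[OF j] by (simp add: pp(2) obsD)
    also have "\<dots> = (\<Sum>x\<in>cube J. x j *\<^sub>R p x)" using pp(3)[OF j] by (simp add: sum_distrib_left)
    finally have eq: "Z j - W j = (\<Sum>x\<in>cube J. (g x j - x j) *\<^sub>R p x)"
      by (simp add: Z_def scaleR_diff_left sum_subtractf)
    have "norm ((g x j - x j) *\<^sub>R p x) \<le> 2 * C4 * \<delta>" if x: "x \<in> cube J" for x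
    proof (cases "x \<in> S")
      case True
      then show ?thesis using pos \<delta> by (simp add: g_def)
    next
      case False
      have "\<bar>g x j - x j\<bar> \<le> 2" using cube_values[OF g(1), of x j] cube_values[OF x, of j] by auto
      then have "\<bar>g x j - x j\<bar> * norm (p x) \<le> 2 * (C4 * \<delta>)" using small[OF x False] by (intro mult_mono) auto
      then show ?thesis by simp
    qed
    then have "norm (\<Sum>x\<in>cube J. (g x j - x j) *\<^sub>R p x) \<le> (\<Sum>x\<in>cube J. 2 * C4 * \<delta>)"
      by (rule sum_norm_le)
    then show ?thesis by (simp add: eq)
  qed
  have "norm (Z j - \<phi> j) \<le> constraint_const K f J * \<delta>" if j: "j \<in> J" for j
    using norm_triangle_mono[OF ZW[OF j] W\<phi>[OF j]] by (simp add: C_eq algebra_simps)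
  then show ?thesis using Zobs Zcomm Zf by blast
qed

text \<open>By uniqueness of coefficients an unsatisfiable constraint has the constant polynomial 1.
  This excludes such constraints whenever an approximate representation with \<epsilon> \<le> 1
  exists.\<close>

lemma mpoly_unsatisfiable:
  assumes "finite J" "\<And>x. x \<in> cube J \<Longrightarrow> mlin f J x = 1"
  shows "mpoly d f J W = eye d"
proof -
  define g where "g = (\<lambda>\<alpha>::'a set. if \<alpha> = {} then 1 else (0::real))"
  have g: "mlin g J x = 1" for x
  proof -
    have "mlin g J x = (\<Sum>\<alpha>\<in>Pow J. if \<alpha> = {} then 1 else 0)"
      unfolding mlin_def by (intro sum.cong refl) (simp add: g_def)
    then show ?thesis using assms(1) by simp
  qed
  have "mlin (\<lambda>\<alpha>. f \<alpha> - g \<alpha>) J x = mlin f J x - mlin g J x" for x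
    by (simp add: mlin_def left_diff_distrib sum_subtractf)
  then have "f \<alpha> - g \<alpha> = 0" if "\<alpha> \<subseteq> J" for \<alpha>
    using mlin_zero[OF assms(1), of "\<lambda>\<alpha>. f \<alpha> - g \<alpha>" \<alpha>] assms(2) g that by simp
  then have "mpoly d f J W = (\<Sum>\<alpha>\<in>Pow J. if \<alpha> = {} then eye d else 0)"
    unfolding mpoly_def by (intro sum.cong refl) (auto simp: g_def)
  then show ?thesis using assms(1) by simp
qed

text \<open>The coefficients are real, so conjugating Alice's observables preserves the
  constraint.\<close>

lemma mpoly_fconj: "mpoly d f J (\<lambda>j. fconj (W j)) = fconj (mpoly d f J W)"
proof -
  have "mono_prod d (\<lambda>j. fconj (W j)) xs = fconj (mono_prod d W xs)" for xs
    by (induction xs) simp_all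
  then show ?thesis by (simp add: mpoly_def)
qed

lemma mpoly_cong:
  assumes "finite J" "\<And>j. j \<in> J \<Longrightarrow> W j = W' j" shows "mpoly d f J W = mpoly d f J W'"
proof -
  have mono: "mono_prod d W xs = mono_prod d W' xs" if "set xs \<subseteq> J" for xs
    using that assms(2) by (induction xs) auto
  have "set (sorted_list_of_set \<alpha>) \<subseteq> J" if "\<alpha> \<in> Pow J" for \<alpha>
    using that finite_subset[OF _ assms(1), of \<alpha>] by simp
  then show ?thesis
    unfolding mpoly_def by (intro sum.cong refl) (simp add: mono)
qed

text \<open>Polarisation with |X|^2 = |Z|^2 = d. It makes the probability of disagreement equal to
  |Z - X|^2/(4d), hence quadratic in the distance.\<close>

lemma inner_obs: assumes "obs d X" "obs d Z" shows "inner Z X = real d - (norm (Z - X))\<^sup>2 / 2"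
proof -
  have "(norm X)\<^sup>2 = real d" if "obs d X" for X
  proof -
    have "(norm X)\<^sup>2 = inner (eye d * X) X" using that by (simp add: obsD power2_norm_eq_inner)
    also have "\<dots> = inner (eye d) (X * X)" by (simp only: inner_mult_right obsD(2)[OF that])
    also have "\<dots> = (norm (eye d))\<^sup>2" using that by (simp add: obsD power2_norm_eq_inner)
    finally show ?thesis by (simp add: norm_eye)
  qed
  then show ?thesis using assms by (simp add: power2_norm_eq_inner inner_diff_left inner_diff_right inner_commute field_simps)
qed

lemma bcs_relsI:
  "Sub (Star (Gen j)) (Gen j) \<in> bcs_rels K Sat"
  "Sub (Mul (Gen j) (Gen j)) (Cst 1) \<in> bcs_rels K Sat"
  "Sub (bcs_poly K Sat i) (Cst (-1)) \<in> bcs_rels K Sat"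
  "j \<in> K i \<Longrightarrow> j' \<in> K i \<Longrightarrow> Sub (Mul (Gen j) (Gen j')) (Mul (Gen j') (Gen j)) \<in> bcs_rels K Sat"
  unfolding bcs_rels_def by blast+

lemma bcs_strategyI:
  fixes Ks :: "'c \<Rightarrow> 'v::{finite,linorder} set"
  assumes Z: "\<And>i j. j \<in> Ks i \<Longrightarrow> obs d (Z i j)" "\<And>i. commuting_on (Ks i) (Z i)"
    "\<And>i. mpoly d (bcs_coef Ks Sat i) (Ks i) (Z i) = - eye d" and X: "\<And>j. obs d (X j)"
  shows "bcs_strategy d Ks Sat (\<lambda>i j. cconj (of_fin d (Z i j))) (\<lambda>j. of_fin d (X j))"
  unfolding bcs_strategy_def
proof (intro conjI allI ballI)
  have fin_Y: "fin (cconj (of_fin d (Z i j))) = fconj (Z i j)" if "j \<in> Ks i" for i j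
    using Z(1)[OF that] by (simp add: fin_cconj[where d = d] obsD)
  have Y: "cconj (of_fin d (Z i j)) \<in> carrier_mat d d" for i j by simp
  fix i
  let ?S = "seval d (\<lambda>j. cconj (of_fin d (Z i j))) (bcs_poly Ks Sat i)"
  have "fin ?S = mpoly d (bcs_coef Ks Sat i) (Ks i) (\<lambda>j. fin (cconj (of_fin d (Z i j))))"
    by (rule fin_seval_bcs_poly) simp
  also have "\<dots> = mpoly d (bcs_coef Ks Sat i) (Ks i) (\<lambda>j. fconj (Z i j))"
    by (rule mpoly_cong) (simp_all add: fin_Y)
  also have "\<dots> = fin (- 1\<^sub>m d)" by (simp add: mpoly_fconj Z(3) fin_uminus[where d = d])
  finally have "fin ?S = fin (- 1\<^sub>m d)" .
  moreover have "?S \<in> carrier_mat d d" by (rule seval_carrier) simp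
  moreover have "- 1\<^sub>m d \<in> carrier_mat d d" by simp
  ultimately show "?S = - 1\<^sub>m d" using fin_inject by blast
  fix j assume j: "j \<in> Ks i"
  show "is_obs d (cconj (of_fin d (Z i j)))" by (rule is_obs_cconj_of_fin[OF Z(1)[OF j]])
  fix k assume k: "k \<in> Ks i"
  have "fin (cconj (of_fin d (Z i j)) * cconj (of_fin d (Z i k))) =
      fin (cconj (of_fin d (Z i k)) * cconj (of_fin d (Z i j)))"
    unfolding fin_mult[OF Y Y] fin_Y[OF j] fin_Y[OF k] fconj_mult[symmetric] commuting_onD[OF Z(2) j k] ..
  then show "cconj (of_fin d (Z i j)) * cconj (of_fin d (Z i k)) =
      cconj (of_fin d (Z i k)) * cconj (of_fin d (Z i j))"
    using fin_inject[OF mult_carrier_mat[OF Y Y] mult_carrier_mat[OF Y Y]] by blast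
qed (rule is_obs_of_fin[OF X])

lemma bcs_winprob_ge:
  fixes \<eta> :: "'c::finite \<Rightarrow> 'v::finite \<Rightarrow> real"
  assumes "prob_dist \<eta>" "d \<ge> 1" "\<And>i j. j \<in> Ks i \<Longrightarrow> obs d (Z i j)" "\<And>j. obs d (X j)"
    and close: "\<And>i j. j \<in> Ks i \<Longrightarrow> norm (Z i j - X j) \<le> M * sqrt (real d)"
  shows "bcs_winprob \<eta> Ks (\<lambda>i j. cconj (of_fin d (Z i j))) (\<lambda>j. of_fin d (X j)) (max_ent d) \<ge> 1 - M\<^sup>2"
proof -
  have win: "1 - M\<^sup>2 \<le> (if j \<notin> Ks i then 1 else
      (1 + Re (expect (max_ent d) (kron (cconj (of_fin d (Z i j))) (of_fin d (X j))))) / 2)" for i j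
  proof (cases "j \<in> Ks i")
    case True
    have "(norm (Z i j - X j))\<^sup>2 \<le> (M * sqrt (real d))\<^sup>2" by (intro power_mono close True) simp
    then have "inner (Z i j) (X j) \<ge> real d - M\<^sup>2 * real d / 2"
      using inner_obs[OF assms(4) assms(3)[OF True]] by (simp add: power_mult_distrib)
    then have "inner (Z i j) (X j) / real d \<ge> 1 - M\<^sup>2 / 2"
      using assms(2) by (subst pos_le_divide_eq) (simp_all add: algebra_simps)
    note ge = this
    have "1 - q \<le> (1 + r) / 2" if "1 - q / 2 \<le> r" "0 \<le> q" for q r :: real
      using that by (simp add: field_simps)
    from this[OF ge zero_le_power2] have "1 - M\<^sup>2 \<le> (1 + inner (Z i j) (X j) / real d) / 2" .
    then show ?thesis
      using True assms(3)[OF True] assms(4) by (simp add: Re_expect_max_ent[of _ d] obsD)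
  qed simp
  show ?thesis unfolding bcs_winprob_def by (rule prob_dist_average_ge[OF assms(1) win])
qed

text \<open>Bob's observables are rounded singly. Each constraint then receives its own commuting
  family, obtained from them and close to the same \<phi>, so the answers of Alice and Bob for a
  shared variable agree up to O(\<epsilon>) in norm.\<close>

theorem bcs_stability:
  fixes \<eta> :: "'c::finite \<Rightarrow> 'v::{finite,linorder} \<Rightarrow> real" and Ks :: "'c \<Rightarrow> 'v set"
  assumes K: "K > 0" and game: "bcs_game \<eta> Ks Sat"
  shows "\<exists>C>0. \<exists>\<epsilon>0>0. \<forall>\<epsilon> (d::nat) (\<phi> :: 'v \<Rightarrow> complex mat).
         0 \<le> \<epsilon> \<and> \<epsilon> \<le> \<epsilon>0 \<and> d \<ge> 1 \<and> eps_rep lfrob d (bcs_rels Ks Sat) \<epsilon> \<phi> \<and>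
         (\<forall>j. op_norm (\<phi> j) \<le> K) \<longrightarrow>
         (\<exists>Y X. bcs_strategy d Ks Sat Y X \<and> (\<forall>j. lfrob (X j - \<phi> j) \<le> C * \<epsilon>) \<and>
              bcs_winprob \<eta> Ks Y X (max_ent d) \<ge> 1 - C * \<epsilon>\<^sup>2)"
proof -
  define f where "f = bcs_coef Ks Sat"
  define C where "C = (\<lambda>i. constraint_const K (f i) (Ks i))"
  \<comment> \<open>Absolute values make this sum an upper bound for every
    \<open>C i\<close>.\<close>
  define C0 where "C0 = (\<Sum>i\<in>UNIV. \<bar>C i\<bar>)"
  have C0: "C i \<le> C0" "0 \<le> C0" for i
    using member_le_sum[of i UNIV "\<lambda>i. \<bar>C i\<bar>"] by (auto simp: C0_def sum_nonneg)
  define L where "L = 2 + 2 * K"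
  define M where "M = (C0 + 1) * L"
  define D where "D = L + M\<^sup>2"
  have L: "L \<ge> 1" using K by (simp add: L_def)
  have D: "D > 0" "L \<le> D" "M\<^sup>2 \<le> D" using L by (simp_all add: D_def add_pos_nonneg)
  show ?thesis
  proof (rule exI[of _ D], intro conjI D, rule exI[of _ 1], intro conjI allI impI)
    fix \<epsilon> :: real and d :: nat and \<phi> :: "'v \<Rightarrow> complex mat"
    assume "0 \<le> \<epsilon> \<and> \<epsilon> \<le> 1 \<and> d \<ge> 1 \<and> eps_rep lfrob d (bcs_rels Ks Sat) \<epsilon> \<phi> \<and> (\<forall>j. op_norm (\<phi> j) \<le> K)"
    then have \<epsilon>: "0 \<le> \<epsilon>" "\<epsilon> \<le> 1" and d: "d \<ge> 1" and rep: "eps_rep lfrob d (bcs_rels Ks Sat) \<epsilon> \<phi>"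
      and op: "\<And>j. op_norm (\<phi> j) \<le> K" by auto
    have \<phi>: "\<And>s. \<phi> s \<in> carrier_mat d d" using rep unfolding eps_rep_def by blast
    define \<delta> where "\<delta> = \<epsilon> * sqrt (real d)"
    have \<delta>: "0 \<le> \<delta>" using \<epsilon> by (simp add: \<delta>_def)
    define F where "F = (\<lambda>j. fin (\<phi> j))"
    note rel = eps_rep_norm[OF \<phi> rep _ d, folded \<delta>_def]
    have F: "in_corner d (F j)" "mult_bound K (F j)" for j
      using \<phi> K op by (auto simp: F_def intro!: mult_bound_op_norm)
    note fs = fin_seval[OF \<phi>] fin_seval_bcs_poly[OF \<phi>]
    have F1: "norm (F j - star (F j)) \<le> \<delta>" for j
      using rel[OF bcs_relsI(1), of j] by (simp add: fs F_def norm_minus_commute del: seval.simps(2-))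
    have F2: "norm (F j * F j - eye d) \<le> \<delta>" for j
      using rel[OF bcs_relsI(2), of j] by (simp add: fs F_def del: seval.simps(2-))
    have F3: "norm (mpoly d (f i) (Ks i) F + eye d) \<le> \<delta>" for i
      using rel[OF bcs_relsI(3), of i] by (simp add: fs F_def[abs_def] f_def del: seval.simps(2-))
    have F4: "norm (F j * F k - F k * F j) \<le> \<delta>" if "j \<in> Ks i" "k \<in> Ks i" for i j k
      using rel[OF bcs_relsI(4)[of j Ks i k, OF that]] by (simp add: fs F_def del: seval.simps(2-))
    \<comment> \<open>An empty \<open>Sat i\<close> would give 2 sqrt d \<le> \<epsilon> sqrt d.
      This is where \<epsilon> \<le> 1 is used.\<close>
    have nonempty: "Sat i \<noteq> {}" for i
    proof
      assume "Sat i = {}"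
      then have "mpoly d (f i) (Ks i) F = eye d"
        using bcs_coef_spec[of _ Ks i Sat] by (intro mpoly_unsatisfiable) (simp_all add: f_def)
      then have "norm (2 *\<^sub>R eye d) \<le> \<delta>" using F3[of i] by (simp add: scaleR_2)
      then have "2 * sqrt (real d) \<le> \<epsilon> * sqrt (real d)" by (simp add: norm_eye \<delta>_def)
      then show False using d \<epsilon> by (simp add: mult_le_cancel_right)
    qed
    have "\<forall>j. \<exists>X. obs d X \<and> norm (X - F j) \<le> L * \<delta>"
      unfolding L_def using round_obs[OF F F1 F2] by blast
    then obtain X where X: "\<And>j. obs d (X j)" "\<And>j. norm (X j - F j) \<le> L * \<delta>" by metis
    \<comment> \<open>The rounded observables are within L \<delta> of \<phi>, so
      \<open>constraint_round\<close> is run with L \<delta> as the common error for the relations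
      too.\<close>
    have L\<delta>: "\<delta> \<le> L * \<delta>" using L \<delta> mult_right_mono[of 1 L \<delta>] by simp
    have "\<forall>i. \<exists>Z. (\<forall>j\<in>Ks i. obs d (Z j) \<and> norm (Z j - F j) \<le> C i * (L * \<delta>)) \<and> commuting_on (Ks i) Z \<and>
      mpoly d (f i) (Ks i) Z = - eye d"
    proof
      fix i
      obtain x0 where x0: "x0 \<in> Sat i" using nonempty by blast
      have sub: "Sat i \<subseteq> cube (Ks i)" using game by (simp add: bcs_game_def)
      have "mlin (f i) (Ks i) x = (if x \<in> Sat i then -1 else 1)" if "x \<in> cube (Ks i)" for x
        unfolding f_def by (rule bcs_coef_spec[of x Ks i, OF that])
      from constraint_round[OF finite less_imp_le[OF K] x0 sub this X F(2) order_trans[OF F4 L\<delta>] order_trans[OF F3 L\<delta>]]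
      show "\<exists>Z. (\<forall>j\<in>Ks i. obs d (Z j) \<and> norm (Z j - F j) \<le> C i * (L * \<delta>)) \<and> commuting_on (Ks i) Z \<and>
        mpoly d (f i) (Ks i) Z = - eye d"
        unfolding C_def .
    qed
    from choice[OF this] obtain Z where Z: "\<And>i j. j \<in> Ks i \<Longrightarrow> obs d (Z i j)"
      "\<And>i j. j \<in> Ks i \<Longrightarrow> norm (Z i j - F j) \<le> C i * (L * \<delta>)" "\<And>i. commuting_on (Ks i) (Z i)"
      "\<And>i. mpoly d (f i) (Ks i) (Z i) = - eye d"
      by blast
    define Xm where "Xm = (\<lambda>j. of_fin d (X j))"
    define Ym where "Ym = (\<lambda>i j. cconj (of_fin d (Z i j)))"
    have ZX: "norm (Z i j - X j) \<le> M * \<epsilon> * sqrt (real d)" if j: "j \<in> Ks i" for i j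
    proof -
      have "norm (Z i j - X j) \<le> C i * (L * \<delta>) + L * \<delta>"
        using norm_triangle_mono[OF Z(2)[OF j] order_trans[OF norm_minus_commute[THEN eq_refl] X(2)[of j]]] by simp
      also have "\<dots> \<le> C0 * (L * \<delta>) + L * \<delta>" using C0(1) L \<delta> by (intro add_right_mono mult_right_mono) auto
      finally show ?thesis by (simp add: M_def \<delta>_def algebra_simps)
    qed
    have "lfrob (Xm j - \<phi> j) \<le> D * \<epsilon>" for j
      unfolding Xm_def
      by (rule lfrob_of_fin_diff_le[OF obsD(1)[OF X(1)] \<phi> d X(2)[unfolded F_def \<delta>_def] D(2) \<epsilon>(1)])
    moreover have "bcs_winprob \<eta> Ks Ym Xm (max_ent d) \<ge> 1 - (M * \<epsilon>)\<^sup>2"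
      unfolding Xm_def Ym_def using game by (intro bcs_winprob_ge d X Z(1) ZX) (auto simp: bcs_game_def)
    moreover have "(M * \<epsilon>)\<^sup>2 \<le> D * \<epsilon>\<^sup>2"
      using mult_right_mono[OF D(3), of "\<epsilon>\<^sup>2"] by (simp add: power_mult_distrib)
    moreover have "bcs_strategy d Ks Sat Ym Xm"
      unfolding Xm_def Ym_def by (rule bcs_strategyI[OF Z(1,3) Z(4)[unfolded f_def] X(1)])
    ultimately show "\<exists>Y X. bcs_strategy d Ks Sat Y X \<and> (\<forall>j. lfrob (X j - \<phi> j) \<le> D * \<epsilon>) \<and>
              bcs_winprob \<eta> Ks Y X (max_ent d) \<ge> 1 - D * \<epsilon>\<^sup>2"
      by (intro exI[of _ Ym] exI[of _ Xm]) auto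
  qed simp
qed

section \<open>Tsirelson realisations and the elliptope\<close>

definition blk :: "nat \<Rightarrow> finmat \<Rightarrow> finmat \<Rightarrow> finmat \<Rightarrow> finmat \<Rightarrow> finmat" where
  "blk D A B C E = trunc_mat (2 * D) (\<lambda>i j.
     if i < D then if j < D then entry A i j else entry B i (j - D)
     else if j < D then entry C (i - D) j else entry E (i - D) (j - D))"

lemma corner_blk [simp]: "in_corner (2 * D) (blk D A B C E)"
  by (simp add: blk_def in_corner_iff)

lemma sum_two_blocks: "(\<Sum>k<2 * D. f k) = (\<Sum>k<D. f k) + (\<Sum>k<D. f (D + k))" for f :: "nat \<Rightarrow> 'a::comm_monoid_add"
  using sum_nat_block[of f 2 D] by (simp add: numeral_2_eq_2)

lemma blk_mult:
  assumes "in_corner D A" "in_corner D B" "in_corner D C" "in_corner D E"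
  shows "blk D A B C E * blk D A' B' C' E' =
    blk D (A * A' + B * C') (A * B' + B * E') (C * A' + E * C') (C * B' + E * E')"
proof (rule finmat_eqI)
  fix i j
  have b: "bounded_by (blk D A B C E) (2 * D)" using corner_blk by (simp add: in_corner_iff)
  have bs: "bounded_by A D" "bounded_by B D" "bounded_by C D" "bounded_by E D"
    using assms by (simp_all add: in_corner_iff)
  show "entry (blk D A B C E * blk D A' B' C' E') i j =
    entry (blk D (A * A' + B * C') (A * B' + B * E') (C * A' + E * C') (C * B' + E * E')) i j"
    by (cases "i < D"; cases "i < 2 * D"; cases "j < D"; cases "j < 2 * D")
      (simp_all add: entry_times[OF b] sum_two_blocks entry_times[OF bs(1)] entry_times[OF bs(2)]
        entry_times[OF bs(3)] entry_times[OF bs(4)],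
        simp_all add: blk_def entry_times[OF bs(1)] entry_times[OF bs(2)] entry_times[OF bs(3)] entry_times[OF bs(4)])
qed

lemma blk_add: "blk D A B C E + blk D A' B' C' E' = blk D (A + A') (B + B') (C + C') (E + E')"
  by (rule finmat_eqI) (simp add: blk_def)

lemma blk_star: "star (blk D A B C E) = blk D (star A) (star C) (star B) (star E)"
  by (rule finmat_eqI) (simp add: blk_def)

lemma blk_eye: "blk D (r *\<^sub>R eye D) 0 0 (r *\<^sub>R eye D) = r *\<^sub>R eye (2 * D)"
  by (rule finmat_eqI) (auto simp: blk_def entry_eye)

definition clifford :: "nat \<Rightarrow> nat \<Rightarrow> (nat \<Rightarrow> finmat) \<Rightarrow> bool" where
  "clifford D N \<gamma> \<longleftrightarrow> (\<forall>k<N. in_corner D (\<gamma> k) \<and> star (\<gamma> k) = \<gamma> k) \<and>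
    (\<forall>k<N. \<forall>l<N. \<gamma> k * \<gamma> l + \<gamma> l * \<gamma> k = (if k = l then 2 else 0) *\<^sub>R eye D)"

lemma cliffordD:
  assumes "clifford D N \<gamma>"
  shows "k < N \<Longrightarrow> in_corner D (\<gamma> k)" "k < N \<Longrightarrow> star (\<gamma> k) = \<gamma> k"
    "k < N \<Longrightarrow> l < N \<Longrightarrow> \<gamma> k * \<gamma> l + \<gamma> l * \<gamma> k = (if k = l then 2 else 0) *\<^sub>R eye D"
proof -
  note h = assms[unfolded clifford_def]
  show "k < N \<Longrightarrow> in_corner D (\<gamma> k)" "k < N \<Longrightarrow> star (\<gamma> k) = \<gamma> k"
    using h[THEN conjunct1] by simp_all
  show "k < N \<Longrightarrow> l < N \<Longrightarrow> \<gamma> k * \<gamma> l + \<gamma> l * \<gamma> k = (if k = l then 2 else 0) *\<^sub>R eye D"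
    by (rule h[THEN conjunct2, rule_format])
qed

text \<open>Doubling with Pauli matrices: the new generator is sigma_z \<otimes> 1, and an old one
  becomes sigma_x \<otimes> \<gamma>_k.\<close>

lemma clifford_exists: "\<exists>D \<gamma>. D \<ge> 1 \<and> clifford D N \<gamma>"
proof (induction N)
  case 0
  show ?case by (intro exI[of _ 1]) (simp add: clifford_def)
next
  case (Suc N)
  then obtain D \<gamma> where D: "D \<ge> 1" and \<gamma>: "clifford D N \<gamma>" by blast
  define \<gamma>' where "\<gamma>' = (\<lambda>k. if k = N then blk D (eye D) 0 0 (- eye D) else blk D 0 (\<gamma> k) (\<gamma> k) 0)"
  have eye: "blk D (eye D) 0 0 (- eye D) * blk D (eye D) 0 0 (- eye D) = eye (2 * D)"
    using blk_eye[of D 1] by (simp add: blk_mult in_corner_def)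
  have "clifford (2 * D) (Suc N) \<gamma>'"
    unfolding clifford_def
  proof (intro conjI allI impI)
    fix k assume k: "k < Suc N"
    show "in_corner (2 * D) (\<gamma>' k)" by (simp add: \<gamma>'_def)
    show "star (\<gamma>' k) = \<gamma>' k" using k cliffordD(2)[OF \<gamma>, of k] by (simp add: \<gamma>'_def blk_star)
    fix l assume l: "l < Suc N"
    have e: "in_corner D (- eye D)" by (simp add: in_corner_def)
    consider "k = N" "l = N" | "k = N" "l < N" | "k < N" "l = N" | "k < N" "l < N" using k l by linarith
    then show "\<gamma>' k * \<gamma>' l + \<gamma>' l * \<gamma>' k = (if k = l then 2 else 0) *\<^sub>R eye (2 * D)"
    proof cases
      case 1
      then show ?thesis by (simp add: \<gamma>'_def eye scaleR_2)
    next
      case 2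
      then show ?thesis using cliffordD(1)[OF \<gamma>, of l] e blk_eye[of D 0]
        by (simp add: \<gamma>'_def blk_mult blk_add)
    next
      case 3
      then show ?thesis using cliffordD(1)[OF \<gamma>, of k] e blk_eye[of D 0]
        by (simp add: \<gamma>'_def blk_mult blk_add)
    next
      case 4
      then show ?thesis
        using cliffordD(1)[OF \<gamma>, of k] cliffordD(1)[OF \<gamma>, of l] cliffordD(3)[OF \<gamma>, of k l]
          blk_eye[of D "if k = l then 2 else 0"]
        by (simp add: \<gamma>'_def blk_mult blk_add split del: if_split)
    qed
  qed
  moreover have "2 * D \<ge> 1" using D by simp
  ultimately show ?case by blast
qed

lemma clifford_inner:
  assumes "clifford D N \<gamma>" "k < N" "l < N"
  shows "inner (\<gamma> k) (\<gamma> l) = (if k = l then real D else 0)"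
proof -
  have ee: "inner (eye D) (eye D) = real D" by (simp add: norm_eye flip: power2_norm_eq_inner)
  have 1: "inner (\<gamma> k) (\<gamma> l) = inner (eye D) (\<gamma> k * \<gamma> l)" if "k < N" "l < N" for k l
    using inner_mult_left[of "\<gamma> k" "eye D" "\<gamma> l"] cliffordD(1,2)[OF assms(1)] that by simp
  have "2 * inner (\<gamma> k) (\<gamma> l) = inner (eye D) (\<gamma> k * \<gamma> l + \<gamma> l * \<gamma> k)"
    using 1[of k l] 1[of l k] assms(2,3) by (simp add: inner_add_right inner_commute)
  then show ?thesis
    unfolding cliffordD(3)[OF assms] by (simp add: ee split: if_splits)
qed

text \<open>Anticommutation cancels the cross terms of the square, leaving the squared length of w
  times the unit.\<close>

lemma clifford_obs:
  assumes \<gamma>: "clifford D N \<gamma>" and w: "(\<Sum>k<N. (w k)\<^sup>2) = 1"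
  shows "obs D (\<Sum>k<N. w k *\<^sub>R \<gamma> k)"
proof -
  let ?X = "\<Sum>k<N. w k *\<^sub>R \<gamma> k"
  have sq: "?X * ?X = (\<Sum>k<N. \<Sum>l<N. (w k * w l) *\<^sub>R (\<gamma> k * \<gamma> l))"
    by (simp add: sum_product mult.commute)
  also have "\<dots> = (\<Sum>k<N. \<Sum>l<N. (w k * w l) *\<^sub>R (\<gamma> l * \<gamma> k))"
    by (subst sum.swap) (simp add: mult.commute)
  finally have "2 *\<^sub>R (?X * ?X) = (\<Sum>k<N. \<Sum>l<N. (w k * w l) *\<^sub>R (\<gamma> k * \<gamma> l + \<gamma> l * \<gamma> k))"
    using sq by (simp add: scaleR_2 scaleR_add_right sum.distrib)
  also have "\<dots> = (\<Sum>k<N. \<Sum>l<N. if l = k then (2 * (w k)\<^sup>2) *\<^sub>R eye D else 0)"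
    by (intro sum.cong refl) (auto simp: cliffordD(3)[OF \<gamma>] power2_eq_square)
  also have "\<dots> = 2 *\<^sub>R eye D"
    using w by (simp flip: scaleR_sum_left sum_distrib_left)
  finally have "?X * ?X = eye D" by simp
  moreover have "star ?X = ?X" using cliffordD(2)[OF \<gamma>] by simp
  moreover have "in_corner D ?X" by (intro corner_sum corner_scaleR cliffordD(1)[OF \<gamma>]) simp
  ultimately show ?thesis by (simp only: obs_def simp_thms)
qed

lemma clifford_inner_sum:
  assumes \<gamma>: "clifford D N \<gamma>"
  shows "inner (\<Sum>k<N. u k *\<^sub>R \<gamma> k) (\<Sum>k<N. w k *\<^sub>R \<gamma> k) = real D * (\<Sum>k<N. u k * w k)"
proof -
  have "inner (\<Sum>k<N. u k *\<^sub>R \<gamma> k) (\<Sum>l<N. w l *\<^sub>R \<gamma> l) = (\<Sum>k<N. \<Sum>l<N. u k * w l * inner (\<gamma> k) (\<gamma> l))"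
    unfolding inner_sum_left by (simp add: inner_sum_right sum_distrib_left mult_ac)
  also have "\<dots> = (\<Sum>k<N. \<Sum>l<N. if l = k then u k * w k * real D else 0)"
    by (intro sum.cong refl) (auto simp: clifford_inner[OF \<gamma>])
  finally show ?thesis by (simp add: sum_distrib_left mult_ac)
qed

text \<open>Distinct generators are orthogonal and have squared norm D, so the normalised trace form
  of two combinations is the inner product of their coefficient vectors. The maximally entangled
  state turns that into a correlation.\<close>

lemma tsirelson_realisation:
  fixes u :: "'r \<Rightarrow> nat \<Rightarrow> real" and w :: "'s \<Rightarrow> nat \<Rightarrow> real"
  assumes "\<And>i. (\<Sum>k<N. (u i k)\<^sup>2) = 1" "\<And>j. (\<Sum>k<N. (w j k)\<^sup>2) = 1"
  obtains D Y X where "D \<ge> 1" "xor_strategy D Y X (max_ent D)"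
    "\<And>i j. Re (expect (max_ent D) (kron (Y i) (X j))) = (\<Sum>k<N. u i k * w j k)"
proof -
  obtain D \<gamma> where D: "D \<ge> 1" and \<gamma>: "clifford D N \<gamma>" using clifford_exists by blast
  define U where "U = (\<lambda>i. \<Sum>k<N. u i k *\<^sub>R \<gamma> k)"
  define W where "W = (\<lambda>j. \<Sum>k<N. w j k *\<^sub>R \<gamma> k)"
  have UW: "obs D (U i)" "obs D (W j)" for i j
    unfolding U_def W_def using clifford_obs[OF \<gamma>] assms by auto
  define Y X where "Y = (\<lambda>i. cconj (of_fin D (U i)))" and "X = (\<lambda>j. of_fin D (W j))"
  have "is_obs D (Y i)" for i unfolding Y_def by (rule is_obs_cconj_of_fin[OF UW(1)])
  then have "xor_strategy D Y X (max_ent D)"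
    using D UW by (simp add: xor_strategy_def X_def is_obs_of_fin vnorm_max_ent)
  moreover have "Re (expect (max_ent D) (kron (Y i) (X j))) = (\<Sum>k<N. u i k * w j k)" for i j
    using D UW(1)[of i] UW(2)[of j]
    by (simp add: Y_def X_def Re_expect_max_ent[of _ D] obsD)
      (simp add: U_def W_def clifford_inner_sum[OF \<gamma>])
  ultimately show ?thesis using that D by blast
qed

section \<open>Correlation matrices and a concave maximisation problem\<close>

type_synonym 's sqmat = "((real, 's) Finite_Cartesian_Product.vec, 's) Finite_Cartesian_Product.vec"

abbreviation mentry :: "'s::finite sqmat \<Rightarrow> 's \<Rightarrow> 's \<Rightarrow> real" where
  "mentry W j l \<equiv> vec_nth (vec_nth W j) l"

text \<open>The Gram matrices of unit vectors indexed by Bob's questions, given by closed convex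
  conditions.\<close>

definition elliptope :: "'s::finite sqmat set" where
  "elliptope = {W. (\<forall>j. mentry W j j = 1) \<and> (\<forall>j l. mentry W j l = mentry W l j) \<and>
     (\<forall>x::'s \<Rightarrow> real. 0 \<le> (\<Sum>j\<in>UNIV. \<Sum>l\<in>UNIV. x j * x l * mentry W j l))}"

text \<open>Positivity is tested on the sum and the difference of two unit coordinate
  vectors.\<close>

lemma elliptope_entry_le:
  assumes W: "W \<in> elliptope"
  shows "\<bar>mentry W j l\<bar> \<le> 1"
proof (cases "j = l")
  case True
  then show ?thesis using W by (simp add: elliptope_def)
next
  case False
  have quad: "0 \<le> (\<Sum>a\<in>UNIV. \<Sum>b\<in>UNIV. x a * x b * mentry W a b)" for x
    using W by (simp add: elliptope_def)
  have "(\<Sum>a\<in>UNIV. \<Sum>b\<in>UNIV. x a * x b * mentry W a b) =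
      (\<Sum>a\<in>{j, l}. \<Sum>b\<in>{j, l}. x a * x b * mentry W a b)"
    if "\<And>a. a \<noteq> j \<Longrightarrow> a \<noteq> l \<Longrightarrow> x a = 0" for x :: "'a \<Rightarrow> real"
    using that
    by (intro sum.mono_neutral_cong_right) (auto intro!: sum.mono_neutral_cong_right)
  then have "0 \<le> (\<Sum>a\<in>{j, l}. \<Sum>b\<in>{j, l}. x a * x b * mentry W a b)"
    if "\<And>a. a \<noteq> j \<Longrightarrow> a \<noteq> l \<Longrightarrow> x a = 0" for x
    using quad[of x] that by simp
  from this[of "\<lambda>a. if a = j \<or> a = l then 1 else 0"] this[of "\<lambda>a. if a = j then 1 else if a = l then -1 else 0"]
  show ?thesis using W False by (simp add: elliptope_def)
qed

lemma compact_elliptope: "compact (elliptope :: 's::finite sqmat set)"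
  unfolding compact_eq_bounded_closed
proof
  show "bounded (elliptope :: 's sqmat set)"
    unfolding bounded_iff
  proof (intro exI ballI)
    fix W :: "'s sqmat"
    assume W: "W \<in> elliptope"
    have "norm W \<le> (\<Sum>j\<in>UNIV. norm (vec_nth W j))"
      unfolding norm_vec_def by (rule L2_set_le_sum) simp
    also have "\<dots> \<le> (\<Sum>j\<in>(UNIV::'s set). \<Sum>l\<in>(UNIV::'s set). 1)"
    proof (rule sum_mono)
      fix j
      have "norm (vec_nth W j) \<le> (\<Sum>l\<in>UNIV. norm (mentry W j l))"
        unfolding norm_vec_def by (rule L2_set_le_sum) simp
      also have "\<dots> \<le> (\<Sum>l\<in>(UNIV::'s set). 1)"
        by (rule sum_mono) (use elliptope_entry_le[OF W] in simp)
      finally show "norm (vec_nth W j) \<le> (\<Sum>l\<in>(UNIV::'s set). 1)" .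
    qed
    finally show "norm W \<le> (\<Sum>j\<in>(UNIV::'s set). \<Sum>l\<in>(UNIV::'s set). 1)" .
  qed
  show "closed (elliptope :: 's sqmat set)"
    unfolding elliptope_def
    by (intro closed_Collect_conj closed_Collect_all closed_Collect_eq closed_Collect_le continuous_intros)
qed

lemma elliptope_nonempty: "(elliptope :: 's::finite sqmat set) \<noteq> {}"
proof -
  have "vec_lambda (\<lambda>j. vec_lambda (\<lambda>l. if l = j then 1 else 0)) \<in> (elliptope :: 's sqmat set)"
    by (auto simp: elliptope_def if_distrib cong: if_cong intro!: sum_nonneg)
  then show ?thesis by blast
qed

definition row_form :: "('r \<Rightarrow> 's::finite \<Rightarrow> real) \<Rightarrow> 'r \<Rightarrow>
    's sqmat \<Rightarrow> real" where
  "row_form g i W = (\<Sum>j\<in>UNIV. \<Sum>l\<in>UNIV. g i j * g i l * mentry W j l)"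

text \<open>The best bias against unit vectors of Bob with Gram matrix \<open>W\<close>: in row i
  Alice's optimal unit vector is aligned with the weighted sum of his vectors, whose length is the
  square root of the row form.\<close>

definition row_value :: "('r::finite \<Rightarrow> 's::finite \<Rightarrow> real) \<Rightarrow>
    's sqmat \<Rightarrow> real" where
  "row_value g W = (\<Sum>i\<in>UNIV. sqrt (row_form g i W))"

lemma row_form_nonneg: "W \<in> elliptope \<Longrightarrow> 0 \<le> row_form g i W"
  by (simp add: row_form_def elliptope_def)

lemma row_value_attains_max: "\<exists>W\<in>elliptope. \<forall>W'\<in>elliptope. row_value g W' \<le> row_value g W"
proof (rule continuous_attains_sup[OF compact_elliptope elliptope_nonempty])
  show "continuous_on elliptope (row_value g)"
    unfolding row_value_def[abs_def] row_form_def by (intro continuous_intros)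
qed

text \<open>Both parts follow from (a + b)/2 - ((sqrt a + sqrt b)/2)^2 = ((sqrt a - sqrt
  b)/2)^2.\<close>

lemma sqrt_midpoint:
  assumes "0 \<le> a" "0 \<le> b"
  shows "(sqrt a + sqrt b) / 2 \<le> sqrt ((a + b) / 2)"
    and "sqrt ((a + b) / 2) \<le> (sqrt a + sqrt b) / 2 \<Longrightarrow> a = b"
proof -
  have eq: "(a + b) / 2 - ((sqrt a + sqrt b) / 2)\<^sup>2 = ((sqrt a - sqrt b) / 2)\<^sup>2"
    using assms by (simp add: power2_eq_square field_simps)
  then have "((sqrt a + sqrt b) / 2)\<^sup>2 \<le> (a + b) / 2" by (smt (verit) zero_le_power2)
  then show "(sqrt a + sqrt b) / 2 \<le> sqrt ((a + b) / 2)" by (rule real_le_rsqrt)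
  assume "sqrt ((a + b) / 2) \<le> (sqrt a + sqrt b) / 2"
  then have "(sqrt ((a + b) / 2))\<^sup>2 \<le> ((sqrt a + sqrt b) / 2)\<^sup>2"
    using assms by (intro power_mono) auto
  then have "((sqrt a - sqrt b) / 2)\<^sup>2 \<le> 0" unfolding eq[symmetric] using assms by simp
  then show "a = b" using assms by simp
qed

lemma row_form_unique:
  assumes W: "W \<in> elliptope" "\<forall>V\<in>elliptope. row_value g V \<le> row_value g W"
    and W': "W' \<in> elliptope" "row_value g W' = row_value g W"
  shows "row_form g i W' = row_form g i W"
proof -
  define M where "M = (1/2) *\<^sub>R (W + W')"
  have Mjl: "mentry M j l = (mentry W j l + mentry W' j l) / 2" for j l
    by (simp add: M_def)
  have avg: "(\<Sum>j\<in>UNIV. \<Sum>l\<in>UNIV. c j l * mentry M j l) =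
      ((\<Sum>j\<in>UNIV. \<Sum>l\<in>UNIV. c j l * mentry W j l) + (\<Sum>j\<in>UNIV. \<Sum>l\<in>UNIV. c j l * mentry W' j l)) / 2" for c
    unfolding Mjl by (simp add: sum.distrib[symmetric] sum_divide_distrib distrib_left)
  have "M \<in> elliptope"
    using W(1) W'(1) unfolding elliptope_def by (simp add: avg) (simp add: Mjl)
  then have "row_value g M \<le> row_value g W" using W(2) by blast
  moreover have qM: "row_form g i M = (row_form g i W + row_form g i W') / 2" for i
    unfolding row_form_def by (rule avg)
  \<comment> \<open>Row forms are linear in \<open>W\<close>, so each gap measures concavity of the
    square root at the midpoint. The gaps are nonnegative and maximality makes their sum
    nonpositive, so each vanishes.\<close>
  define gap where "gap = (\<lambda>i. sqrt (row_form g i M) - (sqrt (row_form g i W) + sqrt (row_form g i W')) / 2)"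
  have gap: "0 \<le> gap i" for i
    unfolding gap_def qM using sqrt_midpoint(1)[OF row_form_nonneg[OF W(1)] row_form_nonneg[OF W'(1)]] by simp
  have "(\<Sum>i\<in>UNIV. gap i) = row_value g M - (row_value g W + row_value g W') / 2"
    by (simp add: gap_def row_value_def sum_subtractf sum.distrib sum_divide_distrib[symmetric])
  ultimately have "(\<Sum>i\<in>UNIV. gap i) \<le> 0" using W'(2) by simp
  then have "gap i \<le> 0" using member_le_sum[of i UNIV gap] gap by simp
  then show ?thesis
    using sqrt_midpoint(2)[OF row_form_nonneg[OF W(1)] row_form_nonneg[OF W'(1)], of g i g i]
    unfolding gap_def qM by simp
qed

lemma elliptope_gram_in:
  fixes x :: "'s::finite \<Rightarrow> 'a::real_inner"
  assumes "\<And>j. norm (x j) = 1"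
  shows "vec_lambda (\<lambda>j. vec_lambda (\<lambda>l. inner (x j) (x l))) \<in> elliptope"
proof -
  have "(\<Sum>j\<in>UNIV. \<Sum>l\<in>UNIV. c j * c l * inner (x j) (x l)) =
      inner (\<Sum>j\<in>UNIV. c j *\<^sub>R x j) (\<Sum>j\<in>UNIV. c j *\<^sub>R x j)" for c
    unfolding inner_sum_left by (simp add: inner_sum_right sum_distrib_left mult_ac)
  then show ?thesis
    using assms by (simp add: elliptope_def inner_commute flip: power2_norm_eq_inner)
qed

lemma row_form_gram:
  fixes x :: "'s::finite \<Rightarrow> 'a::real_inner"
  shows "row_form g i (vec_lambda (\<lambda>j. vec_lambda (\<lambda>l. inner (x j) (x l)))) =
    (norm (\<Sum>j\<in>UNIV. g i j *\<^sub>R x j))\<^sup>2"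
  unfolding power2_norm_eq_inner row_form_def inner_sum_left
  by (simp add: inner_sum_right sum_distrib_left mult_ac)

text \<open>The vectors are the rows of a self-adjoint square root of \<open>W\<close>, from the
  spectral theorem for complex matrices. A complex row becomes real by listing its real and then its
  imaginary parts.\<close>

lemma elliptope_gram:
  fixes W :: "'s::finite sqmat"
  assumes W: "W \<in> elliptope"
  obtains N and w :: "'s \<Rightarrow> nat \<Rightarrow> real" where "\<And>j l. (\<Sum>k<N. w j k * w l k) = mentry W j l"
proof -
  define n where "n = CARD('s)"
  obtain h :: "'s \<Rightarrow> nat" where h: "bij_betw h UNIV {0..<n}"
    using ex_bij_betw_finite_nat[of "UNIV :: 's set"] by (auto simp: n_def)
  define h' where "h' = the_inv_into UNIV h"
  have h': "h' (h j) = j" for j using h by (simp add: h'_def the_inv_into_f_f bij_betw_def)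
  have hn: "h j < n" for j using h by (auto simp: bij_betw_def)
  have reindex: "(\<Sum>a<n. f (h' a)) = (\<Sum>j\<in>UNIV. f j)" for f :: "'s \<Rightarrow> real"
    using sum.reindex_bij_betw[OF h, of "\<lambda>a. f (h' a)"] by (simp add: h' lessThan_atLeast0)
  define ent where "ent = mentry W"
  have sym: "ent j l = ent l j" for j l using W by (simp add: ent_def elliptope_def)
  have psd: "0 \<le> (\<Sum>a<n. \<Sum>b<n. x a * x b * ent (h' a) (h' b))" for x
  proof -
    have "(\<Sum>a<n. \<Sum>b<n. x (h (h' a)) * x (h (h' b)) * ent (h' a) (h' b)) =
        (\<Sum>j\<in>UNIV. \<Sum>l\<in>UNIV. x (h j) * x (h l) * ent j l)"
      by (subst reindex[symmetric]) (simp add: reindex[symmetric])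
    moreover have "h (h' a) = a" if "a < n" for a
      unfolding h'_def using h that by (intro f_the_inv_into_f) (auto simp: bij_betw_def)
    ultimately have "(\<Sum>a<n. \<Sum>b<n. x a * x b * ent (h' a) (h' b)) = (\<Sum>j\<in>UNIV. \<Sum>l\<in>UNIV. x (h j) * x (h l) * ent j l)"
      by simp
    then show ?thesis using W by (simp add: elliptope_def ent_def)
  qed
  define G where "G = trunc_mat n (\<lambda>a b. complex_of_real (ent (h' a) (h' b)))"
  have G: "in_corner n G" "bounded_by G n" by (simp_all add: G_def in_corner_iff)
  have "star G = G" by (rule finmat_eqI) (auto simp: G_def sym)
  then obtain m l E where sp: "spectral_decomp (eye n) G m l E" using spectral_theorem[OF G(1)] by metis
  \<comment> \<open>Column by column, the real and imaginary parts of \<open>A\<close> contribute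
    two real quadratic forms of \<open>W\<close>. Applied to \<open>E i\<close>, this gives
    nonnegative eigenvalues.\<close>
  have quad: "0 \<le> inner A (G * A)" if A: "in_corner n A" for A
  proof -
    have "inner A (G * A) = (\<Sum>a<n. \<Sum>c<n. Re (cnj (entry A a c) * (\<Sum>b<n. entry G a b * entry A b c)))"
      using A by (simp add: inner_finmat_def cinner_eq[where n = n] in_corner_iff entry_times[OF G(2)])
    also have "\<dots> = (\<Sum>a<n. \<Sum>c<n. \<Sum>b<n. (Re (entry A a c) * Re (entry A b c) + Im (entry A a c) * Im (entry A b c)) * ent (h' a) (h' b))"
      unfolding sum_distrib_left Re_sum by (intro sum.cong refl) (simp add: G_def algebra_simps)
    also have "\<dots> = (\<Sum>c<n. \<Sum>a<n. \<Sum>b<n. (Re (entry A a c) * Re (entry A b c) + Im (entry A a c) * Im (entry A b c)) * ent (h' a) (h' b))"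
      by (rule sum.swap)
    also have "\<dots> = (\<Sum>c<n. (\<Sum>a<n. \<Sum>b<n. Re (entry A a c) * Re (entry A b c) * ent (h' a) (h' b)) +
        (\<Sum>a<n. \<Sum>b<n. Im (entry A a c) * Im (entry A b c) * ent (h' a) (h' b)))"
      by (simp add: distrib_right sum.distrib)
    also have "\<dots> \<ge> 0" by (intro sum_nonneg add_nonneg_nonneg psd)
    finally show ?thesis .
  qed
  have l: "0 \<le> l i" if i: "i < m" for i
  proof -
    have "G * E i = l i *\<^sub>R E i"
    proof -
      have "G * E i = (\<Sum>j<m. l j *\<^sub>R (E j * E i))" by (subst spectral_decompD(5)[OF sp]) (simp add: sum_distrib_right)
      also have "\<dots> = (\<Sum>j<m. if j = i then l i *\<^sub>R E i else 0)"
        using spectral_decompD(3)[OF sp _ i] by (intro sum.cong refl) auto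
      finally show ?thesis using i by simp
    qed
    moreover have "in_corner n (E i)"
    proof -
      have "eye n * E i = (\<Sum>j<m. E j * E i)" "E i * eye n = (\<Sum>j<m. E i * E j)"
        by (subst spectral_decompD(4)[OF sp], simp add: sum_distrib_right sum_distrib_left)+
      moreover have "(\<Sum>j<m. E j * E i) = (\<Sum>j<m. if j = i then E i else 0)"
        "(\<Sum>j<m. E i * E j) = (\<Sum>j<m. if j = i then E i else 0)"
        using spectral_decompD(3)[OF sp] i by (auto intro!: sum.cong)
      ultimately show ?thesis unfolding in_corner_def using i by (simp only: sum.delta) simp
    qed
    ultimately have "0 \<le> l i * inner (E i) (E i)" using quad[of "E i"] by simp
    moreover have "0 < inner (E i) (E i)" using spectral_decompD(2)[OF sp i] by simp
    ultimately show ?thesis by (simp add: zero_le_mult_iff)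
  qed
  define T where "T = (\<Sum>i<m. sqrt (l i) *\<^sub>R E i)"
  have "T * T = (\<Sum>i<m. (sqrt (l i) * sqrt (l i)) *\<^sub>R E i)" unfolding T_def by (rule spectral_calculus(1)[OF sp])
  also have "\<dots> = (\<Sum>i<m. l i *\<^sub>R E i)" using l by (intro sum.cong refl) simp
  also have "\<dots> = G" using spectral_decompD(5)[OF sp] ..
  finally have TT: "T * T = G" .
  have sT: "star T = T" unfolding T_def by (rule spectral_calculus(3)[OF sp])
  obtain p where p: "bounded_by T p" using ex_bounded_by by blast
  \<comment> \<open>The real inner product of two such vectors of length 2p is the real part of an
    entry of T T* = G.\<close>
  define w where "w = (\<lambda>j k. if k < p then Re (entry T (h j) k) else Im (entry T (h j) (k - p)))"
  have "(\<Sum>k<2 * p. w j k * w q k) = ent j q" for j q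
  proof -
    have "ent j q = Re (entry (T * star T) (h j) (h q))"
      using hn by (simp add: sT TT G_def h')
    also have "\<dots> = (\<Sum>k<p. Re (entry T (h j) k) * Re (entry T (h q) k) + Im (entry T (h j) k) * Im (entry T (h q) k))"
      by (simp add: entry_times[OF p])
    also have "\<dots> = (\<Sum>k<2 * p. w j k * w q k)"
      by (simp add: sum_two_blocks w_def sum.distrib)
    finally show ?thesis ..
  qed
  then show ?thesis using that[of w "2 * p"] by (simp add: ent_def)
qed

section \<open>XOR games\<close>

lemma obs_ftr: assumes "obs d X" shows "obs d (ftr X)"
proof -
  have "star (fconj X) = fconj X" "fconj X * fconj X = eye d"
    using assms by (simp_all add: obs_def flip: fconj_star fconj_mult)
  then show ?thesis using assms by (simp add: obs_def ftr_def)
qed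

lemma ftr_eye [simp]: "ftr (eye d) = eye d"
  by (simp add: ftr_def)

lemma norm_obs_mult:
  assumes "obs d X" "in_corner d M"
  shows "norm (X * M) = norm M" "norm (M * X) = norm M"
proof -
  have "inner (X * M) (X * M) = inner M M"
    by (simp only: inner_mult_left obsD(2)[OF assms(1)] obs_mult_mult[OF assms])
  moreover have "inner (M * X) (M * X) = inner M M"
    using assms by (simp add: inner_mult_right obsD mult.assoc)
  ultimately show "norm (X * M) = norm M" "norm (M * X) = norm M"
    by (simp_all add: norm_eq_sqrt_inner)
qed

text \<open>Alice's and Bob's vectors of a quantum strategy, with \<open>\<complex>\<^sup>d \<otimes> \<complex>\<^sup>d\<close> read as \<open>d \<times> d\<close> matrices.\<close>

definition alice_vec :: "nat \<Rightarrow> complex Matrix.vec \<Rightarrow> complex mat \<Rightarrow> finmat" where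
  "alice_vec d \<psi> Y = fin Y * fvec d \<psi>"

definition bob_vec :: "nat \<Rightarrow> complex Matrix.vec \<Rightarrow> complex mat \<Rightarrow> finmat" where
  "bob_vec d \<psi> X = fvec d \<psi> * ftr (fin X)"

context
  fixes d :: nat and Y :: "'r::finite \<Rightarrow> complex mat" and X :: "'s::finite \<Rightarrow> complex mat" and \<psi>
  assumes strat: "xor_strategy d Y X \<psi>"
begin

lemma strategy_carrier: "Y i \<in> carrier_mat d d" "X j \<in> carrier_mat d d" "\<psi> \<in> carrier_vec (d * d)"
  using strat unfolding xor_strategy_def is_obs_def by blast+

lemma strategy_obs: "obs d (fin (Y i))" "obs d (fin (X j))"
  using strat unfolding xor_strategy_def by (simp_all add: obs_fin)

lemma norm_strategy_vec: "norm (alice_vec d \<psi> (Y i)) = 1" "norm (bob_vec d \<psi> (X j)) = 1"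
proof -
  have "norm (fvec d \<psi>) = 1"
    using strat vnorm_fvec[OF strategy_carrier(3)] unfolding xor_strategy_def by simp
  then show "norm (alice_vec d \<psi> (Y i)) = 1" "norm (bob_vec d \<psi> (X j)) = 1"
    by (simp_all add: alice_vec_def bob_vec_def norm_obs_mult[of d] strategy_obs obs_ftr)
qed

lemma strategy_expect: "expect \<psi> (kron (Y i) (X j)) = cinner (alice_vec d \<psi> (Y i)) (bob_vec d \<psi> (X j))"
  unfolding expect_kron[OF strategy_carrier(1-3)] alice_vec_def bob_vec_def
  by (simp only: cinner_mult_left obsD(2)[OF strategy_obs(1)] mult.assoc)

abbreviation "bob_row g i \<equiv> (\<Sum>j\<in>UNIV. g i j *\<^sub>R bob_vec d \<psi> (X j))"

lemma xor_bias_eq: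
  "xor_bias g Y X \<psi> = (\<Sum>i\<in>UNIV. inner (alice_vec d \<psi> (Y i)) (bob_row g i))"
  by (simp add: xor_bias_def strategy_expect inner_sum_right flip: inner_finmat_def)

abbreviation "strategy_gram \<equiv>
  (vec_lambda (\<lambda>j. vec_lambda (\<lambda>l. inner (bob_vec d \<psi> (X j)) (bob_vec d \<psi> (X l)))) :: 's sqmat)"

lemma strategy_gram_in: "strategy_gram \<in> elliptope"
  by (rule elliptope_gram_in) (rule norm_strategy_vec)

lemma row_value_strategy:
  "row_value g strategy_gram = (\<Sum>i\<in>UNIV. norm (bob_row g i))" for g :: "'r \<Rightarrow> 's \<Rightarrow> real"
  by (simp add: row_value_def row_form_gram)

lemma alice_row_le:
  "inner (alice_vec d \<psi> (Y i)) (bob_row g i) \<le> norm (bob_row g i)"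
  using norm_cauchy_schwarz[of "alice_vec d \<psi> (Y i)" "bob_row g i"]
  by (simp add: norm_strategy_vec)

lemma xor_bias_le_row_value: "xor_bias g Y X \<psi> \<le> row_value g strategy_gram"
  unfolding xor_bias_eq row_value_strategy by (intro sum_mono alice_row_le)

text \<open>Equality in Cauchy-Schwarz forces Bob's weighted vector to be a multiple of Alice's.\<close>

lemma optimal_row:
  assumes "row_value g strategy_gram \<le> xor_bias g Y X \<psi>"
  shows "bob_row g i = sqrt (row_form g i strategy_gram) *\<^sub>R alice_vec d \<psi> (Y i)"
proof -
  define v where "v = (\<lambda>i. bob_row g i)"
  define y where "y = (\<lambda>i. alice_vec d \<psi> (Y i))"
  have le: "inner (y i) (v i) \<le> norm (v i)" for i unfolding v_def y_def by (rule alice_row_le)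
  have "(\<Sum>i\<in>UNIV. norm (v i) - inner (y i) (v i)) \<le> 0"
    using assms unfolding xor_bias_eq row_value_strategy v_def y_def by (simp add: sum_subtractf)
  then have "norm (v i) - inner (y i) (v i) \<le> 0"
    using member_le_sum[of i UNIV "\<lambda>i. norm (v i) - inner (y i) (v i)"] le by simp
  then have eq: "inner (y i) (v i) = norm (v i)" using le[of i] by simp
  have yy: "inner (y i) (y i) = 1" using norm_strategy_vec(1)[of i] by (simp add: y_def flip: power2_norm_eq_inner)
  have "inner (v i - norm (v i) *\<^sub>R y i) (v i - norm (v i) *\<^sub>R y i) =
      inner (v i) (v i) - 2 * norm (v i) * inner (y i) (v i) + norm (v i) * norm (v i) * inner (y i) (y i)"
    by (simp add: inner_diff_left inner_diff_right inner_commute algebra_simps)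
  also have "inner (v i) (v i) = norm (v i) * norm (v i)"
    by (simp add: power2_eq_square flip: power2_norm_eq_inner)
  finally have "inner (v i - norm (v i) *\<^sub>R y i) (v i - norm (v i) *\<^sub>R y i) = 0"
    unfolding eq yy by simp
  then have "v i = norm (v i) *\<^sub>R y i" by simp
  moreover have "sqrt (row_form g i strategy_gram) = norm (v i)" by (simp add: row_form_gram v_def)
  ultimately show ?thesis by (simp add: v_def y_def)
qed

lemma alice_bob_index:
  assumes "k < d * d"
  shows "(kron (Y i) (1\<^sub>m d) *\<^sub>v \<psi>) $ k = entry (alice_vec d \<psi> (Y i)) (k div d) (k mod d)"
    "(kron (1\<^sub>m d) (X j) *\<^sub>v \<psi>) $ k = entry (bob_vec d \<psi> (X j)) (k div d) (k mod d)"
proof -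
  have d: "d > 0" using assms by (cases d) auto
  have st: "k div d < d" "k mod d < d" using assms d by (simp_all add: less_mult_imp_div_less)
  have k: "k = k div d * d + k mod d" by simp
  have one: "1\<^sub>m d \<in> carrier_mat d d" by simp
  show "(kron (Y i) (1\<^sub>m d) *\<^sub>v \<psi>) $ k = entry (alice_vec d \<psi> (Y i)) (k div d) (k mod d)"
    using kron_mult_vec_index[OF strategy_carrier(1) one strategy_carrier(3) st, of i] strategy_carrier(1)[of i]
    by (simp add: alice_vec_def)
  show "(kron (1\<^sub>m d) (X j) *\<^sub>v \<psi>) $ k = entry (bob_vec d \<psi> (X j)) (k div d) (k mod d)"
    using kron_mult_vec_index[OF one strategy_carrier(2) strategy_carrier(3) st, of j]
    by (simp add: bob_vec_def)
qed

text \<open>The two clauses in the definite description of \<open>xor_row_bias\<close>, with the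
  value of c made explicit.\<close>

lemma optimal_row_equations:
  fixes i :: 'r and g :: "'r \<Rightarrow> 's \<Rightarrow> real"
  assumes "row_value g strategy_gram \<le> xor_bias g Y X \<psi>"
  defines "c \<equiv> sqrt (row_form g i strategy_gram)"
  shows "k < d * d \<Longrightarrow> (\<Sum>j\<in>UNIV. complex_of_real (g i j) * (kron (1\<^sub>m d) (X j) *\<^sub>v \<psi>) $ k)
      = complex_of_real c * (kron (Y i) (1\<^sub>m d) *\<^sub>v \<psi>) $ k"
    and "complex_of_real c = (\<Sum>j\<in>UNIV. complex_of_real (g i j) * expect \<psi> (kron (Y i) (X j)))"
proof -
  note row = optimal_row[OF assms(1), of i, folded c_def]
  assume k: "k < d * d"
  from arg_cong[OF row, of "\<lambda>A. entry A (k div d) (k mod d)"]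
  show "(\<Sum>j\<in>UNIV. complex_of_real (g i j) * (kron (1\<^sub>m d) (X j) *\<^sub>v \<psi>) $ k)
      = complex_of_real c * (kron (Y i) (1\<^sub>m d) *\<^sub>v \<psi>) $ k"
    by (simp add: alice_bob_index[OF k])
next
  note row = optimal_row[OF assms(1), of i, folded c_def]
  have "(\<Sum>j\<in>UNIV. complex_of_real (g i j) * expect \<psi> (kron (Y i) (X j))) =
      cinner (alice_vec d \<psi> (Y i)) (bob_row g i)"
    by (simp add: strategy_expect cinner_sum_right cinner_scaleR_right)
  then show "complex_of_real c = (\<Sum>j\<in>UNIV. complex_of_real (g i j) * expect \<psi> (kron (Y i) (X j)))"
    by (simp add: row cinner_scaleR_right cinner_self norm_strategy_vec)
qed

end

text \<open>Bob receives the Gram vectors of \<open>W\<close> and Alice the normalised row sums;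
  Tsirelson's construction turns both into observables.\<close>

lemma row_value_attained:
  fixes g :: "'r::finite \<Rightarrow> 's::finite \<Rightarrow> real"
  assumes W: "W \<in> elliptope"
  obtains d Y X \<psi> where "xor_strategy d Y X \<psi>" "xor_bias g Y X \<psi> = row_value g W"
proof -
  obtain N and w :: "'s \<Rightarrow> nat \<Rightarrow> real" where w: "\<And>j l. (\<Sum>k<N. w j k * w l k) = mentry W j l"
    using elliptope_gram[OF W] by metis
  have w1: "(\<Sum>k<N. (w j k)\<^sup>2) = 1" for j
    using w[of j j] W by (simp add: elliptope_def power2_eq_square)
  define v where "v = (\<lambda>i k. \<Sum>j\<in>UNIV. g i j * w j k)"
  define q where "q = (\<lambda>i. row_form g i W)"
  have vv: "(\<Sum>k<N. (v i k)\<^sup>2) = q i" for i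
  proof -
    have "(\<Sum>k<N. (v i k)\<^sup>2) = (\<Sum>k<N. \<Sum>j\<in>UNIV. \<Sum>l\<in>UNIV. g i j * g i l * (w j k * w l k))"
      by (simp add: v_def power2_eq_square sum_product mult_ac)
    also have "\<dots> = (\<Sum>j\<in>UNIV. \<Sum>k<N. \<Sum>l\<in>UNIV. g i j * g i l * (w j k * w l k))" by (rule sum.swap)
    also have "\<dots> = (\<Sum>j\<in>UNIV. \<Sum>l\<in>UNIV. \<Sum>k<N. g i j * g i l * (w j k * w l k))"
      by (intro sum.cong refl sum.swap)
    also have "\<dots> = q i" by (simp add: w q_def row_form_def flip: sum_distrib_left)
    finally show ?thesis .
  qed
  \<comment> \<open>If q i = 0 the row sum is zero and any unit vector serves; the one of an
    arbitrary question is taken.\<close>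
  define u where "u = (\<lambda>i k. if q i = 0 then w undefined k else v i k / sqrt (q i))"
  have q: "0 \<le> q i" for i unfolding q_def by (rule row_form_nonneg[OF W])
  have u1: "(\<Sum>k<N. (u i k)\<^sup>2) = 1" for i
    using q[of i] w1 by (cases "q i = 0") (simp_all add: u_def power_divide vv flip: sum_divide_distrib)
  have uv: "(\<Sum>k<N. u i k * v i k) = sqrt (q i)" for i
  proof (cases "q i = 0")
    case True
    then have "\<forall>k\<in>{..<N}. (v i k)\<^sup>2 = 0"
      using vv[of i] by (subst sum_nonneg_eq_0_iff[symmetric]) auto
    then show ?thesis using True by simp
  next
    case False
    then have "(\<Sum>k<N. u i k * v i k) = (\<Sum>k<N. (v i k)\<^sup>2) / sqrt (q i)"
      by (simp add: u_def power2_eq_square flip: sum_divide_distrib)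
    then show ?thesis using vv q by (simp add: real_div_sqrt)
  qed
  obtain D Y X where D: "xor_strategy D Y X (max_ent D)"
    "\<And>i j. Re (expect (max_ent D) (kron (Y i) (X j))) = (\<Sum>k<N. u i k * w j k)"
    by (rule tsirelson_realisation[of u N w, OF u1 w1], rule that, assumption, blast)
  have "(\<Sum>j\<in>UNIV. g i j * (\<Sum>k<N. u i k * w j k)) = sqrt (q i)" for i
  proof -
    have "(\<Sum>j\<in>UNIV. g i j * (\<Sum>k<N. u i k * w j k)) = (\<Sum>j\<in>UNIV. \<Sum>k<N. u i k * (g i j * w j k))"
      by (simp add: sum_distrib_left mult_ac)
    also have "\<dots> = (\<Sum>k<N. \<Sum>j\<in>UNIV. u i k * (g i j * w j k))" by (rule sum.swap)
    also have "\<dots> = (\<Sum>k<N. u i k * v i k)" by (simp add: v_def sum_distrib_left)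
    finally show ?thesis by (simp add: uv)
  qed
  then have "xor_bias g Y X (max_ent D) = row_value g W"
    by (simp add: xor_bias_def D(2) row_value_def q_def)
  then show ?thesis using that D(1) by blast
qed

text \<open>The Gram matrix of every optimal strategy maximises \<open>row_value\<close>, and all
  maximisers share their row forms. Hence one number satisfies the definite description, and these
  numbers sum to the maximum.\<close>

theorem sum_xor_row_bias:
  fixes g :: "'r::finite \<Rightarrow> 's::finite \<Rightarrow> real"
  shows "(\<Sum>i\<in>UNIV. xor_row_bias g i) = xor_opt_bias g"
proof -
  obtain W where W: "W \<in> elliptope" "\<forall>V\<in>elliptope. row_value g V \<le> row_value g W"
    using row_value_attains_max[of g] by blast
  obtain d0 Y0 X0 \<psi>0 where s0: "xor_strategy d0 Y0 X0 \<psi>0" "xor_bias g Y0 X0 \<psi>0 = row_value g W"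
    using row_value_attained[OF W(1)] by metis
  have upper: "xor_bias g Y X \<psi> \<le> row_value g W" if "xor_strategy d Y X \<psi>" for d Y X \<psi>
    using xor_bias_le_row_value[OF that, of g] W(2) strategy_gram_in[OF that] by fastforce
  have opt: "xor_opt_bias g = row_value g W"
    unfolding xor_opt_bias_def
  proof (rule cSup_eq_maximum)
    show "row_value g W \<in> {xor_bias g Y X \<psi> |d Y X \<psi>. xor_strategy d Y X \<psi>}"
      using s0 by (intro CollectI exI[of _ d0] exI[of _ Y0] exI[of _ X0] exI[of _ \<psi>0]) simp
  next
    fix x assume "x \<in> {xor_bias g Y X \<psi> |d Y X \<psi>. xor_strategy d Y X \<psi>}"
    then show "x \<le> row_value g W" using upper by blast
  qed
  let ?P = "\<lambda>d Y X \<psi> i c.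
      (\<forall>k<d*d. (\<Sum>j\<in>UNIV. complex_of_real (g i j) * (kron (1\<^sub>m d) (X j) *\<^sub>v \<psi>) $ k)
               = complex_of_real c * (kron (Y i) (1\<^sub>m d) *\<^sub>v \<psi>) $ k) \<and>
      complex_of_real c = (\<Sum>j\<in>UNIV. complex_of_real (g i j) * expect \<psi> (kron (Y i) (X j)))"
  define P where "P = (\<lambda>i c. \<forall>d Y X \<psi>. xor_optimal g d Y X \<psi> \<longrightarrow> ?P d Y X \<psi> i c)"
  have P: "P i (sqrt (row_form g i W))" for i
    unfolding P_def
  proof (intro allI impI)
    fix d Y X \<psi> assume "xor_optimal g d Y X \<psi>"
    then have s: "xor_strategy d Y X \<psi>" and b: "xor_bias g Y X \<psi> = row_value g W"
      by (simp_all add: xor_optimal_def opt)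
    let ?V = "vec_lambda (\<lambda>j. vec_lambda (\<lambda>l. inner (bob_vec d \<psi> (X j)) (bob_vec d \<psi> (X l)))) :: 's sqmat"
    have V: "?V \<in> elliptope" by (rule strategy_gram_in[OF s])
    have ge: "row_value g ?V \<le> xor_bias g Y X \<psi>" using W(2) V b by simp
    moreover have "xor_bias g Y X \<psi> \<le> row_value g ?V" by (rule xor_bias_le_row_value[OF s])
    ultimately have "row_value g ?V = row_value g W" using b by simp
    then have q: "row_form g i ?V = row_form g i W" by (rule row_form_unique[OF W V])
    from optimal_row_equations[OF s ge, where i = i]
    show "?P d Y X \<psi> i (sqrt (row_form g i W))" unfolding q by blast
  qed
  have "xor_row_bias g i = sqrt (row_form g i W)" for i
  proof -
    have "xor_row_bias g i = (THE c. P i c)" by (simp add: xor_row_bias_def P_def)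
    also have "\<dots> = sqrt (row_form g i W)"
    proof (rule the_equality)
      show "P i (sqrt (row_form g i W))" by (rule P)
      \<comment> \<open>Uniqueness needs an actual optimal strategy, since otherwise the condition
        on c would hold vacuously. Its second clause determines c.\<close>
      fix c assume "P i c"
      moreover have "xor_optimal g d0 Y0 X0 \<psi>0" using s0 by (simp add: xor_optimal_def opt)
      ultimately have "complex_of_real c = (\<Sum>j\<in>UNIV. complex_of_real (g i j) * expect \<psi>0 (kron (Y0 i) (X0 j)))"
        "complex_of_real (sqrt (row_form g i W)) = (\<Sum>j\<in>UNIV. complex_of_real (g i j) * expect \<psi>0 (kron (Y0 i) (X0 j)))"
        using P[of i] unfolding P_def by blast+
      then show "c = sqrt (row_form g i W)" by (metis of_real_eq_iff)
    qed
    finally show ?thesis .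
  qed
  then show ?thesis by (simp add: opt row_value_def)
qed

section \<open>Rounding approximate solutions of an XOR game\<close>

lemma mult_bound_sum:
  assumes "finite A" "\<And>x. x \<in> A \<Longrightarrow> mult_bound (k x) (f x)"
  shows "mult_bound (\<Sum>x\<in>A. k x) (\<Sum>x\<in>A. f x)"
  using assms
proof (induction A)
  case empty
  then show ?case by (simp add: mult_bound_def)
qed (simp add: mult_bound_add)

lemma xor_relsI:
  "Sub (Gen j) (Star (Gen j)) \<in> xor_rels g"
  "Sub (Mul (Gen j) (Gen j)) (Cst 1) \<in> xor_rels g"
  "Sub (Mul (ssum (\<lambda>j. Mul (Cst (complex_of_real (g i j))) (Gen j)) UNIV)
               (ssum (\<lambda>j. Mul (Cst (complex_of_real (g i j))) (Gen j)) UNIV))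
          (Cst (complex_of_real ((xor_row_bias g i)\<^sup>2))) \<in> xor_rels g"
  unfolding xor_rels_def by blast+

text \<open>Rescaling by |c| makes A^2 \<approx> c^2 into H^2 \<approx> 1, so the sign
  \<open>S\<close> is close to \<open>H\<close>. Cauchy-Schwarz applied to S and S - H then gives a
  loss that is linear in r.\<close>

lemma sign_correlation:
  assumes A: "in_corner d A" "star A = A" and c: "c \<noteq> 0"
    and close: "norm (A * A - c\<^sup>2 *\<^sub>R eye d) \<le> r * sqrt (real d)"
  shows "\<exists>S. obs d S \<and> inner S A \<ge> real d * (\<bar>c\<bar> - r / \<bar>c\<bar>)"
proof -
  define H where "H = (1 / \<bar>c\<bar>) *\<^sub>R A"
  have H: "in_corner d H" "star H = H" using A by (simp_all add: H_def)
  obtain S where S: "obs d S" "norm (S - H) \<le> norm (H * H - eye d)"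
    using sign_round[OF H] by metis
  have "H * H - eye d = (1 / c\<^sup>2) *\<^sub>R (A * A - c\<^sup>2 *\<^sub>R eye d)"
    using c by (simp add: H_def scaleR_diff_right power2_eq_square abs_mult[symmetric])
  then have "norm (H * H - eye d) \<le> (1 / c\<^sup>2) * (r * sqrt (real d))"
    using close by (simp add: divide_right_mono)
  then have SH: "norm (S - H) \<le> (1 / c\<^sup>2) * (r * sqrt (real d))" using S(2) by linarith
  have SS: "inner S S = real d" using inner_obs[OF S(1) S(1)] by simp
  then have nS: "norm S = sqrt (real d)" by (simp add: norm_eq_sqrt_inner)
  have "inner S (S - H) \<le> sqrt (real d) * ((1 / c\<^sup>2) * (r * sqrt (real d)))"
    using mult_left_mono[OF SH, of "norm S"] norm_cauchy_schwarz[of S "S - H"] by (simp add: nS)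
  also have "\<dots> = real d * (r / c\<^sup>2)" by simp
  finally have "real d - real d * (r / c\<^sup>2) \<le> inner S H" by (simp add: inner_diff_right SS)
  then have "\<bar>c\<bar> * (real d - real d * (r / c\<^sup>2)) \<le> \<bar>c\<bar> * inner S H" by (intro mult_left_mono) auto
  moreover have "\<bar>c\<bar> * inner S H = inner S A" using c by (simp add: H_def)
  moreover have "\<bar>c\<bar> * (real d - real d * (r / c\<^sup>2)) = real d * (\<bar>c\<bar> - r / \<bar>c\<bar>)"
  proof -
    have "a * (n - n * (r / a\<^sup>2)) = n * (a - r / a)" if "a \<noteq> 0" for a n :: real
      using that by (simp add: field_simps power2_eq_square)
    from this[of "\<bar>c\<bar>" "real d"] show ?thesis using c by simp
  qed
  ultimately show ?thesis using S(1) by auto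
qed

text \<open>Alice answers row i with the sign of \<open>A i\<close>, which correlates with it to
  about |c i|. Summed over the rows this reaches the optimal bias, by
  \<open>sum_xor_row_bias\<close>.\<close>

theorem xor_stability:
  fixes g :: "'r::finite \<Rightarrow> 's::finite \<Rightarrow> real"
  assumes K: "K > 0" and c: "\<And>i. xor_row_bias g i \<noteq> 0"
  shows "\<exists>C>0. \<exists>\<epsilon>0>0. \<forall>\<epsilon> (d::nat) (\<phi> :: 's \<Rightarrow> complex mat).
         0 \<le> \<epsilon> \<and> \<epsilon> \<le> \<epsilon>0 \<and> d \<ge> 1 \<and> eps_rep lfrob d (xor_rels g) \<epsilon> \<phi> \<and>
         (\<forall>j. op_norm (\<phi> j) \<le> K) \<longrightarrow>
         (\<exists>Y X. xor_strategy d Y X (max_ent d) \<and> (\<forall>j. lfrob (X j - \<phi> j) \<le> C * \<epsilon>) \<and>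
              xor_bias g Y X (max_ent d) \<ge> xor_opt_bias g - C * \<epsilon>)"
proof -
  define c where "c = xor_row_bias g"
  have c0: "c i \<noteq> 0" for i using assms(2) by (simp add: c_def)
  define G where "G = (\<lambda>i. \<Sum>j\<in>UNIV. \<bar>g i j\<bar>)"
  have G: "0 \<le> G i" for i by (simp add: G_def sum_nonneg)
  define L where "L = 2 + 2 * K"
  have L: "L > 0" using K by (simp add: L_def)
  \<comment> \<open>Bounds A^2 - c^2 = (A - B) A + B (A - B) + (B^2 - c^2), where \<open>B\<close>
    is formed from \<phi> and \<open>A\<close> from the rounded observables: A has bound
    \<open>G i\<close>, B has bound \<open>G i * K\<close>, and A - B is at most G i L
    \<delta>.\<close>
  define P where "P = (\<lambda>i. 1 + G i * (G i * L) + G i * K * (G i * L))"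
  have P: "0 \<le> P i" for i using G[of i] K L by (simp add: P_def)
  define D where "D = L + (\<Sum>i\<in>UNIV. P i / \<bar>c i\<bar>)"
  have S0: "0 \<le> (\<Sum>i\<in>UNIV. P i / \<bar>c i\<bar>)" using P by (intro sum_nonneg divide_nonneg_nonneg) auto
  then have D: "D > 0" "L \<le> D" "(\<Sum>i\<in>UNIV. P i / \<bar>c i\<bar>) \<le> D" using L by (simp_all add: D_def)
  show ?thesis
  proof (rule exI[of _ D], intro conjI D, rule exI[of _ 1], intro conjI allI impI)
    fix \<epsilon> :: real and d :: nat and \<phi> :: "'s \<Rightarrow> complex mat"
    assume "0 \<le> \<epsilon> \<and> \<epsilon> \<le> 1 \<and> d \<ge> 1 \<and> eps_rep lfrob d (xor_rels g) \<epsilon> \<phi> \<and> (\<forall>j. op_norm (\<phi> j) \<le> K)"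
    then have \<epsilon>: "0 \<le> \<epsilon>" and d: "d \<ge> 1" and rep: "eps_rep lfrob d (xor_rels g) \<epsilon> \<phi>"
      and op: "\<And>j. op_norm (\<phi> j) \<le> K" by auto
    have \<phi>: "\<And>s. \<phi> s \<in> carrier_mat d d" using rep unfolding eps_rep_def by blast
    define \<delta> where "\<delta> = \<epsilon> * sqrt (real d)"
    have \<delta>: "0 \<le> \<delta>" using \<epsilon> by (simp add: \<delta>_def)
    define F where "F = (\<lambda>j. fin (\<phi> j))"
    note rel = eps_rep_norm[OF \<phi> rep _ d, folded \<delta>_def]
    have F: "in_corner d (F j)" "mult_bound K (F j)" for j
      using \<phi> K op by (auto simp: F_def intro!: mult_bound_op_norm)
    note fs = fin_seval[OF \<phi>] fin_seval_ssum[OF \<phi>]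
    have F1: "norm (F j - star (F j)) \<le> \<delta>" for j
      using rel[OF xor_relsI(1), of j] by (simp add: fs F_def del: seval.simps(2-))
    have F2: "norm (F j * F j - eye d) \<le> \<delta>" for j
      using rel[OF xor_relsI(2), of j] by (simp add: fs F_def del: seval.simps(2-))
    define B where "B = (\<lambda>i. \<Sum>j\<in>UNIV. g i j *\<^sub>R F j)"
    have F3: "norm (B i * B i - (c i)\<^sup>2 *\<^sub>R eye d) \<le> \<delta>" for i
    proof -
      have "eye d * fin (\<phi> j) = F j" for j using F(1)[of j] by (simp add: F_def)
      then show ?thesis
        using rel[OF xor_relsI(3), of i] by (simp add: fs c_def B_def del: seval.simps(2-) of_real_power)
    qed
    have "\<forall>j. \<exists>X. obs d X \<and> norm (X - F j) \<le> L * \<delta>"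
      unfolding L_def using round_obs[OF F F1 F2] by blast
    then obtain X where X: "\<And>j. obs d (X j)" "\<And>j. norm (X j - F j) \<le> L * \<delta>" by metis
    define A where "A = (\<lambda>i. \<Sum>j\<in>UNIV. g i j *\<^sub>R X j)"
    have A: "in_corner d (A i)" "star (A i) = A i" for i
      using X(1) by (simp_all add: A_def obsD(1) obsD(2)[OF X(1)])
    have mA: "mult_bound (G i) (A i)" for i
      unfolding G_def A_def using mult_bound_scaleR[OF mult_bound_obs[OF X(1)]]
      by (intro mult_bound_sum) auto
    have mB: "mult_bound (G i * K) (B i)" for i
      unfolding G_def B_def sum_distrib_right by (intro mult_bound_sum mult_bound_scaleR F) simp
    have AB: "norm (A i - B i) \<le> G i * (L * \<delta>)" for i
    proof -
      have "norm (\<Sum>j\<in>UNIV. g i j *\<^sub>R (X j - F j)) \<le> (\<Sum>j\<in>UNIV. \<bar>g i j\<bar> * (L * \<delta>))"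
        by (rule sum_norm_le) (use X(2) in \<open>simp add: mult_left_mono\<close>)
      then show ?thesis by (simp add: A_def B_def G_def sum_distrib_right scaleR_diff_right sum_subtractf)
    qed
    have AA: "norm (A i * A i - (c i)\<^sup>2 *\<^sub>R eye d) \<le> P i * \<epsilon> * sqrt (real d)" for i
    proof -
      have "A i * A i - (c i)\<^sup>2 *\<^sub>R eye d = (A i - B i) * A i + B i * (A i - B i) + (B i * B i - (c i)\<^sup>2 *\<^sub>R eye d)"
        by (simp add: algebra_simps)
      moreover have "norm ((A i - B i) * A i) \<le> G i * (G i * (L * \<delta>))"
        by (rule order_trans[OF mult_boundD(2)[OF mA]]) (intro mult_left_mono AB G)
      moreover have "norm (B i * (A i - B i)) \<le> G i * K * (G i * (L * \<delta>))"
        using G[of i] K by (intro order_trans[OF mult_boundD(1)[OF mB]] mult_left_mono AB) simp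
      ultimately have "norm (A i * A i - (c i)\<^sup>2 *\<^sub>R eye d) \<le> G i * (G i * (L * \<delta>)) + G i * K * (G i * (L * \<delta>)) + \<delta>"
        using F3[of i] by (metis norm_triangle_mono)
      then show ?thesis by (simp add: P_def \<delta>_def algebra_simps)
    qed
    have "\<forall>i. \<exists>S. obs d S \<and> inner S (A i) \<ge> real d * (\<bar>c i\<bar> - P i * \<epsilon> / \<bar>c i\<bar>)"
      using sign_correlation[OF A c0 AA] by blast
    then obtain S where S: "\<And>i. obs d (S i)" "\<And>i. inner (S i) (A i) \<ge> real d * (\<bar>c i\<bar> - P i * \<epsilon> / \<bar>c i\<bar>)"
      by metis
    define Xm where "Xm = (\<lambda>j. of_fin d (X j))"
    define Ym where "Ym = (\<lambda>i. cconj (of_fin d (S i)))"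
    have "is_obs d (Ym i)" for i unfolding Ym_def by (rule is_obs_cconj_of_fin[OF S(1)])
    then have strat: "xor_strategy d Ym Xm (max_ent d)"
      using d X(1) by (simp add: xor_strategy_def Xm_def is_obs_of_fin vnorm_max_ent)
    have close: "lfrob (Xm j - \<phi> j) \<le> D * \<epsilon>" for j
      unfolding Xm_def
      by (rule lfrob_of_fin_diff_le[OF obsD(1)[OF X(1)] \<phi> d X(2)[unfolded F_def \<delta>_def] D(2) \<epsilon>])
    have bias: "xor_bias g Ym Xm (max_ent d) = (\<Sum>i\<in>UNIV. inner (S i) (A i) / real d)"
      using X(1) S(1)
      by (simp add: xor_bias_def Ym_def Xm_def Re_expect_max_ent[of _ d] obsD A_def inner_sum_right
          sum_divide_distrib)
    have "xor_opt_bias g - D * \<epsilon> \<le> (\<Sum>i\<in>UNIV. c i) - (\<Sum>i\<in>UNIV. P i / \<bar>c i\<bar>) * \<epsilon>"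
      using mult_right_mono[OF D(3) \<epsilon>] by (simp add: c_def sum_xor_row_bias)
    also have "\<dots> = (\<Sum>i\<in>UNIV. c i - P i * \<epsilon> / \<bar>c i\<bar>)"
      by (simp add: sum_subtractf sum_distrib_right)
    also have "\<dots> \<le> (\<Sum>i\<in>UNIV. inner (S i) (A i) / real d)"
    proof (rule sum_mono)
      fix i
      \<comment> \<open>The sign supplies |c i|, which is at least the c i that enters the optimal
        bias.\<close>
      have "c i - P i * \<epsilon> / \<bar>c i\<bar> \<le> \<bar>c i\<bar> - P i * \<epsilon> / \<bar>c i\<bar>" by simp
      also have "\<dots> \<le> inner (S i) (A i) / real d"
        using S(2)[of i] d by (subst pos_le_divide_eq) (simp_all add: mult.commute)
      finally show "c i - P i * \<epsilon> / \<bar>c i\<bar> \<le> inner (S i) (A i) / real d" .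
    qed
    also have "\<dots> = xor_bias g Ym Xm (max_ent d)" by (rule bias[symmetric])
    finally show "\<exists>Y X. xor_strategy d Y X (max_ent d) \<and> (\<forall>j. lfrob (X j - \<phi> j) \<le> D * \<epsilon>) \<and>
              xor_bias g Y X (max_ent d) \<ge> xor_opt_bias g - D * \<epsilon>"
      using strat close by blast
  qed simp
qed

theorem theorem1p2:
  fixes K :: real
  assumes "K > 0"
  shows
  "(\<forall>(\<eta> :: 'i::finite \<Rightarrow> 'i \<Rightarrow> real) (V :: 'a::finite \<Rightarrow> 'a \<Rightarrow> 'i \<Rightarrow> 'i \<Rightarrow> bool).
      sync_game \<eta> V \<longrightarrow>
      (\<exists>C>0. \<exists>\<epsilon>0>0. \<forall>\<epsilon> (d::nat) (\<phi> :: 'i \<times> 'a \<Rightarrow> complex mat).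
         0 \<le> \<epsilon> \<and> \<epsilon> \<le> \<epsilon>0 \<and> d \<ge> 1 \<and> eps_rep lfrob d (sync_rels V) \<epsilon> \<phi> \<and>
         (\<forall>ia. op_norm (\<phi> ia) \<le> K) \<longrightarrow>
         (\<exists>Q. sync_strategy d Q \<and> (\<forall>ia. lfrob (Q ia - \<phi> ia) \<le> C * \<epsilon>) \<and>
              sync_winprob \<eta> V Q (max_ent d) \<ge> 1 - C * \<epsilon>\<^sup>2)))
   \<and> (\<forall>(\<eta> :: 'c::finite \<Rightarrow> 'v::{finite,linorder} \<Rightarrow> real) (Ks :: 'c \<Rightarrow> 'v set) Sat.
      bcs_game \<eta> Ks Sat \<longrightarrow>
      (\<exists>C>0. \<exists>\<epsilon>0>0. \<forall>\<epsilon> (d::nat) (\<phi> :: 'v \<Rightarrow> complex mat).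
         0 \<le> \<epsilon> \<and> \<epsilon> \<le> \<epsilon>0 \<and> d \<ge> 1 \<and> eps_rep lfrob d (bcs_rels Ks Sat) \<epsilon> \<phi> \<and>
         (\<forall>j. op_norm (\<phi> j) \<le> K) \<longrightarrow>
         (\<exists>Y X. bcs_strategy d Ks Sat Y X \<and> (\<forall>j. lfrob (X j - \<phi> j) \<le> C * \<epsilon>) \<and>
              bcs_winprob \<eta> Ks Y X (max_ent d) \<ge> 1 - C * \<epsilon>\<^sup>2)))
   \<and> (\<forall>(t :: 'r::finite \<Rightarrow> 's::finite \<Rightarrow> bool) (\<pi> :: 'r \<Rightarrow> 's \<Rightarrow> real).
      prob_dist \<pi> \<and> (\<forall>i. xor_row_bias (xor_cost t \<pi>) i \<noteq> 0) \<longrightarrow>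
      (\<exists>C>0. \<exists>\<epsilon>0>0. \<forall>\<epsilon> (d::nat) (\<phi> :: 's \<Rightarrow> complex mat).
         0 \<le> \<epsilon> \<and> \<epsilon> \<le> \<epsilon>0 \<and> d \<ge> 1 \<and> eps_rep lfrob d (xor_rels (xor_cost t \<pi>)) \<epsilon> \<phi> \<and>
         (\<forall>j. op_norm (\<phi> j) \<le> K) \<longrightarrow>
         (\<exists>Y X. xor_strategy d Y X (max_ent d) \<and> (\<forall>j. lfrob (X j - \<phi> j) \<le> C * \<epsilon>) \<and>
              xor_bias (xor_cost t \<pi>) Y X (max_ent d) \<ge> xor_opt_bias (xor_cost t \<pi>) - C * \<epsilon>)))"
  by (intro conjI allI impI; (elim conjE)?)
    (rule synchronous_stability[OF assms] bcs_stability[OF assms] xor_stability[OF assms]; blast)+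

end
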